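(* Let $L/K$ be a finite Galois extension of fields with Galois group $\Gamma=\mathrm{Gal}(L/K)$, and suppose that $L/K$ admits a Hopf-Galois structure of type $G$. If $G$ is nilpotent then $\Gamma$ is soluble. Thus, if a finite Galois extension of fields admits a Hopf-Galois structure of nilpotent type, then the extension has soluble Galois group.
   Context: Hopf-Galois structures. Let $L/K$ be a finite field extension and $H$ a $K$-Hopf algebra with comultiplication $\Delta(h)=\sum_{(h)}h_{(1)}\otimes h_{(2)}$ and counit $\epsilon$. $L$ is an $H$-module algebra if $H$ acts on $L$ with $h\cdot(xy)=\sum_{(h)}(h_{(1)}\cdot x)(h_{(2)}\cdot y)$ and $h\cdot k=\epsilon(h)k$ for all $h\in H$, $x,y\in L$, $k\in K$. If moreover the $K$-linear map $L\otimes_K L\to \mathrm{Hom}_K(H,L)$, $x\otimes y\mapsto (h\mapsto x(h\cdot y))$, is bijective, then $L$ is an $H$-Galois extension of $K$, and $H$ is said to endow $L/K$ with a Hopf-Galois structure. Type. If $L/K$ is Galois with group $\Gamma$, then by Greither and Pareigis the Hopf-Galois structures on $L/K$, up to isomorphism, correspond bijectively to the regular subgroups $G$ of $\mathrm{Perm}(\Gamma)$ (the group of all permutations of the set $\Gamma$) that are normalized by the group $\lambda(\Gamma)$ of left translations by elements of $\Gamma$; the Hopf algebra corresponding to $G$ is the fixed-point algebra $L[G]^\Gamma$, where $\Gamma$ acts on $L$ by field automorphisms and on $G$ by conjugation via $\lambda(\Gamma)$. (A permutation group on a set is regular if it is transitive and all point stabilizers are trivial.) The type of the Hopf-Galois structure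 is the isomorphism type of $G$. Thus "$L/K$ admits a Hopf-Galois structure of type $G$" means that some regular subgroup of $\mathrm{Perm}(\Gamma)$ normalized by $\lambda(\Gamma)$ is isomorphic to $G$; in particular $|G|=|\Gamma|$. *)

theory Defs
  imports "HOL-Algebra.Algebra"
begin

section \<open>Finite Galois extensions\<close>

text \<open>A field extension \<open>L/K\<close> is given by a field \<open>L\<close> and a subfield \<open>K \<subseteq> carrier L\<close>. Since
  \<^const>\<open>ring_iso\<close> says nothing about values outside the carrier, automorphisms are taken in
  \<^const>\<open>Bij\<close>, i.e. extensional, so that there is exactly one function per automorphism.\<close>

definition field_auts :: "('a, 'b) ring_scheme \<Rightarrow> 'a set \<Rightarrow> ('a \<Rightarrow> 'a) set" where
  "field_auts L K = {\<sigma> \<in> ring_iso L L \<inter> Bij (carrier L). \<forall>k\<in>K. \<sigma> k = k}"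

definition galois_group :: "('a, 'b) ring_scheme \<Rightarrow> 'a set \<Rightarrow> ('a \<Rightarrow> 'a) monoid" where
  "galois_group L K = (BijGroup (carrier L)) \<lparr>carrier := field_auts L K\<rparr>"

locale finite_galois_extension = field L for L (structure) and K +
  assumes subfield_base: "subfield K L"
    and finite_degree: "finite_dimension K (carrier L)"
    and fixed_field: "{x \<in> carrier L. \<forall>\<sigma>\<in>field_auts L K. \<sigma> x = x} = K"

lemma subgroup_field_auts:
  assumes "K \<subseteq> carrier L" and "field L"
  shows "subgroup (field_auts L K) (BijGroup (carrier L))"
proof -
  interpret L: field L by fact
  interpret B: group "BijGroup (carrier L)" by (rule group_BijGroup)
  show ?thesis
  proof (rule B.subgroupI)
    show "field_auts L K \<subseteq> carrier (BijGroup (carrier L))"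
      by (auto simp: field_auts_def BijGroup_def)
    have "(\<lambda>x\<in>carrier L. x) \<in> field_auts L K"
      using assms(1) id_Bij[of "carrier L"]
      by (auto simp: field_auts_def ring_iso_def ring_hom_def Bij_def)
    then show "field_auts L K \<noteq> {}" by auto
  next
    fix s assume s: "s \<in> field_auts L K"
    then have sB: "s \<in> Bij (carrier L)" and sh: "s \<in> ring_hom L L"
      and sf: "\<And>k. k \<in> K \<Longrightarrow> s k = k"
      by (auto simp: field_auts_def ring_iso_def)
    let ?t = "\<lambda>x\<in>carrier L. inv_into (carrier L) s x"
    have tB: "?t \<in> Bij (carrier L)" using sB by (rule restrict_inv_into_Bij)
    have inj: "inj_on s (carrier L)" using sB by (auto simp: Bij_def bij_betw_def)
    have mult: "inv_into (carrier L) s (x \<otimes>\<^bsub>L\<^esub> y)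
        = inv_into (carrier L) s x \<otimes>\<^bsub>L\<^esub> inv_into (carrier L) s y"
      if "x \<in> carrier L" "y \<in> carrier L" for x y
      using that sh by (intro Bij_inv_into_lemma[OF _ sB]) (auto simp: ring_hom_mult)
    have add: "inv_into (carrier L) s (x \<oplus>\<^bsub>L\<^esub> y)
        = inv_into (carrier L) s x \<oplus>\<^bsub>L\<^esub> inv_into (carrier L) s y"
      if "x \<in> carrier L" "y \<in> carrier L" for x y
      using that sh by (intro Bij_inv_into_lemma[OF _ sB]) (auto simp: ring_hom_add)
    have fix': "inv_into (carrier L) s k = k" if "k \<in> carrier L" "s k = k" for k
      using inv_into_f_f[OF inj that(1)] that(2) by simp
    have one: "inv_into (carrier L) s \<one>\<^bsub>L\<^esub> = \<one>\<^bsub>L\<^esub>"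
      using ring_hom_one[OF sh] by (intro fix') auto
    have "?t \<in> ring_hom L L"
      using Bij_inv_into_mem[OF sB] mult add one
      by (intro ring_hom_memI) auto
    then have "?t \<in> field_auts L K"
      using tB assms(1) fix' sf by (auto simp: field_auts_def ring_iso_def Bij_def)
    then show "inv\<^bsub>BijGroup (carrier L)\<^esub> s \<in> field_auts L K"
      using inv_BijGroup[OF sB] by simp
  next
    fix s t assume "s \<in> field_auts L K" and "t \<in> field_auts L K"
    then have sB: "s \<in> Bij (carrier L)" and sh: "s \<in> ring_hom L L"
      and sf: "\<And>k. k \<in> K \<Longrightarrow> s k = k"
      and tB: "t \<in> Bij (carrier L)" and th: "t \<in> ring_hom L L"
      and tf: "\<And>k. k \<in> K \<Longrightarrow> t k = k"
      by (auto simp: field_auts_def ring_iso_def)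
    have B: "compose (carrier L) s t \<in> Bij (carrier L)" using sB tB by (rule compose_Bij)
    have "compose (carrier L) s t \<in> ring_hom L L"
      using sh th ring_hom_closed[OF th]
      by (intro ring_hom_memI)
        (auto simp: compose_def ring_hom_closed ring_hom_mult ring_hom_add ring_hom_one)
    then have "compose (carrier L) s t \<in> field_auts L K"
      using B assms(1) sf tf by (auto simp: field_auts_def ring_iso_def Bij_def compose_def)
    then show "s \<otimes>\<^bsub>BijGroup (carrier L)\<^esub> t \<in> field_auts L K"
      using sB tB by (simp add: BijGroup_def)
  qed
qed

lemma (in finite_galois_extension) group_galois_group: "group (galois_group L K)"
  unfolding galois_group_def
  using subgroup_field_auts[OF subfieldE(3)[OF subfield_base] field_axioms]
  by (rule subgroup.subgroup_is_group[OF _ group_BijGroup])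


section \<open>Hopf-Galois structures via regular subgroups\<close>

definition left_translation :: "('a, 'b) monoid_scheme \<Rightarrow> 'a \<Rightarrow> ('a \<Rightarrow> 'a)" where
  "left_translation G g = (\<lambda>x\<in>carrier G. g \<otimes>\<^bsub>G\<^esub> x)"

lemma (in group) left_translation_hom: "left_translation G \<in> hom G (BijGroup (carrier G))"
proof -
  have B: "left_translation G g \<in> Bij (carrier G)" if "g \<in> carrier G" for g
  proof -
    have "bij_betw (\<lambda>x. g \<otimes> x) (carrier G) (carrier G)"
      using that by (intro bij_betwI[where g = "\<lambda>x. inv g \<otimes> x"]) (auto simp: m_assoc[symmetric])
    then show ?thesis by (simp add: left_translation_def Bij_def)
  qed
  show ?thesis
    using B by (intro homI)
      (auto simp: BijGroup_def left_translation_def compose_def m_assoc intro!: restrict_ext)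
qed

definition regular_perm_group :: "'a set \<Rightarrow> ('a \<Rightarrow> 'a) set \<Rightarrow> bool" where
  "regular_perm_group S N \<longleftrightarrow>
     subgroup N (BijGroup S) \<and>
     transitive_action ((BijGroup S) \<lparr>carrier := N\<rparr>) S (\<lambda>\<eta>. \<eta>) \<and>
     (\<forall>x\<in>S. stabilizer ((BijGroup S) \<lparr>carrier := N\<rparr>) (\<lambda>\<eta>. \<eta>) x = {\<one>\<^bsub>BijGroup S\<^esub>})"

text \<open>By the theorem of Greither and Pareigis, the Hopf-Galois structures on a finite Galois
  extension \<open>L/K\<close> with group \<open>\<Gamma>\<close> correspond to the regular subgroups \<open>N\<close> of \<open>Perm(\<Gamma>)\<close>
  normalized by the left translations; the Hopf algebra is \<open>L[N]\<^sup>\<Gamma>\<close> and its type is the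
  isomorphism class of \<open>N\<close>.\<close>

definition admits_hopf_galois_of_type ::
    "('a, 'b) ring_scheme \<Rightarrow> 'a set \<Rightarrow> ('g, 'c) monoid_scheme \<Rightarrow> bool" where
  "admits_hopf_galois_of_type L K G \<longleftrightarrow>
     (let \<Gamma> = galois_group L K; P = BijGroup (carrier \<Gamma>) in
      \<exists>N. regular_perm_group (carrier \<Gamma>) N \<and>
          left_translation \<Gamma> ` carrier \<Gamma> \<subseteq> normalizer P N \<and>
          P \<lparr>carrier := N\<rparr> \<cong> G)"


section \<open>Nilpotent groups\<close>

primrec lower_central :: "('a, 'b) monoid_scheme \<Rightarrow> nat \<Rightarrow> 'a set" where
  "lower_central G 0 = carrier G"
| "lower_central G (Suc n) = generate G
     {h \<otimes>\<^bsub>G\<^esub> g \<otimes>\<^bsub>G\<^esub> inv\<^bsub>G\<^esub> h \<otimes>\<^bsub>G\<^esub> inv\<^bsub>G\<^esub> g | h g. h \<in> lower_central G n \<and> g \<in> carrier G}"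

definition nilpotent :: "('a, 'b) monoid_scheme \<Rightarrow> bool" where
  "nilpotent G \<longleftrightarrow> (\<exists>n. lower_central G n = {\<one>\<^bsub>G\<^esub>})"

end

theory Submission
  imports Defs "Jordan_Normal_Form.Schur_Decomposition"
begin

text \<open>Let \<open>N\<close> be a nilpotent regular subgroup of \<open>Perm(\<Gamma>)\<close> normalized by \<open>\<lambda>(\<Gamma>)\<close>. For every
  factorization \<open>|\<Gamma>| = a b\<close> with \<open>a\<close>, \<open>b\<close> coprime, the orbit of \<open>1\<close> under the Hall subgroup of
  order \<open>b\<close> of \<open>N\<close>, which is characteristic, is a subgroup of \<open>\<Gamma>\<close> of order \<open>b\<close>. These subgroups are
  soluble by induction on \<open>b\<close>: if \<open>b\<close> has at most two prime divisors, by Burnside's \<open>p\<^sup>a q\<^sup>b\<close>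
  theorem; otherwise by Wielandt's theorem, that a finite group with three soluble subgroups of
  pairwise coprime indices is soluble.

  Burnside's theorem is proved without representation theory: irreducible characters are replaced
  by the central idempotents obtained by splitting \<open>1\<close> into eigenvectors of multiplication by a
  class sum in the complex group algebra.\<close>

section \<open>Algebraic integers\<close>

text \<open>Normalization by left translations enters in one place. Let \<open>x\<close> and
  \<open>y\<close> lie in the orbit of 1 under a characteristic subgroup H of N, and let h in H send
  1 to \<open>y\<close>. Then \<lambda>(x) h \<lambda>(x)^-1 lies in H and sends \<open>x\<close> to
  the product of \<open>x\<close> and \<open>y\<close>, so the orbit is closed under products. The
  resulting bijection between \<Gamma> and N is a homomorphism only up to a twist, so the structure
  of N is not inherited; what passes to \<Gamma> is a supply of subgroups of prescribed order. Hence
  the use of two theorems that read solubility off orders and indices. For Burnside's theorem a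
  single class sum is split, so an idempotent gathers all irreducible characters \<chi> with the
  same value of \<chi>(g)/\<chi>(1). The available trace is the sum of \<chi>(1)\<chi>(g) over them,
  and the dimension is the sum of the \<chi>(1)^2. If \<open>p\<close> divides this dimension, the
  trace is shown to be divisible by the square root of \<open>p\<close> only; this still suffices,
  because 1/p would become an algebraic integer.\<close>

lemma algebraic_intI_module:
  fixes x :: complex
  assumes fin: "finite I" and i0: "i0 \<in> I" "w i0 \<noteq> 0"
    and eq: "\<And>i. i \<in> I \<Longrightarrow> x * w i = (\<Sum>j\<in>I. of_int (c i j) * w j)"
  shows "algebraic_int x"
proof -
  obtain b where b: "bij_betw b {0..<card I} I"
    using ex_bij_betw_nat_finite[OF fin] by blast
  define n where "n = card I"
  define A where "A = mat n n (\<lambda>(i,j). c (b i) (b j))"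
  define v where "v = vec n (\<lambda>i. w (b i))"
  have A: "A \<in> carrier_mat n n" "map_mat of_int A \<in> carrier_mat n n" by (auto simp: A_def)
  obtain k where k: "k < n" "b k = i0"
    using b i0(1) unfolding bij_betw_def n_def by (metis atLeastLessThan_iff imageE)
  \<comment> \<open>The numbers \<open>w i\<close> form an eigenvector with eigenvalue
    \<open>x\<close> of an integer matrix, whose characteristic polynomial is monic with integer
    coefficients.\<close>
  have "map_mat of_int A *\<^sub>v v = x \<cdot>\<^sub>v v"
  proof (rule eq_vecI)
    fix i assume "i < dim_vec (x \<cdot>\<^sub>v v)"
    then have i: "i < n" by (simp add: v_def)
    have bi: "b i \<in> I" using b i by (auto simp: bij_betw_def n_def)
    have "(map_mat of_int A *\<^sub>v v) $ i = (\<Sum>j = 0..<n. of_int (c (b i) (b j)) * w (b j))"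
      using i by (auto simp: A_def v_def scalar_prod_def)
    also have "\<dots> = (\<Sum>j\<in>I. of_int (c (b i) j) * w j)"
      using sum.reindex_bij_betw[OF b, of "\<lambda>j. of_int (c (b i) j) * w j"] by (simp add: n_def)
    also have "\<dots> = x * w (b i)" using eq[OF bi] by simp
    finally show "(map_mat of_int A *\<^sub>v v) $ i = (x \<cdot>\<^sub>v v) $ i" using i by (simp add: v_def)
  qed (auto simp: A_def v_def)
  moreover have "v \<noteq> 0\<^sub>v n"
  proof
    assume "v = 0\<^sub>v n"
    then have "v $ k = 0" using k by simp
    then show False using k i0(2) by (simp add: v_def)
  qed
  ultimately have "eigenvector (map_mat of_int A) v x"
    using A by (auto simp: eigenvector_def v_def)
  then have "poly (char_poly (map_mat of_int A)) x = 0"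
    using eigenvalue_root_char_poly[OF A(2)] by (auto simp: eigenvalue_def)
  then have "poly (map_poly of_int (char_poly A)) x = 0"
    by (simp add: of_int_hom.char_poly_hom[OF A(1)])
  moreover have "lead_coeff (char_poly A) = 1" using degree_monic_char_poly[OF A(1)] by auto
  ultimately show ?thesis unfolding algebraic_int_altdef_ipoly by blast
qed

text \<open>The powers below the degree of a monic integer polynomial span a module stable under
  multiplication by \<open>x\<close>, and this form of integrality passes to sums and products. As
  \<open>n > 0\<close>, the family contains \<open>x ^ 0 = 1\<close>, the nonzero member that
  \<open>algebraic_intI_module\<close> demands.\<close>

lemma algebraic_int_moduleE:
  fixes x :: complex
  assumes "algebraic_int x"
  obtains n :: nat and c :: "nat \<Rightarrow> nat \<Rightarrow> int" where "n > 0"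
    "\<And>i. i < n \<Longrightarrow> x * x ^ i = (\<Sum>j<n. of_int (c i j) * x ^ j)"
proof -
  obtain p :: "int poly" where p: "poly (map_poly of_int p) x = 0" "lead_coeff p = 1"
    using assms unfolding algebraic_int_altdef_ipoly by blast
  define n where "n = degree p"
  have sum0: "(\<Sum>i\<le>n. of_int (coeff p i) * x ^ i) = 0"
    using p(1) by (simp add: poly_altdef degree_map_poly coeff_map_poly n_def)
  then have top: "x ^ n = (\<Sum>j<n. of_int (- coeff p j) * x ^ j)"
    using p(2) by (simp add: lessThan_Suc_atMost[symmetric] n_def sum_negf eq_neg_iff_add_eq_0 add.commute)
  have n: "n > 0"
  proof (rule ccontr)
    assume "\<not> n > 0"
    then show False using sum0 p(2) by (simp add: n_def)
  qed
  \<comment> \<open>Companion matrix: every row but the last is a shift, and the last one is the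
    relation \<open>top\<close>.\<close>
  define c where "c i j = (if Suc i = n then - coeff p j else if j = Suc i then 1 else 0)" for i j
  have "x * x ^ i = (\<Sum>j<n. of_int (c i j) * x ^ j)" if "i < n" for i
  proof (cases "Suc i = n")
    case True
    then have "x * x ^ i = x ^ n" by (metis power_Suc)
    then show ?thesis using top True by (simp add: c_def)
  next
    case False
    then have *: "Suc i < n" using that by simp
    have "(\<Sum>j<n. of_int (c i j) * x ^ j) = (\<Sum>j<n. if j = Suc i then x ^ j else 0)"
      using False by (intro sum.cong) (auto simp: c_def)
    also have "\<dots> = x ^ Suc i" using * by (simp add: sum.delta)
    finally show ?thesis by simp
  qed
  with n that show ?thesis by blast
qed

text \<open>The products of a power of \<open>x\<close> and a power of \<open>y\<close> span a
  module stable under both. On it \<open>cx\<close> and \<open>cy\<close> are the matrices of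
  multiplication by \<open>x\<close> and by \<open>y\<close>: each acts on one index and leaves the
  other alone.\<close>

lemma algebraic_int_plus_times:
  fixes x y :: complex
  assumes "algebraic_int x" "algebraic_int y"
  shows "algebraic_int (x + y)" "algebraic_int (x * y)"
proof -
  obtain n c where n: "n > 0" and c: "\<And>i. i < n \<Longrightarrow> x * x ^ i = (\<Sum>j<n. of_int (c i j :: int) * x ^ j)"
    using algebraic_int_moduleE[OF assms(1)] by metis
  obtain m d where m: "m > 0" and d: "\<And>i. i < m \<Longrightarrow> y * y ^ i = (\<Sum>j<m. of_int (d i j :: int) * y ^ j)"
    using algebraic_int_moduleE[OF assms(2)] by metis
  let ?I = "{..<n} \<times> {..<m}"
  define w where "w = (\<lambda>(i,j). x ^ i * y ^ j)"
  have I: "finite ?I" "(0,0) \<in> ?I" "w (0,0) \<noteq> 0" using n m by (auto simp: w_def)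
  define cx :: "nat \<times> nat \<Rightarrow> nat \<times> nat \<Rightarrow> int" where "cx = (\<lambda>(i,j) (k,l). if l = j then c i k else 0)"
  define cy :: "nat \<times> nat \<Rightarrow> nat \<times> nat \<Rightarrow> int" where "cy = (\<lambda>(i,j) (k,l). if k = i then d j l else 0)"
  have x: "x * w ij = (\<Sum>kl\<in>?I. of_int (cx ij kl) * w kl)" if ij: "ij \<in> ?I" for ij
  proof -
    obtain i j where ij': "ij = (i,j)" "i < n" "j < m" using ij by auto
    have "x * w ij = (\<Sum>k<n. of_int (c i k) * x ^ k) * y ^ j"
      using c[OF ij'(2)] by (simp add: w_def ij'(1))
    also have "\<dots> = (\<Sum>k<n. \<Sum>l<m. if l = j then of_int (c i k) * x ^ k * y ^ l else 0)"
      using ij'(3) by (simp add: sum_distrib_right sum.delta)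
    also have "\<dots> = (\<Sum>kl\<in>?I. of_int (cx ij kl) * w kl)"
      unfolding sum.cartesian_product by (intro sum.cong) (auto simp: cx_def w_def ij'(1))
    finally show ?thesis .
  qed
  have y: "y * w ij = (\<Sum>kl\<in>?I. of_int (cy ij kl) * w kl)" if ij: "ij \<in> ?I" for ij
  proof -
    obtain i j where ij': "ij = (i,j)" "i < n" "j < m" using ij by auto
    have "y * w ij = x ^ i * (\<Sum>l<m. of_int (d j l) * y ^ l)"
      using d[OF ij'(3)] by (simp add: w_def ij'(1))
    also have "\<dots> = (\<Sum>k<n. if k = i then x ^ k * (\<Sum>l<m. of_int (d j l) * y ^ l) else 0)"
      using ij'(2) by (simp add: sum.delta)
    also have "\<dots> = (\<Sum>k<n. \<Sum>l<m. if k = i then of_int (d j l) * (x ^ k * y ^ l) else 0)"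
      by (intro sum.cong) (auto simp: sum_distrib_left mult_ac)
    also have "\<dots> = (\<Sum>kl\<in>?I. of_int (cy ij kl) * w kl)"
      unfolding sum.cartesian_product by (intro sum.cong) (auto simp: cy_def w_def ij'(1))
    finally show ?thesis .
  qed
  show "algebraic_int (x + y)"
    by (rule algebraic_intI_module[of ?I "(0,0)" w, OF I, where c = "\<lambda>i j. cx i j + cy i j"])
      (simp add: x y distrib_right sum.distrib)
  show "algebraic_int (x * y)"
  \<comment> \<open>The factor \<open>y\<close> is expanded first and \<open>x\<close> is then
    applied to each \<open>w k\<close>, so the matrix is \<open>cy\<close> times
    \<open>cx\<close>.\<close>
  proof (rule algebraic_intI_module[of ?I "(0,0)" w, OF I, where c = "\<lambda>i j. \<Sum>k\<in>?I. cy i k * cx k j"])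
    fix i assume i: "i \<in> ?I"
    have "x * y * w i = (\<Sum>k\<in>?I. of_int (cy i k) * (x * w k))"
      using y[OF i] by (simp add: sum_distrib_left mult_ac)
    also have "\<dots> = (\<Sum>k\<in>?I. \<Sum>j\<in>?I. of_int (cy i k) * of_int (cx k j) * w j)"
      using x by (intro sum.cong) (auto simp: sum_distrib_left mult_ac)
    also have "\<dots> = (\<Sum>j\<in>?I. \<Sum>k\<in>?I. of_int (cy i k) * of_int (cx k j) * w j)"
      by (rule sum.swap)
    also have "\<dots> = (\<Sum>j\<in>?I. of_int (\<Sum>k\<in>?I. cy i k * cx k j) * w j)"
      by (simp add: sum_distrib_right)
    finally show "x * y * w i = (\<Sum>j\<in>?I. of_int (\<Sum>k\<in>?I. cy i k * cx k j) * w j)" .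
  qed
qed

lemma algebraic_int_of_int: "algebraic_int (of_int k :: complex)"
  by (rule int_imp_algebraic_int) auto

lemma algebraic_int_of_nat: "algebraic_int (of_nat k :: complex)"
  by (rule int_imp_algebraic_int) auto

lemma algebraic_int_sum:
  fixes f :: "'i \<Rightarrow> complex"
  assumes "\<And>i. i \<in> I \<Longrightarrow> algebraic_int (f i)"
  shows "algebraic_int (sum f I)"
  using assms by (induction I rule: infinite_finite_induct) (auto intro: algebraic_int_plus_times)

lemma algebraic_int_sum_list:
  fixes xs :: "complex list"
  assumes "\<And>x. x \<in> set xs \<Longrightarrow> algebraic_int x"
  shows "algebraic_int (sum_list xs)"
  using assms by (induction xs) (auto intro: algebraic_int_plus_times)

lemma algebraic_int_prod_list:
  fixes xs :: "complex list"
  assumes "\<And>x. x \<in> set xs \<Longrightarrow> algebraic_int x"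
  shows "algebraic_int (prod_list xs)"
  using assms algebraic_int_of_nat[of 1] by (induction xs) (auto intro: algebraic_int_plus_times)

lemma algebraic_int_power_root:
  fixes x :: complex
  assumes "algebraic_int (x ^ m)" "m > 0"
  shows "algebraic_int x"
  by (rule algebraic_int_root[OF assms(1), of "monom 1 m"])
    (use assms(2) in \<open>auto simp: poly_monom degree_monom_eq\<close>)

lemma algebraic_int_unity_root: "(x :: complex) ^ m = 1 \<Longrightarrow> m > 0 \<Longrightarrow> algebraic_int x"
  using algebraic_int_of_nat[of 1] by (intro algebraic_int_power_root[of x m]) auto

text \<open>\<open>\<alpha>\<close> is an eigenvalue of a rational circulant matrix with nonnegative entries and row sums 1,
  and all eigenvalues of such a matrix lie in the unit disc. This replaces the Galois conjugates
  of \<open>\<alpha>\<close>.\<close>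

lemma unity_average_rat_poly:
  fixes \<alpha> :: complex
  assumes m: "m > 0" and ne: "\<mu>s \<noteq> []" and unity: "\<forall>\<mu>\<in>set \<mu>s. \<mu> ^ m = 1"
    and \<alpha>: "\<alpha> = sum_list \<mu>s / of_nat (length \<mu>s)"
  shows "\<exists>R :: rat poly. R \<noteq> 0 \<and> poly (map_poly of_rat R) \<alpha> = 0 \<and>
           (\<forall>z :: complex. poly (map_poly of_rat R) z = 0 \<longrightarrow> norm z \<le> 1)"
proof -
  define \<zeta> where "\<zeta> = cis (2 * pi / of_nat m)"
  have z1: "\<zeta> ^ m = 1" using m by (simp add: \<zeta>_def DeMoivre)
  have "\<exists>a<m. \<mu> = \<zeta> ^ a" if mu: "\<mu> \<in> set \<mu>s" for \<mu>
  proof -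
    have "\<mu> \<in> {z. z ^ m = 1}" using unity mu by auto
    then have "\<mu> \<in> (\<lambda>k. cis (2 * pi * real k / real m)) ` {..<m}"
      using bij_betw_roots_unity[OF m] by (auto simp: bij_betw_def)
    then obtain a where a: "a < m" "\<mu> = cis (2 * pi * real a / real m)" by auto
    have "\<zeta> ^ a = \<mu>" unfolding \<zeta>_def DeMoivre a(2) by (simp add: mult_ac)
    then show ?thesis using a(1) by auto
  qed
  then obtain a where a: "\<And>\<mu>. \<mu> \<in> set \<mu>s \<Longrightarrow> \<mu> = \<zeta> ^ a \<mu>" by metis
  define d where "d = length \<mu>s"
  have d: "d > 0" using ne by (simp add: d_def)
  define e where "e i = a (\<mu>s ! i)" for i
  have \<alpha>': "\<alpha> = (\<Sum>i<d. \<zeta> ^ e i) / of_nat d"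
  proof -
    have "sum_list \<mu>s = (\<Sum>i<d. \<mu>s ! i)"
      by (simp add: sum_list_sum_nth d_def atLeast0LessThan)
    also have "\<dots> = (\<Sum>i<d. \<zeta> ^ e i)"
      using a by (intro sum.cong) (auto simp: e_def d_def)
    finally show ?thesis using \<alpha> by (simp add: d_def)
  qed
  \<comment> \<open>The coefficient of \<zeta>^l in \<alpha> * \<zeta>^k once exponents are reduced
    modulo \<open>m\<close>, that is, the proportion of indices \<open>i\<close> for which
    \<open>k + e i\<close> is congruent to \<open>l\<close>. The vector of powers of \<zeta> is
    therefore an eigenvector for \<alpha>.\<close>
  define f where "f k l = (\<Sum>i<d. if (k + e i) mod m = l then 1 else 0 :: rat) / of_nat d" for k l
  have fnn: "f k l \<ge> 0" for k l
    by (auto simp: f_def intro!: divide_nonneg_nonneg sum_nonneg)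
  have frow: "(\<Sum>l<m. f k l) = 1" for k
  proof -
    have "(\<Sum>l<m. \<Sum>i<d. if (k + e i) mod m = l then 1 else 0 :: rat)
        = (\<Sum>i<d. \<Sum>l<m. if (k + e i) mod m = l then 1 else 0 :: rat)" by (rule sum.swap)
    also have "\<dots> = of_nat d" using m by (simp add: sum.delta')
    finally show ?thesis using d by (simp add: f_def flip: sum_divide_distrib)
  qed
  define A where "A = mat m m (\<lambda>(i,j). f i j)"
  define B where "B = (map_mat of_rat A :: complex mat)"
  have A: "A \<in> carrier_mat m m" and B: "B \<in> carrier_mat m m" by (auto simp: A_def B_def)
  have Bij: "B $$ (i,j) = of_rat (f i j)" if "i < m" "j < m" for i j
    using that by (simp add: B_def A_def)
  have cp: "char_poly B = map_poly of_rat (char_poly A)"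
    unfolding B_def by (rule of_rat_hom.char_poly_hom[OF A])
  have root: "poly (char_poly B) \<alpha> = 0"
  proof -
    define v where "v = vec m (\<lambda>k. \<zeta> ^ k)"
    have "B *\<^sub>v v = \<alpha> \<cdot>\<^sub>v v"
    proof (rule eq_vecI)
      fix k assume "k < dim_vec (\<alpha> \<cdot>\<^sub>v v)"
      then have k: "k < m" by (simp add: v_def)
      have "(B *\<^sub>v v) $ k = (\<Sum>l<m. of_rat (f k l) * \<zeta> ^ l)"
        using k by (auto simp: A_def B_def v_def scalar_prod_def atLeast0LessThan)
      also have "\<dots> = (\<Sum>l<m. \<Sum>i<d. (if (k + e i) mod m = l then \<zeta> ^ l else 0)) / of_nat d"
        unfolding f_def sum_divide_distrib
        by (intro sum.cong refl)
          (simp add: of_rat_divide of_rat_sum sum_distrib_right sum_divide_distrib if_distrib[of of_rat] if_distribR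
            cong: if_cong sum.cong, intro sum.cong, auto)
      also have "\<dots> = (\<Sum>i<d. \<Sum>l<m. (if (k + e i) mod m = l then \<zeta> ^ l else 0)) / of_nat d"
        by (subst sum.swap) (rule refl)
      also have "\<dots> = (\<Sum>i<d. \<zeta> ^ ((k + e i) mod m)) / of_nat d"
        using m by (simp add: sum.delta')
      also have "\<dots> = (\<Sum>i<d. \<zeta> ^ (k + e i)) / of_nat d"
      proof -
        have "\<zeta> ^ (j mod m) = \<zeta> ^ j" for j
        proof -
          have "\<zeta> ^ j = \<zeta> ^ (m * (j div m) + j mod m)" by simp
          also have "\<dots> = \<zeta> ^ (j mod m)" by (simp only: power_add power_mult z1) simp
          finally show ?thesis by simp
        qed
        then show ?thesis by simp
      qed
      also have "\<dots> = \<alpha> * \<zeta> ^ k"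
        unfolding \<alpha>' by (simp add: power_add sum_distrib_left sum_distrib_right mult_ac)
      finally show "(B *\<^sub>v v) $ k = (\<alpha> \<cdot>\<^sub>v v) $ k" using k by (simp add: v_def)
    qed (use B in \<open>auto simp: v_def\<close>)
    moreover have "v \<noteq> 0\<^sub>v m"
    proof
      assume "v = 0\<^sub>v m"
      then have "v $ 0 = 0" using m by simp
      then show False using m by (simp add: v_def)
    qed
    ultimately have "eigenvector B v \<alpha>" using B by (auto simp: eigenvector_def v_def)
    then show ?thesis using eigenvalue_root_char_poly[OF B] by (auto simp: eigenvalue_def)
  qed
  have bound: "norm z \<le> 1" if rz: "poly (char_poly B) z = 0" for z
  proof -
    obtain v where "eigenvector B v z"
      using rz eigenvalue_root_char_poly[OF B, of z] by (auto simp: eigenvalue_def)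
    then have v: "v \<in> carrier_vec m" "v \<noteq> 0\<^sub>v m" "B *\<^sub>v v = z \<cdot>\<^sub>v v"
      using B by (auto simp: eigenvector_def)
    \<comment> \<open>In the row \<open>k\<close> where the eigenvector is largest, the weights
      \<open>f k l\<close> average entries of norm at most \<open>M\<close>, so
      \<open>norm z * M\<close> cannot exceed \<open>M\<close>.\<close>
    define M where "M = Max ((\<lambda>i. norm (v $ i)) ` {..<m})"
    have "M \<in> (\<lambda>i. norm (v $ i)) ` {..<m}" unfolding M_def using m by (intro Max_in) auto
    then obtain k where k: "k < m" "norm (v $ k) = M" by auto
    have le: "norm (v $ i) \<le> M" if "i < m" for i unfolding M_def using that by (intro Max_ge) auto
    obtain i where "i < m" "v $ i \<noteq> 0" using v(1,2) by (metis carrier_vecD eq_vecI index_zero_vec zero_carrier_vec)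
    then have M: "M > 0" using le[of i] by (smt (verit) zero_less_norm_iff)
    have "z * v $ k = (B *\<^sub>v v) $ k" using v k by simp
    also have "\<dots> = (\<Sum>l<m. of_rat (f k l) * v $ l)"
      using k B v(1) by (auto simp: A_def B_def scalar_prod_def atLeast0LessThan)
    finally have "norm z * M \<le> (\<Sum>l<m. norm (of_rat (f k l) * v $ l))"
      using k by (metis norm_mult norm_sum)
    also have "\<dots> \<le> (\<Sum>l<m. of_rat (f k l) * M)"
    proof (rule sum_mono)
      fix l assume "l \<in> {..<m}"
      moreover have "norm (of_rat (f k l) :: complex) = of_rat (f k l)"
      proof -
        have "norm (of_rat (f k l) :: complex) = norm (complex_of_real (of_rat (f k l)))"
          by (cases "f k l") (simp add: of_rat_rat)
        also have "\<dots> = \<bar>real_of_rat (f k l)\<bar>" by (rule norm_of_real)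
        also have "\<dots> = of_rat (f k l)" using fnn[of k l] by (intro abs_of_nonneg) simp
        finally show ?thesis .
      qed
      ultimately show "norm (of_rat (f k l) * v $ l) \<le> of_rat (f k l) * M"
        using fnn le by (auto simp: norm_mult intro!: mult_left_mono)
    qed
    also have "\<dots> = of_rat (\<Sum>l<m. f k l) * M" by (simp add: of_rat_sum sum_distrib_right)
    finally show ?thesis using frow M by simp
  qed
  have "char_poly A \<noteq> 0" using degree_monic_char_poly[OF A] by auto
  then show ?thesis using root bound unfolding cp by blast
qed

lemma map_poly_mult_rat: "map_poly of_rat (p * q) = map_poly of_rat p * (map_poly of_rat q :: complex poly)"
proof -
  interpret map_poly_comm_ring_hom "of_rat :: rat \<Rightarrow> complex" ..
  show ?thesis by (rule hom_mult)
qed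

text \<open>Otherwise \<alpha> is nonzero and strictly inside the unit disc. The roots of its
  minimal polynomial \<open>G\<close> over the rationals are algebraic integers, since
  \<open>G\<close> divides \<open>P\<close>, and lie in the unit disc, since \<open>G\<close>
  divides \<open>R\<close>. Up to sign their product is a rational algebraic integer of norm below
  1, so 0 is a root of \<open>G\<close>, against minimality.\<close>

lemma unity_average_algebraic_int:
  fixes \<alpha> :: complex
  assumes m: "m > 0" and ne: "\<mu>s \<noteq> []" and unity: "\<forall>\<mu>\<in>set \<mu>s. \<mu> ^ m = 1"
    and \<alpha>: "\<alpha> = sum_list \<mu>s / of_nat (length \<mu>s)" and int: "algebraic_int \<alpha>"
  shows "\<alpha> = 0 \<or> norm \<alpha> = 1"
proof (rule ccontr)
  assume neg: "\<not> ?thesis"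
  define rt where "rt P z \<longleftrightarrow> poly (map_poly of_rat P) z = 0" for P :: "rat poly" and z :: complex
  obtain R :: "rat poly" where R: "R \<noteq> 0" "rt R \<alpha>" "\<And>z. rt R z \<Longrightarrow> norm z \<le> 1"
    using unity_average_rat_poly[OF m ne unity \<alpha>] unfolding rt_def by blast
  obtain p :: "int poly" where p: "poly (map_poly of_int p) \<alpha> = 0" "lead_coeff p = 1"
    using int unfolding algebraic_int_altdef_ipoly by blast
  define P where "P = (map_poly of_int p :: rat poly)"
  have mp: "map_poly of_rat P = (map_poly of_int p :: complex poly)"
    unfolding P_def by (subst map_poly_map_poly) (auto simp: o_def)
  define S where "S = {Q :: rat poly. Q \<noteq> 0 \<and> rt Q \<alpha>}"
  obtain G0 where G0: "G0 \<in> S" "\<And>Q. Q \<in> S \<Longrightarrow> degree G0 \<le> degree Q"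
    using ex_has_least_nat[of "\<lambda>Q. Q \<in> S" R degree] R by (auto simp: S_def)
  define G where "G = smult (inverse (lead_coeff G0)) G0"
  have G: "G \<noteq> 0" "lead_coeff G = 1" "rt G \<alpha>" and Gmin: "\<And>Q. Q \<in> S \<Longrightarrow> degree G \<le> degree Q"
    using G0 by (auto simp: G_def S_def rt_def of_rat_hom.map_poly_hom_smult)
  have dvd: "G dvd Q" if "rt Q \<alpha>" for Q
  proof (rule ccontr)
    assume "\<not> G dvd Q"
    then have ne: "Q mod G \<noteq> 0" by (simp add: dvd_eq_mod_eq_0)
    have "Q = Q div G * G + Q mod G" by simp
    then have "map_poly of_rat Q = map_poly of_rat (Q div G) * map_poly of_rat G
        + (map_poly of_rat (Q mod G) :: complex poly)"
      by (metis of_rat_hom.map_poly_hom_add map_poly_mult_rat)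
    then have "rt (Q mod G) \<alpha>" using that G(3) by (simp add: rt_def)
    then have "degree G \<le> degree (Q mod G)" using ne by (intro Gmin) (auto simp: S_def)
    moreover have "degree (Q mod G) < degree G \<or> Q mod G = 0" using degree_mod_less[OF G(1)] by auto
    ultimately show False using ne by auto
  qed
  have rt_dvd: "rt Q z" if "G dvd Q" "rt G z" for Q z
    using that by (auto simp: rt_def map_poly_mult_rat elim!: dvdE)
  have Gint: "algebraic_int z" and Gle: "norm z \<le> 1" if "rt G z" for z
  proof -
    have "rt P \<alpha>" unfolding rt_def mp by (rule p(1))
    then have "rt P z" using rt_dvd[OF dvd that] by blast
    then show "algebraic_int z" using p(2) unfolding rt_def mp algebraic_int_altdef_ipoly by blast
    show "norm z \<le> 1" using rt_dvd[OF dvd that] R by blast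
  qed
  define H where "H = (map_poly of_rat G :: complex poly)"
  have lH: "lead_coeff H = 1" using G(2) by (simp add: H_def)
  obtain zs where zs: "H = (\<Prod>z\<leftarrow>zs. [:- z, 1:])"
    using fundamental_theorem_algebra_factorized[of H] lH by auto
  have rtH: "rt G z \<longleftrightarrow> z \<in> set zs" for z
  proof -
    have "poly (\<Prod>z\<leftarrow>xs. [:- z, 1:]) z = 0 \<longleftrightarrow> z \<in> set xs" for xs :: "complex list"
      by (induction xs) auto
    then show ?thesis using zs by (simp add: rt_def H_def[symmetric])
  qed
  have c0: "coeff H 0 = prod_list (map uminus zs)"
  proof -
    have "coeff (\<Prod>z\<leftarrow>xs. [:- z, 1:]) 0 = prod_list (map uminus xs)" for xs :: "complex list"
      by (induction xs) (auto simp: coeff_mult_0)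
    then show ?thesis using zs by simp
  qed
  have "algebraic_int (coeff H 0)" unfolding c0
    using Gint rtH by (intro algebraic_int_prod_list) auto
  moreover have "coeff H 0 \<in> \<rat>" by (simp add: H_def)
  ultimately have "coeff H 0 \<in> \<int>" by (rule rational_algebraic_int_is_int)
  moreover have "norm (coeff H 0) < 1"
  proof -
    have le1: "norm (prod_list (map uminus xs)) \<le> 1" if "set xs \<subseteq> set zs" for xs
      using that
    proof (induction xs)
      case (Cons z xs)
      then have "norm z * norm (prod_list (map uminus xs)) \<le> 1 * 1"
        using Gle rtH by (intro mult_mono) auto
      then show ?case by (simp add: norm_mult)
    qed auto
    obtain xs ys where xy: "zs = xs @ \<alpha> # ys" using rtH G(3) by (meson split_list)
    have "norm (coeff H 0) = norm (prod_list (map uminus xs)) * norm \<alpha> * norm (prod_list (map uminus ys))"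
      unfolding c0 xy by (simp add: norm_mult)
    also have "\<dots> \<le> 1 * norm \<alpha> * 1"
      using le1[of xs] le1[of ys] xy by (intro mult_mono) auto
    also have "\<dots> < 1" using neg Gle[OF G(3)] by auto
    finally show ?thesis .
  qed
  ultimately have "coeff H 0 = 0" by (auto elim!: Ints_cases)
  then have "coeff G 0 = 0" by (simp add: H_def)
  \<comment> \<open>As \<alpha> is nonzero, cancelling the factor X leaves a polynomial of smaller
    degree that still has the root \<alpha>.\<close>
  then obtain G' where G': "G = pCons 0 G'" by (metis coeff_pCons_0 pCons_cases)
  have "rt G' \<alpha>" using G(3) neg by (simp add: G' rt_def of_rat_hom.map_poly_pCons_hom)
  moreover have "G' \<noteq> 0" using G(1) G' by auto
  ultimately have "degree G \<le> degree G'" by (intro Gmin) (auto simp: S_def)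
  then show False using G' \<open>G' \<noteq> 0\<close> by simp
qed

section \<open>Traces of matrices of finite order\<close>

lemma upper_triangular_pow:
  fixes B :: "complex mat"
  assumes B: "B \<in> carrier_mat n n" "upper_triangular B"
  shows "upper_triangular (B ^\<^sub>m k) \<and> (\<forall>i<n. (B ^\<^sub>m k) $$ (i,i) = (B $$ (i,i)) ^ k)"
proof (induction k)
  case (Suc k)
  let ?C = "B ^\<^sub>m k"
  have C: "?C \<in> carrier_mat n n" using B by simp
  have entry: "(?C * B) $$ (i,j) = (\<Sum>l = 0..<n. ?C $$ (i,l) * B $$ (l,j))" if "i < n" "j < n" for i j
    using that B(1) C by (simp add: scalar_prod_def)
  have up: "?C $$ (i,j) = 0" "B $$ (i,j) = 0" if "j < i" "i < n" for i j
    using Suc B C that by (auto dest: upper_triangularD)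
  have "(?C * B) $$ (i,j) = 0" if "j < i" "i < n" for i j
  proof -
    have "?C $$ (i,l) * B $$ (l,j) = 0" if "l < n" for l
      using up[of l i] up[of j l] \<open>j < i\<close> \<open>i < n\<close> that by (cases "l < i") auto
    then have "(\<Sum>l = 0..<n. ?C $$ (i,l) * B $$ (l,j)) = 0" by (intro sum.neutral) auto
    then show ?thesis using entry that by simp
  qed
  then have "upper_triangular (?C * B)" using B(1) C by auto
  moreover have "(?C * B) $$ (i,i) = (B $$ (i,i)) ^ Suc k" if i: "i < n" for i
  proof -
    have "(?C * B) $$ (i,i) = (\<Sum>l = 0..<n. if l = i then ?C $$ (i,i) * B $$ (i,i) else 0)"
      unfolding entry[OF i i] using up i
      by (intro sum.cong refl) (metis atLeastLessThan_iff linorder_neqE_nat mult_zero_left mult_zero_right)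
    also have "\<dots> = ?C $$ (i,i) * B $$ (i,i)" using i by (simp add: sum.delta)
    finally show ?thesis using Suc i by simp
  qed
  ultimately show ?case by simp
qed (use B in auto)

lemma trace_comm:
  fixes A B :: "complex mat"
  assumes "A \<in> carrier_mat n n" "B \<in> carrier_mat n n"
  shows "(\<Sum>i = 0..<n. (A * B) $$ (i,i)) = (\<Sum>i = 0..<n. (B * A) $$ (i,i))"
proof -
  have "(\<Sum>i = 0..<n. (A * B) $$ (i,i)) = (\<Sum>i = 0..<n. \<Sum>j = 0..<n. A $$ (i,j) * B $$ (j,i))"
    using assms by (intro sum.cong) (auto simp: scalar_prod_def)
  also have "\<dots> = (\<Sum>j = 0..<n. \<Sum>i = 0..<n. A $$ (i,j) * B $$ (j,i))" by (rule sum.swap)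
  also have "\<dots> = (\<Sum>i = 0..<n. (B * A) $$ (i,i))"
    using assms by (intro sum.cong) (auto simp: scalar_prod_def mult.commute)
  finally show ?thesis .
qed

lemma trace_similar:
  fixes A B :: "complex mat"
  assumes A: "A \<in> carrier_mat n n" and sim: "similar_mat_wit A B P Q"
  shows "(\<Sum>i = 0..<n. A $$ (i,i)) = (\<Sum>i = 0..<n. B $$ (i,i))"
proof -
  note w = similar_mat_witD2[OF A sim]
  have "(\<Sum>i = 0..<n. A $$ (i,i)) = (\<Sum>i = 0..<n. (P * (B * Q)) $$ (i,i))"
    using w by (simp add: assoc_mult_mat[of P n n B n Q n])
  also have "\<dots> = (\<Sum>i = 0..<n. ((B * Q) * P) $$ (i,i))"
    using w by (intro trace_comm) auto
  also have "(B * Q) * P = B" using w by (simp add: assoc_mult_mat[of B n n Q n P n])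
  finally show ?thesis .
qed

text \<open>\<open>F 0\<close> is a projection, in general not the identity, and \<open>F 1\<close>
  acts on its image with order dividing \<open>m\<close>. The numbers \<mu>s are the eigenvalues of
  \<open>F 1\<close> on this image, so there are as many as its dimension, which is the trace of
  \<open>F 0\<close>.\<close>

lemma finite_order_trace:
  fixes F :: "nat \<Rightarrow> 'i \<Rightarrow> 'i \<Rightarrow> complex"
  assumes fin: "finite I" and m: "m > 0"
    and comp: "\<And>k l x y. x \<in> I \<Longrightarrow> y \<in> I \<Longrightarrow> (\<Sum>z\<in>I. F k x z * F l z y) = F (k + l) x y"
    and per: "\<And>x y. x \<in> I \<Longrightarrow> y \<in> I \<Longrightarrow> F m x y = F 0 x y"
  shows "\<exists>\<mu>s. (\<forall>\<mu>\<in>set \<mu>s. \<mu> ^ m = 1) \<and> (\<Sum>x\<in>I. F 1 x x) = sum_list \<mu>s \<and>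
           (\<Sum>x\<in>I. F 0 x x) = of_nat (length \<mu>s)"
proof -
  obtain b where b: "bij_betw b {0..<card I} I"
    using ex_bij_betw_nat_finite[OF fin] by blast
  define n where "n = card I"
  have bI: "b i \<in> I" if "i < n" for i using b that by (auto simp: bij_betw_def n_def)
  have sumb: "(\<Sum>i = 0..<n. h (b i)) = sum h I" for h :: "'i \<Rightarrow> complex"
    using sum.reindex_bij_betw[OF b] by (simp add: n_def)
  define A where "A k = mat n n (\<lambda>(i,j). F k (b i) (b j))" for k
  have A: "A k \<in> carrier_mat n n" for k by (simp add: A_def)
  have mult: "A k * A l = A (k + l)" for k l
  proof (rule eq_matI)
    fix i j assume "i < dim_row (A (k + l))" "j < dim_col (A (k + l))"
    then have ij: "i < n" "j < n" by (auto simp: A_def)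
    have "(A k * A l) $$ (i,j) = (\<Sum>z = 0..<n. F k (b i) (b z) * F l (b z) (b j))"
      using ij by (simp add: A_def scalar_prod_def)
    also have "\<dots> = F (k + l) (b i) (b j)"
      using sumb[of "\<lambda>z. F k (b i) z * F l z (b j)"] comp bI ij by simp
    finally show "(A k * A l) $$ (i,j) = A (k + l) $$ (i,j)" using ij by (simp add: A_def)
  qed (auto simp: A_def)
  \<comment> \<open>Only positive exponents occur: the power with exponent 0 is the identity matrix,
    whereas \<open>A 0\<close> is the projection.\<close>
  have pow: "A 1 ^\<^sub>m Suc k = A (Suc k)" for k
  proof (induction k)
    case 0
    have "A 1 ^\<^sub>m Suc 0 = 1\<^sub>m n * A 1" using A[of 1] by simp
    then show ?case using left_mult_one_mat[OF A[of 1]] by simp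
  next
    case (Suc k)
    have "A 1 ^\<^sub>m Suc (Suc k) = A 1 ^\<^sub>m Suc k * A 1" by simp
    then show ?case by (simp only: Suc mult) simp
  qed
  have tr: "(\<Sum>i = 0..<n. A k $$ (i,i)) = (\<Sum>x\<in>I. F k x x)" for k
    using sumb[of "\<lambda>x. F k x x"] by (simp add: A_def)
  obtain es where "char_poly (A 1) = (\<Prod>a\<leftarrow>es. [:- a, 1:])"
    using char_poly_factorized[OF A] by blast
  from schur_upper_triangular[OF A this] obtain B P Q where
    B: "B \<in> carrier_mat n n" "upper_triangular B" and sim: "similar_mat_wit (A 1) B P Q"
    unfolding similar_mat_def by blast
  have simk: "similar_mat_wit (A 1 ^\<^sub>m k) (B ^\<^sub>m k) P Q" for k
    by (rule similar_mat_wit_pow[OF sim])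
  define \<mu> where "\<mu> i = B $$ (i,i)" for i
  have trk: "(\<Sum>i = 0..<n. (A 1 ^\<^sub>m k) $$ (i,i)) = (\<Sum>i = 0..<n. \<mu> i ^ k)" for k
    using trace_similar[OF _ simk, of k n] A[of 1] upper_triangular_pow[OF B, of k]
    by (simp add: \<mu>_def)
  have Am: "A (Suc m) = A 1"
  proof -
    have "A m = A 0" by (rule eq_matI) (auto simp: A_def per bI)
    then have "A m * A 1 = A 0 * A 1" by simp
    then show ?thesis by (simp add: mult)
  qed
  have "B ^\<^sub>m Suc m = B"
  proof -
    note w1 = similar_mat_witD2[OF _ similar_mat_wit_sym[OF simk[of "Suc m"]], of n n]
    note w2 = similar_mat_witD2[OF B(1) similar_mat_wit_sym[OF sim]]
    have "B ^\<^sub>m Suc m = Q * (A 1 ^\<^sub>m Suc m) * P" by (rule w1(3)) (rule pow_carrier_mat[OF B(1)])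
    also have "\<dots> = B" using w2(3) unfolding pow Am by simp
    finally show ?thesis .
  qed
  then have mum: "\<mu> i ^ Suc m = \<mu> i" if "i < n" for i
    using upper_triangular_pow[OF B, of "Suc m"] that by (simp add: \<mu>_def)
  \<comment> \<open>Zero diagonal entries come from the kernel of the projection and are dropped;
    the remaining ones are roots of unity by \<open>mum\<close>.\<close>
  define \<mu>s where "\<mu>s = filter (\<lambda>z. z \<noteq> 0) (map \<mu> [0..<n])"
  have 1: "\<forall>z\<in>set \<mu>s. z ^ m = 1" 
  proof
    fix z assume "z \<in> set \<mu>s"
    then obtain i where "i < n" "z = \<mu> i" "z \<noteq> 0" by (auto simp: \<mu>s_def)
    then have "z * z ^ m = z" "z \<noteq> 0" using mum[of i] by auto
    then show "z ^ m = 1" by simp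
  qed
  have fsum: "sum_list (filter (\<lambda>z. z \<noteq> 0) zs) = sum_list zs" for zs :: "complex list"
    by (induction zs) auto
  have "(\<Sum>x\<in>I. F 1 x x) = sum_list \<mu>s"
    using trk[of 1] A[of 1] pow[of 0] tr[of 1] unfolding \<mu>s_def fsum
    by (simp add: sum_list_sum_nth atLeast0LessThan)
  moreover have "(\<Sum>x\<in>I. F 0 x x) = of_nat (length \<mu>s)"
  proof -
    \<comment> \<open>The trace of \<open>F m\<close> counts the nonzero diagonal entries, since
      each of them contributes \<mu>^m = 1.\<close>
    have "(\<Sum>x\<in>I. F 0 x x) = (\<Sum>x\<in>I. F m x x)" using per by simp
    also have "\<dots> = (\<Sum>i = 0..<n. \<mu> i ^ m)"
      using tr[of m] trk[of m] pow[of "m - 1"] m by simp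
    also have "\<dots> = sum_list (map (\<lambda>z. z ^ m) (map \<mu> [0..<n]))"
      by (simp add: sum_list_sum_nth atLeast0LessThan)
    also have "\<dots> = of_nat (length \<mu>s)"
    proof -
      have "(\<forall>z\<in>set zs. z ^ Suc m = z) \<Longrightarrow>
        sum_list (map (\<lambda>z. z ^ m) zs) = of_nat (length (filter (\<lambda>z. z \<noteq> 0) zs))" for zs :: "complex list"
        using m by (induction zs) auto
      moreover have "\<forall>z\<in>set (map \<mu> [0..<n]). z ^ Suc m = z" using mum by (simp del: power_Suc)
      ultimately show ?thesis unfolding \<mu>s_def by blast
    qed
    finally show ?thesis .
  qed
  ultimately show ?thesis using 1 by blast
qed

section \<open>Eigenvector decomposition\<close>

text \<open>On a set of \<open>n\<close> points the \<open>n + 1\<close> functions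
  \<open>f 0\<close>, ..., \<open>f n\<close> are linearly dependent; the coefficients of
  \<open>q\<close> are those of a relation.\<close>

lemma exists_annihilating_poly:
  fixes f :: "nat \<Rightarrow> 'a \<Rightarrow> complex"
  assumes fin: "finite I"
  shows "\<exists>q. q \<noteq> 0 \<and> (\<forall>x\<in>I. (\<Sum>k\<le>degree q. coeff q k * f k x) = 0)"
proof -
  obtain b where b: "bij_betw b {0..<card I} I"
    using ex_bij_betw_nat_finite[OF fin] by blast
  define n where "n = card I"
  \<comment> \<open>The zero row makes the matrix square and singular, so that a vanishing
    determinant provides the kernel vector.\<close>
  define A where "A = mat (Suc n) (Suc n) (\<lambda>(i,j). if i < n then f j (b i) else 0)"
  have A: "A \<in> carrier_mat (Suc n) (Suc n)" by (simp add: A_def)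
  have "A\<^sup>T *\<^sub>v unit_vec (Suc n) n = 0\<^sub>v (Suc n)"
    by (rule eq_vecI) (auto simp: A_def)
  moreover have "unit_vec (Suc n) n \<noteq> (0\<^sub>v (Suc n) :: complex vec)" by simp
  ultimately have "\<exists>v. v \<in> carrier_vec (Suc n) \<and> v \<noteq> 0\<^sub>v (Suc n) \<and> A\<^sup>T *\<^sub>v v = 0\<^sub>v (Suc n)"
    using unit_vec_carrier[of "Suc n" n] by blast
  then have "det A\<^sup>T = 0"
    using A det_0_iff_vec_prod_zero_field[of "A\<^sup>T" "Suc n"] by simp
  then have "det A = 0" using det_transpose[OF A] by simp
  then obtain v where v: "v \<in> carrier_vec (Suc n)" "v \<noteq> 0\<^sub>v (Suc n)" "A *\<^sub>v v = 0\<^sub>v (Suc n)"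
    using det_0_iff_vec_prod_zero_field[OF A] by auto
  define q where "q = (\<Sum>k\<le>n. monom (v $ k) k)"
  have cq: "coeff q k = (if k \<le> n then v $ k else 0)" for k
    by (simp add: q_def coeff_sum)
  obtain k where k: "k \<le> n" "v $ k \<noteq> 0"
    using v(1,2) by (metis carrier_vecD eq_vecI index_zero_vec less_Suc_eq_le zero_carrier_vec)
  have "q \<noteq> 0" using cq[of k] k by auto
  moreover have "(\<Sum>k\<le>degree q. coeff q k * f k x) = 0" if xI: "x \<in> I" for x
  proof -
    obtain i where i: "i < n" "b i = x"
    proof -
      have "x \<in> b ` {0..<n}" using b xI by (simp add: bij_betw_def n_def)
      then show ?thesis using that by auto
    qed
    have "degree q \<le> n" using cq by (intro degree_le) auto
    then have "(\<Sum>k\<le>degree q. coeff q k * f k x) = (\<Sum>k\<le>n. coeff q k * f k x)"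
      by (intro sum.mono_neutral_left) (auto simp: coeff_eq_0)
    also have "\<dots> = (A *\<^sub>v v) $ i"
      using i v(1) by (auto simp: A_def scalar_prod_def cq atLeast0LessThan lessThan_Suc_atMost mult.commute
          intro!: sum.cong simp del: sum.atMost_Suc sum.lessThan_Suc sum.op_ivl_Suc)
    finally show ?thesis using v(3) i by simp
  qed
  ultimately show ?thesis by blast
qed

text \<open>The assumption \<open>semis\<close> holds for normal operators.\<close>

lemma eigen_decomposition:
  fixes T :: "('a \<Rightarrow> complex) \<Rightarrow> ('a \<Rightarrow> complex)"
  assumes fin: "finite I"
    and lin: "\<And>f g c. T (\<lambda>x. f x + c * g x) = (\<lambda>x. T f x + c * T g x)"
    and Wlin: "\<And>f g c. f \<in> W \<Longrightarrow> g \<in> W \<Longrightarrow> (\<lambda>x. f x + c * g x) \<in> W"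
    and WT: "\<And>f. f \<in> W \<Longrightarrow> T f \<in> W"
    and Wsup: "\<And>f x. f \<in> W \<Longrightarrow> x \<notin> I \<Longrightarrow> f x = 0"
    and semis: "\<And>f c. f \<in> W \<Longrightarrow> T (\<lambda>x. T f x - c * f x) = (\<lambda>x. c * (T f x - c * f x)) \<Longrightarrow>
                  T f = (\<lambda>x. c * f x)"
    and v: "v \<in> W"
  shows "\<exists>S w. finite S \<and> (\<forall>c\<in>S. w c \<in> W \<and> T (w c) = (\<lambda>x. c * w c x)) \<and> v = (\<lambda>x. \<Sum>c\<in>S. w c x)"
proof -
  define dec where "dec f \<longleftrightarrow>
    (\<exists>S w. finite S \<and> (\<forall>c\<in>S. w c \<in> W \<and> T (w c) = (\<lambda>x. c * w c x)) \<and> f = (\<lambda>x. \<Sum>c\<in>S. w c x))" for f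
  have T0: "T (\<lambda>x. 0) = (\<lambda>x. 0)" using lin[of "\<lambda>x. 0" "-1" "\<lambda>x. 0"] by simp
  have W0: "(\<lambda>x. 0) \<in> W" using Wlin[OF v v, of "-1"] by simp
  have Tsum: "T (\<lambda>x. f x + (\<Sum>c\<in>S. a c * w c x)) = (\<lambda>x. T f x + (\<Sum>c\<in>S. a c * T (w c) x))"
    if "finite S" for f S a and w :: "complex \<Rightarrow> 'a \<Rightarrow> complex"
    using that
  proof (induction S)
    case (insert c S)
    have "T (\<lambda>x. f x + (\<Sum>c\<in>insert c S. a c * w c x)) = T (\<lambda>x. (f x + (\<Sum>c\<in>S. a c * w c x)) + a c * w c x)"
      using insert by (simp add: add_ac)
    then show ?case unfolding lin insert.IH using insert by (simp add: add_ac)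
  qed simp
  have Wsum: "(\<lambda>x. f x + (\<Sum>c\<in>S. a c * w c x)) \<in> W"
    if "finite S" "f \<in> W" "\<forall>c\<in>S. w c \<in> W" for f S a and w :: "complex \<Rightarrow> 'a \<Rightarrow> complex"
    using that
  proof (induction S)
    case (insert c S)
    then have "(\<lambda>x. (f x + (\<Sum>c\<in>S. a c * w c x)) + a c * w c x) \<in> W" by (intro Wlin) auto
    then show ?case using insert by (simp add: add_ac)
  qed simp
  have WTn: "(T ^^ k) f \<in> W" if "f \<in> W" for k f using that by (induction k) (auto intro: WT)
  have step: "dec f" if f: "f \<in> W" and decD: "dec (\<lambda>x. T f x - c * f x)" for f c
  proof -
    obtain S w where S: "finite S" and w: "\<And>\<mu>. \<mu> \<in> S \<Longrightarrow> w \<mu> \<in> W \<and> T (w \<mu>) = (\<lambda>x. \<mu> * w \<mu> x)"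
      and eq: "(\<lambda>x. T f x - c * f x) = (\<lambda>x. \<Sum>\<mu>\<in>S. w \<mu> x)"
      using decD unfolding dec_def by blast
    have eq': "T f x = c * f x + (\<Sum>\<mu>\<in>S. w \<mu> x)" for x using fun_cong[OF eq, of x] by (simp add: algebra_simps)
    \<comment> \<open>T - c maps \<open>a \<mu> * w \<mu>\<close> to \<open>- w \<mu>\<close>, so
      adding these corrections to \<open>f\<close> removes from (T - c) f every component with \<mu>
      different from \<open>c\<close>.\<close>
    define a where "a \<mu> = - (1 / (\<mu> - c))" for \<mu>
    define f' where "f' = (\<lambda>x. f x + (\<Sum>\<mu>\<in>S-{c}. a \<mu> * w \<mu> x))"
    have f': "f' \<in> W" unfolding f'_def using S f w by (intro Wsum) auto
    have Tf': "T f' = (\<lambda>x. T f x + (\<Sum>\<mu>\<in>S-{c}. a \<mu> * (\<mu> * w \<mu> x)))"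
      unfolding f'_def using S w by (subst Tsum) auto
    define r where "r = (\<lambda>x. if c \<in> S then w c x else 0)"
    have D: "T f' x - c * f' x = r x" for x
    proof -
      have "T f' x - c * f' x = (\<Sum>\<mu>\<in>S. w \<mu> x) + (\<Sum>\<mu>\<in>S-{c}. a \<mu> * (\<mu> * w \<mu> x) - c * (a \<mu> * w \<mu> x))"
        unfolding Tf' unfolding f'_def by (simp add: eq' sum_subtractf sum_distrib_left algebra_simps)
      also have "(\<Sum>\<mu>\<in>S-{c}. a \<mu> * (\<mu> * w \<mu> x) - c * (a \<mu> * w \<mu> x)) = (\<Sum>\<mu>\<in>S-{c}. - w \<mu> x)"
      proof (rule sum.cong[OF refl])
        fix \<mu> assume "\<mu> \<in> S - {c}"
        then have "a \<mu> * (\<mu> - c) = -1" by (simp add: a_def)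
        moreover have "a \<mu> * (\<mu> * w \<mu> x) - c * (a \<mu> * w \<mu> x) = a \<mu> * (\<mu> - c) * w \<mu> x"
          by (simp add: algebra_simps)
        ultimately show "a \<mu> * (\<mu> * w \<mu> x) - c * (a \<mu> * w \<mu> x) = - w \<mu> x" by simp
      qed
      also have "(\<Sum>\<mu>\<in>S. w \<mu> x) = r x + (\<Sum>\<mu>\<in>S-{c}. w \<mu> x)"
        using S by (cases "c \<in> S") (auto simp: r_def sum.remove)
      finally show ?thesis by (simp add: sum_negf)
    qed
    \<comment> \<open>What is left of (T - c) f' is the component for the eigenvalue
      \<open>c\<close> itself. Thus (T - c)^2 kills f', and \<open>semis\<close> makes f' an
      eigenvector.\<close>
    have "T r = (\<lambda>x. c * r x)" unfolding r_def using w T0 by (cases "c \<in> S") auto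
    then have ev: "T f' = (\<lambda>x. c * f' x)" using D by (intro semis[OF f']) auto
    define w' where "w' = (\<lambda>\<mu>. if \<mu> = c then f' else (\<lambda>x. - a \<mu> * w \<mu> x))"
    have "w' \<mu> \<in> W \<and> T (w' \<mu>) = (\<lambda>x. \<mu> * w' \<mu> x)" if "\<mu> \<in> insert c S" for \<mu>
    proof (cases "\<mu> = c")
      case False
      then have "\<mu> \<in> S" using that by simp
      then show ?thesis using False w Wlin[OF W0, of "w \<mu>" "- a \<mu>"] lin[of "\<lambda>x. 0" "- a \<mu>" "w \<mu>"]
        by (simp add: w'_def T0 mult_ac)
    qed (use f' ev in \<open>simp add: w'_def\<close>)
    moreover have "f = (\<lambda>x. \<Sum>\<mu>\<in>insert c S. w' \<mu> x)"
    proof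
      fix x
      have "(\<Sum>\<mu>\<in>insert c S. w' \<mu> x) = f' x + (\<Sum>\<mu>\<in>S-{c}. w' \<mu> x)"
        using S by (subst sum.insert_remove) (auto simp: w'_def)
      also have "(\<Sum>\<mu>\<in>S-{c}. w' \<mu> x) = (\<Sum>\<mu>\<in>S-{c}. - (a \<mu> * w \<mu> x))"
        by (intro sum.cong) (auto simp: w'_def)
      finally show "f x = (\<Sum>\<mu>\<in>insert c S. w' \<mu> x)" by (simp add: f'_def sum_negf)
    qed
    ultimately show ?thesis unfolding dec_def using S by blast
  qed
  \<comment> \<open>Induction on the degree of a polynomial that annihilates \<open>f\<close>: a
    root \<open>c\<close> is split off, the cofactor annihilates (T - c) f, and \<open>step\<close>
    leads back to \<open>f\<close>.\<close>
  have main: "dec f"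
    if "f \<in> W" "q \<noteq> 0" "degree q = n" "\<forall>x\<in>I. (\<Sum>k\<le>n. coeff q k * (T ^^ k) f x) = 0" for f q n
    using that
  proof (induction n arbitrary: q f)
    case 0
    then have "coeff q 0 \<noteq> 0" by (metis leading_coeff_neq_0)
    then have "f = (\<lambda>x. 0)" using 0 Wsup[of f] by fastforce
    then show ?case unfolding dec_def by (intro exI[of _ "{}"]) auto
  next
    case (Suc n)
    then have "\<not> constant (poly q)" by (simp add: constant_degree)
    then obtain c where "poly q c = 0" using fundamental_theorem_of_algebra by blast
    then obtain r where r: "q = [:- c, 1:] * r" by (auto simp: poly_eq_0_iff_dvd)
    have r0: "r \<noteq> 0" using Suc.prems(2) r by auto
    have dr: "degree r = n" using Suc.prems(3) degree_mult_eq[of "[:- c, 1:]" r] r0 unfolding r by simp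
    define g where "g = (\<lambda>x. T f x - c * f x)"
    have g: "g \<in> W" using Wlin[OF WT[OF Suc.prems(1)] Suc.prems(1), of "-c"] by (simp add: g_def)
    have Tg: "(T ^^ k) g = (\<lambda>x. (T ^^ Suc k) f x - c * (T ^^ k) f x)" for k
    proof (induction k)
      case (Suc k)
      then show ?case using lin[of "(T ^^ Suc k) f" "-c" "(T ^^ k) f"] by simp
    qed (simp add: g_def)
    have "(\<Sum>k\<le>n. coeff r k * (T ^^ k) g x) = 0" if "x \<in> I" for x
    proof -
      have cq: "coeff q k = (case k of 0 \<Rightarrow> 0 | Suc j \<Rightarrow> coeff r j) - c * coeff r k" for k
        unfolding r by (simp add: coeff_pCons split: nat.split)
      have "0 = (\<Sum>k\<le>Suc n. coeff q k * (T ^^ k) f x)" using Suc.prems(4) that by simp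
      also have "\<dots> = (\<Sum>k\<le>Suc n. (case k of 0 \<Rightarrow> 0 | Suc j \<Rightarrow> coeff r j) * (T ^^ k) f x)
            - (\<Sum>k\<le>Suc n. c * coeff r k * (T ^^ k) f x)"
        unfolding cq by (simp only: left_diff_distrib sum_subtractf)
      also have "(\<Sum>k\<le>Suc n. (case k of 0 \<Rightarrow> 0 | Suc j \<Rightarrow> coeff r j) * (T ^^ k) f x)
            = (\<Sum>k\<le>n. coeff r k * (T ^^ Suc k) f x)"
        by (subst sum.atMost_Suc_shift) simp
      also have "(\<Sum>k\<le>Suc n. c * coeff r k * (T ^^ k) f x) = (\<Sum>k\<le>n. c * coeff r k * (T ^^ k) f x)"
        using dr by (simp add: coeff_eq_0)
      finally show ?thesis unfolding Tg by (simp add: sum_subtractf algebra_simps)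
    qed
    then have "dec g" using Suc.IH[OF g r0 dr] by simp
    then show ?case using step[OF Suc.prems(1)] unfolding g_def by blast
  qed
  obtain q where "q \<noteq> 0" "\<forall>x\<in>I. (\<Sum>k\<le>degree q. coeff q k * (T ^^ k) v x) = 0"
    using exists_annihilating_poly[OF fin, of "\<lambda>k. (T ^^ k) v"] by blast
  then have "dec v" using main[OF v] by blast
  then show ?thesis unfolding dec_def .
qed

section \<open>The group algebra\<close>

locale finite_group_algebra = group +
  assumes fin: "finite (carrier G)"
begin

lemma inv_cancel [simp]:
  assumes "x \<in> carrier G" "y \<in> carrier G"
  shows "inv x \<otimes> (x \<otimes> y) = y" "x \<otimes> (inv x \<otimes> y) = y"
  using assms by (simp_all flip: m_assoc)

abbreviation n :: complex where "n \<equiv> of_nat (card (carrier G))"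

lemma n_pos: "card (carrier G) > 0"
  using fin by (auto simp: card_gt_0_iff)

lemma sum_translate:
  assumes "a \<in> carrier G" "b \<in> carrier G"
  shows "(\<Sum>x\<in>carrier G. f (a \<otimes> x \<otimes> b)) = sum f (carrier G)"
  using assms
  by (intro sum.reindex_bij_witness[where i = "\<lambda>x. inv a \<otimes> x \<otimes> inv b" and j = "\<lambda>x. a \<otimes> x \<otimes> b"])
    (auto simp: m_assoc)

lemma sum_translate_left:
  assumes "a \<in> carrier G"
  shows "(\<Sum>x\<in>carrier G. f (a \<otimes> x)) = sum f (carrier G)"
  using assms
  by (intro sum.reindex_bij_witness[where i = "\<lambda>x. inv a \<otimes> x" and j = "\<lambda>x. a \<otimes> x"]) auto

text \<open>The centre of the complex group algebra. Vanishing off the carrier makes equality in the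
  algebra plain equality of functions.\<close>

definition class_fun :: "('a \<Rightarrow> complex) set" where
  "class_fun = {f. (\<forall>x. x \<notin> carrier G \<longrightarrow> f x = 0) \<and>
                   (\<forall>x\<in>carrier G. \<forall>y\<in>carrier G. f (x \<otimes> y) = f (y \<otimes> x))}"

lemma class_fun_comm:
  "f \<in> class_fun \<Longrightarrow> x \<in> carrier G \<Longrightarrow> y \<in> carrier G \<Longrightarrow> f (x \<otimes> y) = f (y \<otimes> x)"
  by (simp add: class_fun_def)

lemma class_fun_conj:
  assumes "f \<in> class_fun" "x \<in> carrier G" "y \<in> carrier G"
  shows "f (x \<otimes> y \<otimes> inv x) = f y"
  using class_fun_comm[OF assms(1), of "x \<otimes> y" "inv x"] assms by simp

definition conv :: "('a \<Rightarrow> complex) \<Rightarrow> ('a \<Rightarrow> complex) \<Rightarrow> 'a \<Rightarrow> complex" where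
  "conv a b = (\<lambda>x. if x \<in> carrier G then \<Sum>y\<in>carrier G. a y * b (inv y \<otimes> x) else 0)"

lemma conv_comm:
  assumes "a \<in> class_fun"
  shows "conv a b = conv b a"
proof
  fix x
  show "conv a b x = conv b a x"
  proof (cases "x \<in> carrier G")
    case x: True
    have "(\<Sum>y\<in>carrier G. a y * b (inv y \<otimes> x)) = (\<Sum>y\<in>carrier G. a (x \<otimes> inv y) * b y)"
      using x by (intro sum.reindex_bij_witness[where i = "\<lambda>y. x \<otimes> inv y" and j = "\<lambda>y. inv y \<otimes> x"])
        (auto simp: m_assoc inv_mult_group)
    then show ?thesis using x class_fun_comm[OF assms]
      by (auto simp: conv_def mult.commute intro!: sum.cong)
  qed (simp add: conv_def)
qed

text \<open>The model is a sum of functions \<chi>(1) \<chi>(x^-1) / n over irreducible characters.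
  The third clause says that \<open>e\<close> equals its product with its involute, the function
  with value \<open>cnj (e (inv x))\<close> at \<open>x\<close>. At \<open>\<one>\<close> this makes
  \<open>e \<one>\<close> the sum of all |e y|^2, so that the last clause excludes just
  \<open>e = 0\<close>.\<close>

definition idem :: "('a \<Rightarrow> complex) \<Rightarrow> bool" where
  "idem e \<longleftrightarrow> e \<in> class_fun \<and> conv e e = e \<and>
     (\<forall>z\<in>carrier G. e z = (\<Sum>y\<in>carrier G. e y * cnj (e (inv z \<otimes> y)))) \<and> e \<one> \<noteq> 0"

lemma idemD:
  assumes "idem e"
  shows "e \<in> class_fun" "conv e e = e" "e \<one> \<noteq> 0"
    "z \<in> carrier G \<Longrightarrow> e z = (\<Sum>y\<in>carrier G. e y * cnj (e (inv z \<otimes> y)))"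
  using assms unfolding idem_def by blast+

lemma idem_conv:
  assumes "idem e" "x \<in> carrier G"
  shows "(\<Sum>y\<in>carrier G. e y * e (inv y \<otimes> x)) = e x"
proof -
  have "conv e e x = e x" using idemD(2)[OF assms(1)] by simp
  then show ?thesis using assms(2) by (simp add: conv_def)
qed

lemma idem_one:
  assumes "idem e"
  shows "e \<one> = of_real (\<Sum>y\<in>carrier G. (norm (e y))\<^sup>2)"
proof -
  have "e \<one> = (\<Sum>y\<in>carrier G. e y * cnj (e (inv \<one> \<otimes> y)))"
    by (rule idemD(4)[OF assms]) simp
  also have "\<dots> = (\<Sum>y\<in>carrier G. of_real ((norm (e y))\<^sup>2))"
    by (intro sum.cong) (auto simp: complex_norm_square simp del: of_real_power)
  finally show ?thesis by simp
qed

lemma nat_pow_add_split: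
  assumes "g \<in> carrier G"
  shows "inv (g [^] (k + l :: nat)) = inv (g [^] l) \<otimes> inv (g [^] k)"
  using assms by (simp add: nat_pow_mult[symmetric] inv_mult_group)

text \<open>The sum over \<open>x\<close> is the trace of v \<mapsto> g v h on the ideal generated
  by \<open>e\<close>, and \<open>n * e \<one>\<close> is the dimension of that ideal. The order of
  this operator divides the group order.\<close>

lemma idem_trace:
  assumes e: "idem e" and g: "g \<in> carrier G" and h: "h \<in> carrier G"
  shows "\<exists>\<mu>s. (\<forall>\<mu>\<in>set \<mu>s. \<mu> ^ card (carrier G) = 1) \<and>
     (\<Sum>x\<in>carrier G. e (inv g \<otimes> x \<otimes> inv h \<otimes> inv x)) = sum_list \<mu>s \<and>
     n * e \<one> = of_nat (length \<mu>s)"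
proof -
  have cf: "e \<in> class_fun" using e by (rule idemD)
  \<comment> \<open>Kernel of the operator v \<mapsto> g^k (e v) h^k on the group algebra;
    \<open>F 0\<close> is the projection onto the ideal.\<close>
  define F where "F k x y = e (inv (g [^] k) \<otimes> x \<otimes> inv (h [^] k) \<otimes> inv y)" for k :: nat and x y
  have "(\<Sum>z\<in>carrier G. F k x z * F l z y) = F (k + l) x y"
    if x: "x \<in> carrier G" and y: "y \<in> carrier G" for k l x y
  proof -
    define a where "a = inv (g [^] k) \<otimes> x \<otimes> inv (h [^] k)"
    define b where "b = inv (h [^] l) \<otimes> inv y \<otimes> inv (g [^] l)"
    have ab: "a \<in> carrier G" "b \<in> carrier G" using g h x y by (auto simp: a_def b_def)
    have F2: "F l z y = e (z \<otimes> b)" if "z \<in> carrier G" for z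
      using class_fun_comm[OF cf, of "inv (g [^] l)" "z \<otimes> inv (h [^] l) \<otimes> inv y"] g h y that
      by (simp add: F_def b_def m_assoc)
    have "(\<Sum>z\<in>carrier G. F k x z * F l z y) = (\<Sum>z\<in>carrier G. e (a \<otimes> inv z) * e (z \<otimes> b))"
      using F2 by (intro sum.cong) (auto simp: F_def a_def)
    also have "\<dots> = (\<Sum>w\<in>carrier G. e w * e (inv w \<otimes> (a \<otimes> b)))"
      using ab by (intro sum.reindex_bij_witness[where i = "\<lambda>w. inv w \<otimes> a" and j = "\<lambda>z. a \<otimes> inv z"])
        (auto simp: m_assoc inv_mult_group)
    also have "\<dots> = e (a \<otimes> b)" using idem_conv[OF e] ab by simp
    also have "\<dots> = e (inv (g [^] l) \<otimes> (a \<otimes> (inv (h [^] l) \<otimes> inv y)))"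
      using class_fun_comm[OF cf, of "inv (g [^] l)" "a \<otimes> (inv (h [^] l) \<otimes> inv y)"] g h y ab
      by (simp add: b_def m_assoc)
    also have "\<dots> = F (k + l) x y"
    proof -
      have "inv (h [^] (k + l)) = inv (h [^] k) \<otimes> inv (h [^] l)"
        using nat_pow_add_split[OF h, of l k] by (simp add: add.commute)
      then show ?thesis using g h x y by (simp add: F_def a_def nat_pow_add_split m_assoc)
    qed
    finally show ?thesis .
  qed
  moreover have "F (card (carrier G)) x y = F 0 x y" for x y
    using pow_order_eq_1[OF g] pow_order_eq_1[OF h] by (simp add: F_def Coset.order_def)
  ultimately obtain \<mu>s where \<mu>: "\<forall>\<mu>\<in>set \<mu>s. \<mu> ^ card (carrier G) = 1"
      "(\<Sum>x\<in>carrier G. F 1 x x) = sum_list \<mu>s" "(\<Sum>x\<in>carrier G. F 0 x x) = of_nat (length \<mu>s)"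
    using finite_order_trace[OF fin n_pos, of F] by blast
  have "(\<Sum>x\<in>carrier G. F 0 x x) = n * e \<one>"
    by (simp add: F_def)
  moreover have "(\<Sum>x\<in>carrier G. F 1 x x) = (\<Sum>x\<in>carrier G. e (inv g \<otimes> x \<otimes> inv h \<otimes> inv x))"
    using g h by (simp add: F_def)
  ultimately show ?thesis using \<mu> by metis
qed

text \<open>The hypothesis \<open>eg\<close> is the equality case of Cauchy-Schwarz for
  \<open>e\<close> and its translate by \<open>g\<close>, so \<open>g\<close> acts on
  \<open>e\<close> by a scalar. The elements acting by scalars form a normal subgroup, hence all of
  \<open>G\<close>, and \<open>e\<close> is a multiple of a linear character. Its kernel is normal
  and nontrivial, hence everything, and idempotency fixes the constant.\<close>

lemma idem_norm_one:
  assumes simple: "\<And>N. N \<lhd> G \<Longrightarrow> N = {\<one>} \<or> N = carrier G"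
    and noncomm: "\<not> comm_group G"
    and e: "idem e" and g: "g \<in> carrier G" "g \<noteq> \<one>" and eg: "norm (e (inv g)) = norm (e \<one>)"
    and x: "x \<in> carrier G"
  shows "e x = 1 / n"
proof -
  have cf: "e \<in> class_fun" and e1: "e \<one> \<noteq> 0" using e by (rule idemD)+
  define c where "c = e (inv g) / e \<one>"
  have c: "norm c = 1" using eg e1 by (simp add: c_def norm_divide)
  have gy: "e (inv g \<otimes> y) = c * e y" if y: "y \<in> carrier G" for y
  proof -
    have cross: "(\<Sum>x\<in>carrier G. e (inv g \<otimes> x) * cnj (e x)) = e (inv g)"
    proof -
      have "e (inv g) = (\<Sum>y\<in>carrier G. e y * cnj (e (inv (inv g) \<otimes> y)))"
        using g by (intro idemD(4)[OF e]) simp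
      also have "\<dots> = (\<Sum>x\<in>carrier G. e (inv g \<otimes> x) * cnj (e x))"
        using g by (intro sum.reindex_bij_witness[where i = "\<lambda>x. inv g \<otimes> x" and j = "\<lambda>y. g \<otimes> y"]) auto
      finally show ?thesis by simp
    qed
    have cross': "(\<Sum>x\<in>carrier G. cnj (e (inv g \<otimes> x)) * e x) = cnj (e (inv g))"
      using arg_cong[OF cross, of cnj] by simp
    have trans: "(\<Sum>x\<in>carrier G. (norm (e (inv g \<otimes> x)))\<^sup>2) = (\<Sum>x\<in>carrier G. (norm (e x))\<^sup>2)"
      using sum_translate_left[of "inv g" "\<lambda>x. (norm (e x))\<^sup>2"] g by simp
    \<comment> \<open>The squared distance between the translate of \<open>e\<close> and
      \<open>c * e\<close> expands to 2 e(1) - 2 |c|^2 e(1), which is 0 because |c| = 1.\<close>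
    have "complex_of_real (\<Sum>x\<in>carrier G. (norm (e (inv g \<otimes> x) - c * e x))\<^sup>2)
        = (\<Sum>x\<in>carrier G. (e (inv g \<otimes> x) - c * e x) * cnj (e (inv g \<otimes> x) - c * e x))"
      by (simp add: complex_norm_square del: of_real_power complex_cnj_diff)
    also have "\<dots> = (\<Sum>x\<in>carrier G. of_real ((norm (e (inv g \<otimes> x)))\<^sup>2) + of_real ((norm c)\<^sup>2) * of_real ((norm (e x))\<^sup>2)
        - cnj c * (e (inv g \<otimes> x) * cnj (e x)) - c * (cnj (e (inv g \<otimes> x)) * e x))"
      by (intro sum.cong refl) (simp only: complex_norm_square complex_cnj_diff complex_cnj_mult, simp add: algebra_simps)
    also have "\<dots> = of_real (\<Sum>x\<in>carrier G. (norm (e (inv g \<otimes> x)))\<^sup>2) + of_real (\<Sum>x\<in>carrier G. (norm (e x))\<^sup>2)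
        - cnj c * e (inv g) - c * cnj (e (inv g))"
      by (simp add: c sum.distrib sum_subtractf cross cross' flip: sum_distrib_left)
    also have "\<dots> = e \<one> + e \<one> - (c * cnj c) * e \<one> - (c * cnj c) * cnj (e \<one>)"
      unfolding trans idem_one[OF e, symmetric] using e1 by (simp add: c_def)
    also have "c * cnj c = 1" using c by (simp add: complex_norm_square[symmetric])
    also have "cnj (e \<one>) = e \<one>" using idem_one[OF e] by (metis complex_cnj_complex_of_real)
    finally have "(\<Sum>x\<in>carrier G. (norm (e (inv g \<otimes> x) - c * e x))\<^sup>2) = 0"
      by (simp del: of_real_sum of_real_power)
    then have "(norm (e (inv g \<otimes> y) - c * e y))\<^sup>2 = 0"
      using y fin by (subst (asm) sum_nonneg_eq_0_iff) auto
    then show ?thesis by simp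
  qed
  \<comment> \<open>The elements acting on \<open>e\<close> by a scalar; taking
    \<open>y = \<one>\<close> shows that the scalar must be
    \<open>e (inv x) / e \<one>\<close>.\<close>
  define S where "S = {x \<in> carrier G. \<forall>y\<in>carrier G. e \<one> * e (inv x \<otimes> y) = e (inv x) * e y}"
  have SI: "x \<in> S" if "x \<in> carrier G" "\<And>y. y \<in> carrier G \<Longrightarrow> e (inv x \<otimes> y) = c * e y" for x c
    using that(1) that(2)[of \<one>] that(2) by (auto simp: S_def)
  have SD: "e (inv x \<otimes> y) = e (inv x) / e \<one> * e y" if "x \<in> S" "y \<in> carrier G" for x y
    using that e1 by (simp add: S_def field_simps)
  have "subgroup S G"
  proof (rule subgroupI)
    show "S \<subseteq> carrier G" by (auto simp: S_def)
    have "\<one> \<in> S" by (rule SI[of _ 1]) auto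
    then show "S \<noteq> {}" by auto
    show "a \<otimes> b \<in> S" if "a \<in> S" "b \<in> S" for a b
    proof (rule SI)
      show ab: "a \<otimes> b \<in> carrier G" using that by (auto simp: S_def)
      fix y assume y: "y \<in> carrier G"
      show "e (inv (a \<otimes> b) \<otimes> y) = (e (inv b) / e \<one> * (e (inv a) / e \<one>)) * e y"
        using that y ab SD[OF that(2), of "inv a \<otimes> y"] SD[OF that(1) y]
        by (simp add: S_def inv_mult_group m_assoc)
    qed
    show "inv a \<in> S" if a: "a \<in> S" for a
    proof -
      have ac: "a \<in> carrier G" using a by (simp add: S_def)
      define \<gamma> where "\<gamma> = e (inv a) / e \<one>"
      have "e (inv a \<otimes> (a \<otimes> \<one>)) = \<gamma> * e (a \<otimes> \<one>)" using SD[OF a, of "a \<otimes> \<one>"] ac by (simp add: \<gamma>_def)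
      then have "\<gamma> \<noteq> 0" using e1 ac by auto
      moreover have "e y = \<gamma> * e (a \<otimes> y)" if "y \<in> carrier G" for y
        using SD[OF a, of "a \<otimes> y"] ac that by (simp add: \<gamma>_def)
      ultimately show ?thesis using ac by (intro SI[of _ "1 / \<gamma>"]) (auto simp: field_simps)
    qed
  qed
  then have "S \<lhd> G"
  proof (rule normal_invI)
    fix x h assume x: "x \<in> carrier G" and h: "h \<in> S"
    have hc: "h \<in> carrier G" using h by (simp add: S_def)
    show "x \<otimes> h \<otimes> inv x \<in> S"
    proof (rule SI)
      show "x \<otimes> h \<otimes> inv x \<in> carrier G" using x hc by simp
      fix y assume y: "y \<in> carrier G"
      have "e (inv (x \<otimes> h \<otimes> inv x) \<otimes> y) = e (x \<otimes> (inv h \<otimes> (inv x \<otimes> y)))"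
        using x hc y by (simp add: inv_mult_group m_assoc)
      also have "\<dots> = e (inv h \<otimes> (inv x \<otimes> (y \<otimes> x)))"
        using class_fun_comm[OF cf, of x "inv h \<otimes> (inv x \<otimes> y)"] x hc y by (simp add: m_assoc)
      also have "\<dots> = e (inv h) / e \<one> * e (inv x \<otimes> (y \<otimes> x))" using SD[OF h] x y by simp
      also have "e (inv x \<otimes> (y \<otimes> x)) = e y"
        using class_fun_comm[OF cf, of "inv x" "y \<otimes> x"] x y by (simp add: m_assoc)
      finally show "e (inv (x \<otimes> h \<otimes> inv x) \<otimes> y) = e (inv h) / e \<one> * e y" .
    qed
  qed
  moreover have "g \<in> S" by (rule SI[OF g(1) gy])
  ultimately have S: "S = carrier G" using simple g by blast
  have mult: "e (x \<otimes> y) = e x * e y / e \<one>" if "x \<in> carrier G" "y \<in> carrier G" for x y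
    using SD[of "inv x" y] that by (simp add: S)
  \<comment> \<open>By \<open>mult\<close>, dividing \<open>e\<close> by \<open>e \<one>\<close>
    gives a linear character, with kernel \<open>K\<close>. It is trivial on commutators, so
    \<open>K = {\<one>}\<close> would make the group commutative.\<close>
  define K where "K = {x \<in> carrier G. e x = e \<one>}"
  have "subgroup K G"
  proof (rule subgroupI)
    show "inv a \<in> K" if "a \<in> K" for a
      using mult[of a "inv a"] that e1 by (simp add: K_def)
  qed (auto simp: K_def mult e1)
  then have "K \<lhd> G"
    by (rule normal_invI) (use class_fun_conj[OF cf] in \<open>auto simp: K_def\<close>)
  moreover have "K \<noteq> {\<one>}"
  proof
    assume K: "K = {\<one>}"
    have "x \<otimes> y = y \<otimes> x" if "x \<in> carrier G" "y \<in> carrier G" for x y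
    proof -
      have "e (x \<otimes> y \<otimes> inv (y \<otimes> x)) = e (y \<otimes> x) * e (inv (y \<otimes> x)) / e \<one>"
        using that mult[of "x \<otimes> y" "inv (y \<otimes> x)"] class_fun_comm[OF cf that] by simp
      also have "\<dots> = e (y \<otimes> x \<otimes> inv (y \<otimes> x))"
        using that mult[of "y \<otimes> x" "inv (y \<otimes> x)"] by (simp del: r_inv)
      also have "\<dots> = e \<one>" using that by simp
      finally have "e (x \<otimes> y \<otimes> inv (y \<otimes> x)) = e \<one>" .
      then have "x \<otimes> y \<otimes> inv (y \<otimes> x) \<in> K" using that by (simp add: K_def)
      then show ?thesis using K that by (metis inv_closed inv_equality inv_inv m_closed singletonD)
    qed
    then have "comm_group G" by (intro group_comm_groupI) auto
    then show False using noncomm by simp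
  qed
  ultimately have K: "K = carrier G" using simple by blast
  then have const: "e y = e \<one>" if "y \<in> carrier G" for y using that by (auto simp: K_def)
  have "n * (e \<one> * e \<one>) = e \<one>"
  proof -
    have "(\<Sum>y\<in>carrier G. e y * e (inv y \<otimes> \<one>)) = (\<Sum>y\<in>carrier G. e \<one> * e \<one>)"
      by (intro sum.cong refl arg_cong2[where f = "(*)"] const) auto
    then show ?thesis using idem_conv[OF e, of \<one>] by simp
  qed
  then have "e \<one> = 1 / n" using e1 n_pos by (simp add: field_simps)
  then show ?thesis using const[OF x] by simp
qed

end

section \<open>Multiplication by a class sum as a normal operator\<close>

locale class_sum_operator = finite_group_algebra +
  fixes g
  assumes g: "g \<in> carrier G"
begin

definition C where "C = (\<lambda>x. x \<otimes> g \<otimes> inv x) ` carrier G"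

lemma C_closed: "c \<in> C \<Longrightarrow> c \<in> carrier G"
  using g by (auto simp: C_def)

lemma finite_C: "finite C"
  by (simp add: C_def fin)

lemma g_in_C: "g \<in> C"
  using g by (auto simp: C_def intro!: image_eqI[of _ _ \<one>])

lemma C_conj:
  assumes "c \<in> C" "x \<in> carrier G"
  shows "x \<otimes> c \<otimes> inv x \<in> C"
proof -
  obtain y where y: "y \<in> carrier G" "c = y \<otimes> g \<otimes> inv y" using assms by (auto simp: C_def)
  then have "x \<otimes> c \<otimes> inv x = (x \<otimes> y) \<otimes> g \<otimes> inv (x \<otimes> y)"
    using assms g by (simp add: m_assoc inv_mult_group)
  then show ?thesis using y assms by (auto simp: C_def)
qed

lemma sum_C_conj:
  assumes "x \<in> carrier G"
  shows "(\<Sum>c\<in>C. f (x \<otimes> c \<otimes> inv x)) = sum f C"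
proof (rule sum.reindex_bij_witness[where i = "\<lambda>c. inv x \<otimes> c \<otimes> x" and j = "\<lambda>c. x \<otimes> c \<otimes> inv x"])
  fix c assume "c \<in> C"
  then show "inv x \<otimes> c \<otimes> x \<in> C" using C_conj[of c "inv x"] assms by simp
qed (use assms C_closed C_conj in \<open>auto simp: m_assoc\<close>)

definition T :: "('a \<Rightarrow> complex) \<Rightarrow> 'a \<Rightarrow> complex" where
  "T f = (\<lambda>x. if x \<in> carrier G then \<Sum>c\<in>C. f (inv c \<otimes> x) else 0)"

text \<open>Multiplication by the sum of the inverses of \<open>C\<close>; it is the adjoint of the
  class sum operator \<open>T\<close>, as \<open>T_adjoint\<close> shows.\<close>

definition T' :: "('a \<Rightarrow> complex) \<Rightarrow> 'a \<Rightarrow> complex" where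
  "T' f = (\<lambda>x. if x \<in> carrier G then \<Sum>c\<in>C. f (c \<otimes> x) else 0)"

lemma T_lin: "T (\<lambda>x. f x + a * h x) = (\<lambda>x. T f x + a * T h x)"
  by (auto simp: T_def sum.distrib sum_distrib_left)

lemma T'_scale: "T' (\<lambda>x. a * h x) = (\<lambda>x. a * T' h x)"
  by (auto simp: T'_def sum_distrib_left)

lemma T_class_fun:
  assumes f: "f \<in> class_fun"
  shows "T f \<in> class_fun"
proof -
  have "T f (x \<otimes> y) = T f (y \<otimes> x)" if xy: "x \<in> carrier G" "y \<in> carrier G" for x y
  proof -
    have "T f (x \<otimes> y) = (\<Sum>c\<in>C. f (inv c \<otimes> x \<otimes> y))"
      using xy C_closed by (auto simp: T_def m_assoc intro!: sum.cong)
    also have "\<dots> = (\<Sum>c\<in>C. f (inv (y \<otimes> c \<otimes> inv y) \<otimes> (y \<otimes> x)))"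
    proof (rule sum.cong[OF refl])
      fix c assume "c \<in> C"
      then have c: "c \<in> carrier G" by (rule C_closed)
      show "f (inv c \<otimes> x \<otimes> y) = f (inv (y \<otimes> c \<otimes> inv y) \<otimes> (y \<otimes> x))"
        using class_fun_comm[OF f, of "inv c \<otimes> x" y] c xy by (simp add: m_assoc inv_mult_group)
    qed
    also have "\<dots> = T f (y \<otimes> x)"
      using sum_C_conj[of y "\<lambda>c. f (inv c \<otimes> (y \<otimes> x))"] xy by (simp add: T_def)
    finally show ?thesis .
  qed
  then show ?thesis by (auto simp: class_fun_def T_def)
qed

text \<open>Conjugation by \<open>inv c\<close> permutes \<open>C\<close> and is absorbed in the
  inner sum. Hence \<open>T\<close> commutes with its adjoint.\<close>

lemma T_T': "T (T' f) = T' (T f)"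
proof
  fix x
  show "T (T' f) x = T' (T f) x"
  proof (cases "x \<in> carrier G")
    case x: True
    have "T (T' f) x = (\<Sum>c\<in>C. \<Sum>d\<in>C. f (d \<otimes> (inv c \<otimes> x)))"
      using x C_closed by (auto simp: T_def T'_def intro!: sum.cong)
    also have "\<dots> = (\<Sum>c\<in>C. \<Sum>d\<in>C. f (inv c \<otimes> (d \<otimes> x)))"
    proof (rule sum.cong[OF refl])
      fix c assume "c \<in> C"
      then have c: "c \<in> carrier G" by (rule C_closed)
      have "(\<Sum>d\<in>C. f (d \<otimes> (inv c \<otimes> x))) = (\<Sum>d\<in>C. f (inv c \<otimes> d \<otimes> inv (inv c) \<otimes> (inv c \<otimes> x)))"
        using sum_C_conj[of "inv c" "\<lambda>d. f (d \<otimes> (inv c \<otimes> x))"] c by simp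
      also have "\<dots> = (\<Sum>d\<in>C. f (inv c \<otimes> (d \<otimes> x)))"
        using c x C_closed by (intro sum.cong) (auto simp: m_assoc)
      finally show "(\<Sum>d\<in>C. f (d \<otimes> (inv c \<otimes> x))) = (\<Sum>d\<in>C. f (inv c \<otimes> (d \<otimes> x)))" .
    qed
    also have "\<dots> = (\<Sum>d\<in>C. \<Sum>c\<in>C. f (inv c \<otimes> (d \<otimes> x)))" by (rule sum.swap)
    also have "\<dots> = T' (T f) x"
      using x C_closed by (auto simp: T_def T'_def intro!: sum.cong)
    finally show ?thesis .
  qed (simp add: T_def T'_def)
qed

lemma T_adjoint: "(\<Sum>x\<in>carrier G. T f x * cnj (h x)) = (\<Sum>x\<in>carrier G. f x * cnj (T' h x))"
proof -
  have "(\<Sum>x\<in>carrier G. T f x * cnj (h x)) = (\<Sum>x\<in>carrier G. \<Sum>c\<in>C. f (inv c \<otimes> x) * cnj (h x))"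
    by (simp add: T_def sum_distrib_right)
  also have "\<dots> = (\<Sum>c\<in>C. \<Sum>x\<in>carrier G. f (inv c \<otimes> x) * cnj (h x))" by (rule sum.swap)
  also have "\<dots> = (\<Sum>c\<in>C. \<Sum>x\<in>carrier G. f x * cnj (h (c \<otimes> x)))"
  proof (rule sum.cong[OF refl])
    fix c assume "c \<in> C"
    then have c: "c \<in> carrier G" by (rule C_closed)
    show "(\<Sum>x\<in>carrier G. f (inv c \<otimes> x) * cnj (h x)) = (\<Sum>x\<in>carrier G. f x * cnj (h (c \<otimes> x)))"
      using sum_translate_left[of c "\<lambda>x. f (inv c \<otimes> x) * cnj (h x)"] c by simp
  qed
  also have "\<dots> = (\<Sum>x\<in>carrier G. \<Sum>c\<in>C. f x * cnj (h (c \<otimes> x)))" by (rule sum.swap)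
  also have "\<dots> = (\<Sum>x\<in>carrier G. f x * cnj (T' h x))"
    by (simp add: T'_def sum_distrib_left)
  finally show ?thesis .
qed

lemma norm_sum_zero:
  assumes "(\<Sum>x\<in>carrier G. k x * cnj (k x)) = 0" "x \<in> carrier G"
  shows "k x = 0"
proof -
  have "complex_of_real (\<Sum>x\<in>carrier G. (norm (k x))\<^sup>2) = 0"
    using assms by (simp add: complex_norm_square del: of_real_power)
  then have "(\<Sum>x\<in>carrier G. (norm (k x))\<^sup>2) = 0" by (simp only: of_real_eq_0_iff)
  then show ?thesis using assms(2) fin by (subst (asm) sum_nonneg_eq_0_iff) auto
qed

text \<open>The standard argument for normal operators: \<open>k\<close> stays in the eigenspace of
  \<open>c\<close> because \<open>T\<close> and its adjoint commute, and moving the adjoint across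
  the inner product shows that \<open>k\<close> is orthogonal to itself.\<close>

lemma T'_eigen:
  assumes h: "T h = (\<lambda>x. c * h x)" and x: "x \<in> carrier G"
  shows "T' h x = cnj c * h x"
proof -
  define k where "k = (\<lambda>x. T' h x - cnj c * h x)"
  have "T k = (\<lambda>x. T (T' h) x - cnj c * T h x)"
    using T_lin[of "T' h" "- cnj c" h] by (simp add: k_def)
  also have "\<dots> = (\<lambda>x. c * k x)"
    unfolding T_T' h T'_scale k_def by (auto simp: algebra_simps)
  finally have Tk: "T k = (\<lambda>x. c * k x)" .
  have "(\<Sum>x\<in>carrier G. k x * cnj (k x))
      = (\<Sum>x\<in>carrier G. k x * cnj (T' h x)) - c * (\<Sum>x\<in>carrier G. k x * cnj (h x))"
    by (simp add: k_def algebra_simps sum_subtractf sum_distrib_left)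
  also have "\<dots> = 0" unfolding T_adjoint[symmetric] Tk by (simp add: sum_distrib_left mult_ac)
  finally show ?thesis using norm_sum_zero[OF _ x, of k] by (simp add: k_def)
qed

text \<open>By \<open>T'_eigen\<close> the adjoint of T - c kills \<open>k\<close>, which is (T - c)
  f. The inner product of \<open>k\<close> with itself is that of \<open>f\<close> with the adjoint
  applied to \<open>k\<close>, hence 0.\<close>

lemma T_semisimple:
  assumes f: "f \<in> class_fun" and h: "T (\<lambda>x. T f x - c * f x) = (\<lambda>x. c * (T f x - c * f x))"
  shows "T f = (\<lambda>x. c * f x)"
proof
  fix x
  define k where "k = (\<lambda>x. T f x - c * f x)"
  have "(\<Sum>x\<in>carrier G. k x * cnj (k x))
      = (\<Sum>x\<in>carrier G. T f x * cnj (k x)) - c * (\<Sum>x\<in>carrier G. f x * cnj (k x))"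
    by (simp add: k_def algebra_simps sum_subtractf sum_distrib_left)
  also have "\<dots> = (\<Sum>x\<in>carrier G. f x * cnj (T' k x)) - c * (\<Sum>x\<in>carrier G. f x * cnj (k x))"
    by (simp add: T_adjoint)
  also have "\<dots> = 0"
  proof -
    have "T k = (\<lambda>x. c * k x)" unfolding k_def by (rule h)
    then show ?thesis using T'_eigen[of k c] by (simp add: sum_distrib_left mult_ac)
  qed
  finally show "T f x = c * f x"
    using norm_sum_zero[of k x] f by (cases "x \<in> carrier G") (auto simp: k_def T_def class_fun_def)
qed

section \<open>Splitting the identity into central idempotents\<close>

definition delta :: "'a \<Rightarrow> complex" where "delta x = (if x = \<one> then 1 else 0)"

definition star :: "('a \<Rightarrow> complex) \<Rightarrow> 'a \<Rightarrow> complex" where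
  "star f = (\<lambda>x. if x \<in> carrier G then cnj (f (inv x)) else 0)"

lemma delta_class_fun: "delta \<in> class_fun"
proof -
  have "x \<otimes> y = \<one> \<longleftrightarrow> y \<otimes> x = \<one>" if "x \<in> carrier G" "y \<in> carrier G" for x y
    using that inv_comm by blast
  then show ?thesis by (auto simp: class_fun_def delta_def)
qed

lemma star_class_fun: "f \<in> class_fun \<Longrightarrow> star f \<in> class_fun"
  by (auto simp: class_fun_def star_def inv_mult_group)

lemma conv_delta:
  assumes "f \<in> class_fun"
  shows "conv delta f = f"
proof
  fix x
  have "(\<Sum>y\<in>carrier G. delta y * f (inv y \<otimes> x)) = f x" if "x \<in> carrier G"
  proof -
    have "(\<Sum>y\<in>carrier G. delta y * f (inv y \<otimes> x)) = (\<Sum>y\<in>carrier G. if y = \<one> then f x else 0)"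
      using that by (intro sum.cong) (auto simp: delta_def)
    then show ?thesis using fin by simp
  qed
  then show "conv delta f x = f x" using assms by (auto simp: conv_def class_fun_def)
qed

lemma T_conv: "T (conv a b) = conv (T a) b"
proof
  fix x
  show "T (conv a b) x = conv (T a) b x"
  proof (cases "x \<in> carrier G")
    case x: True
    have "T (conv a b) x = (\<Sum>c\<in>C. \<Sum>y\<in>carrier G. a y * b (inv y \<otimes> (inv c \<otimes> x)))"
      using x C_closed by (auto simp: T_def conv_def intro!: sum.cong)
    also have "\<dots> = (\<Sum>c\<in>C. \<Sum>y\<in>carrier G. a (inv c \<otimes> y) * b (inv y \<otimes> x))"
    proof (rule sum.cong[OF refl])
      fix c assume "c \<in> C"
      then have c: "c \<in> carrier G" by (rule C_closed)
      have "(\<Sum>y\<in>carrier G. a y * b (inv y \<otimes> (inv c \<otimes> x)))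
          = (\<Sum>y\<in>carrier G. a (inv c \<otimes> y) * b (inv (inv c \<otimes> y) \<otimes> (inv c \<otimes> x)))"
        using sum_translate_left[of "inv c" "\<lambda>y. a y * b (inv y \<otimes> (inv c \<otimes> x))"] c by simp
      also have "\<dots> = (\<Sum>y\<in>carrier G. a (inv c \<otimes> y) * b (inv y \<otimes> x))"
        using c x by (intro sum.cong) (auto simp: inv_mult_group m_assoc)
      finally show "(\<Sum>y\<in>carrier G. a y * b (inv y \<otimes> (inv c \<otimes> x)))
          = (\<Sum>y\<in>carrier G. a (inv c \<otimes> y) * b (inv y \<otimes> x))" .
    qed
    also have "\<dots> = (\<Sum>y\<in>carrier G. \<Sum>c\<in>C. a (inv c \<otimes> y) * b (inv y \<otimes> x))" by (rule sum.swap)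
    also have "\<dots> = conv (T a) b x"
      using x by (auto simp: T_def conv_def sum_distrib_right intro!: sum.cong)
    finally show ?thesis .
  qed (simp add: T_def conv_def)
qed

text \<open>The class sum is central, so it may act on either factor, and the product is scaled by
  \<open>c\<close> and by \<open>d\<close> alike.\<close>

lemma conv_orthogonal:
  assumes a: "a \<in> class_fun" "T a = (\<lambda>x. c * a x)" and b: "b \<in> class_fun" "T b = (\<lambda>x. d * b x)"
    and cd: "c \<noteq> d"
  shows "conv a b x = 0"
proof -
  have s: "conv (\<lambda>x. c * a x) b x = c * conv a b x" for a b c x
    by (simp add: conv_def sum_distrib_left mult_ac)
  have "c * conv a b x = T (conv a b) x" by (simp add: T_conv a(2) s)
  also have "\<dots> = T (conv b a) x" by (simp add: conv_comm[OF a(1)])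
  also have "\<dots> = d * conv b a x" by (simp add: T_conv b(2) s)
  also have "\<dots> = d * conv a b x" by (simp add: conv_comm[OF a(1)])
  finally show ?thesis using cd by simp
qed

text \<open>Two conjugations cancel: the involution exchanges \<open>T\<close> with its adjoint,
  whose eigenvalue on \<open>f\<close> is \<open>cnj c\<close>, and conjugates this value back to
  \<open>c\<close>.\<close>

lemma star_eigen:
  assumes f: "f \<in> class_fun" "T f = (\<lambda>x. c * f x)"
  shows "T (star f) = (\<lambda>x. c * star f x)"
proof
  fix x
  show "T (star f) x = c * star f x"
  proof (cases "x \<in> carrier G")
    case x: True
    have "T (star f) x = (\<Sum>c\<in>C. cnj (f (c \<otimes> inv x)))"
      using x C_closed class_fun_comm[OF f(1)]
      by (auto simp: T_def star_def inv_mult_group intro!: sum.cong)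
    also have "\<dots> = cnj (T' f (inv x))" using x by (simp add: T'_def)
    also have "\<dots> = c * star f x" using T'_eigen[OF f(2), of "inv x"] x by (simp add: star_def)
    finally show ?thesis .
  qed (simp add: T_def star_def)
qed

text \<open>Multiplying the decomposition of \<open>delta\<close> by \<open>w d\<close> leaves one
  term, which is idempotency. The involution fixes \<open>delta\<close> and preserves each
  eigenspace, so the starred decomposition gives in the same way the third clause of
  \<open>idem\<close>.\<close>

lemma idem_decomposition:
  "\<exists>S w. finite S \<and> (\<forall>c\<in>S. idem (w c) \<and> T (w c) = (\<lambda>x. c * w c x)) \<and> delta = (\<lambda>x. \<Sum>c\<in>S. w c x)"
proof -
  have "\<exists>S w. finite S \<and> (\<forall>c\<in>S. w c \<in> class_fun \<and> T (w c) = (\<lambda>x. c * w c x)) \<and> delta = (\<lambda>x. \<Sum>c\<in>S. w c x)"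
  proof (rule eigen_decomposition[OF fin T_lin])
    show "(\<lambda>x. f x + c * h x) \<in> class_fun" if "f \<in> class_fun" "h \<in> class_fun" for f h c
      using that by (simp add: class_fun_def)
    show "f x = 0" if "f \<in> class_fun" "x \<notin> carrier G" for f x
      using that by (simp add: class_fun_def)
  qed (fact T_class_fun T_semisimple delta_class_fun)+
  then obtain S w where S: "finite S" and w: "\<And>c. c \<in> S \<Longrightarrow> w c \<in> class_fun"
      "\<And>c. c \<in> S \<Longrightarrow> T (w c) = (\<lambda>x. c * w c x)" and eq: "delta = (\<lambda>x. \<Sum>c\<in>S. w c x)"
    by blast
  have conv_sum: "conv (\<lambda>x. \<Sum>c\<in>S. u c x) b x = (\<Sum>c\<in>S. conv (u c) b x)" for u b x
  proof (cases "x \<in> carrier G")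
    case True
    then show ?thesis by (simp add: conv_def sum_distrib_right) (rule sum.swap)
  qed (simp add: conv_def)
  have star_delta: "delta = (\<lambda>x. \<Sum>c\<in>S. star (w c) x)"
  proof
    fix x
    have "delta x = star delta x" using inv_eq_1_iff by (auto simp: star_def delta_def)
    also have "\<dots> = (\<Sum>c\<in>S. star (w c) x)" by (simp add: star_def eq)
    finally show "delta x = (\<Sum>c\<in>S. star (w c) x)" .
  qed
  have square: "conv (w d) (w d) = w d" if d: "d \<in> S" for d
  proof
    fix x
    have "w d x = (\<Sum>c\<in>S. conv (w c) (w d) x)"
      using conv_delta[OF w(1)[OF d]] conv_sum[of w "w d" x] by (simp flip: eq)
    also have "\<dots> = (\<Sum>c\<in>S. if c = d then conv (w d) (w d) x else 0)"
      using w d by (intro sum.cong) (auto intro: conv_orthogonal)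
    also have "\<dots> = conv (w d) (w d) x" using S d by simp
    finally show "conv (w d) (w d) x = w d x" by simp
  qed
  have square': "w d x = conv (w d) (star (w d)) x" if d: "d \<in> S" for d x
  proof -
    have "w d x = (\<Sum>c\<in>S. conv (star (w c)) (w d) x)"
      using conv_delta[OF w(1)[OF d]] conv_sum[of "\<lambda>c. star (w c)" "w d" x] by (simp flip: star_delta)
    also have "\<dots> = (\<Sum>c\<in>S. if c = d then conv (star (w d)) (w d) x else 0)"
      using w d star_class_fun star_eigen by (intro sum.cong) (auto intro: conv_orthogonal)
    also have "\<dots> = conv (star (w d)) (w d) x" using S d by simp
    finally show ?thesis by (simp add: conv_comm[OF w(1)[OF d]])
  qed
  have square'': "w d z = (\<Sum>y\<in>carrier G. w d y * cnj (w d (inv z \<otimes> y)))"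
    if d: "d \<in> S" and z: "z \<in> carrier G" for d z
  proof -
    have "w d z = (\<Sum>y\<in>carrier G. w d y * star (w d) (inv y \<otimes> z))"
      using square'[OF d, of z] z by (simp add: conv_def)
    also have "\<dots> = (\<Sum>y\<in>carrier G. w d y * cnj (w d (inv z \<otimes> y)))"
      using z by (intro sum.cong) (auto simp: star_def inv_mult_group)
    finally show ?thesis .
  qed
  \<comment> \<open>The value of a component at \<open>\<one>\<close> is the sum of its squared
    norms, so the components dropped here are identically zero.\<close>
  define S' where "S' = {c \<in> S. w c \<one> \<noteq> 0}"
  have zero: "w c x = 0" if c: "c \<in> S - S'" for c x
  proof (cases "x \<in> carrier G")
    case True
    have "(\<Sum>y\<in>carrier G. w c y * cnj (w c y)) = 0"
      using square''[of c \<one>] c by (simp add: S'_def)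
    then show ?thesis using norm_sum_zero True by blast
  next
    case False
    then show ?thesis using w(1) c by (auto simp: class_fun_def)
  qed
  have "(\<Sum>c\<in>S. w c x) = (\<Sum>c\<in>S'. w c x)" for x
    using zero S by (intro sum.mono_neutral_right) (auto simp: S'_def)
  then have "delta = (\<lambda>x. \<Sum>c\<in>S'. w c x)" by (simp add: eq)
  moreover have "idem (w c) \<and> T (w c) = (\<lambda>x. c * w c x)" if "c \<in> S'" for c
    using that w square square'' unfolding S'_def idem_def by blast
  moreover have "finite S'" using S by (simp add: S'_def)
  ultimately show ?thesis by blast
qed

text \<open>Both sides are the double sum of f (x c x^-1) over x in the group and c in
  \<open>C\<close>: the sum over x does not depend on c, nor the sum over c on x.\<close>

lemma sum_conjugates:
  fixes f :: "'a \<Rightarrow> complex"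
  shows "of_nat (card C) * (\<Sum>x\<in>carrier G. f (x \<otimes> g \<otimes> inv x)) = n * sum f C"
proof -
  have "(\<Sum>x\<in>carrier G. f (x \<otimes> c \<otimes> inv x)) = (\<Sum>x\<in>carrier G. f (x \<otimes> g \<otimes> inv x))" if c: "c \<in> C" for c
  proof -
    obtain y where y: "y \<in> carrier G" "c = y \<otimes> g \<otimes> inv y" using c by (auto simp: C_def)
    have "(\<Sum>x\<in>carrier G. f (x \<otimes> g \<otimes> inv x)) = (\<Sum>x\<in>carrier G. f (\<one> \<otimes> x \<otimes> y \<otimes> g \<otimes> inv (\<one> \<otimes> x \<otimes> y)))"
      using sum_translate[of \<one> y "\<lambda>x. f (x \<otimes> g \<otimes> inv x)"] y by simp
    also have "\<dots> = (\<Sum>x\<in>carrier G. f (x \<otimes> c \<otimes> inv x))"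
      using y g by (intro sum.cong) (auto simp: m_assoc inv_mult_group)
    finally show ?thesis by simp
  qed
  then have "of_nat (card C) * (\<Sum>x\<in>carrier G. f (x \<otimes> g \<otimes> inv x)) = (\<Sum>c\<in>C. \<Sum>x\<in>carrier G. f (x \<otimes> c \<otimes> inv x))"
    by simp
  also have "\<dots> = (\<Sum>x\<in>carrier G. \<Sum>c\<in>C. f (x \<otimes> c \<otimes> inv x))" by (rule sum.swap)
  also have "\<dots> = n * sum f C" by (simp add: sum_C_conj)
  finally show ?thesis .
qed

lemma class_fun_C_inv:
  assumes "e \<in> class_fun" "c \<in> C"
  shows "e (inv c) = e (inv g)"
proof -
  obtain x where x: "x \<in> carrier G" "c = x \<otimes> g \<otimes> inv x" using assms by (auto simp: C_def)
  then have "inv c = x \<otimes> inv g \<otimes> inv x" using g by (simp add: inv_mult_group m_assoc)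
  then show ?thesis using class_fun_conj[OF assms(1)] x g by simp
qed

text \<open>This identifies the eigenvalue with the classical number |C| \<chi>(g) / \<chi>(1); it
  is the eigenvector equation read at \<open>\<one>\<close>.\<close>

lemma eigenvalue_central_character:
  assumes "e \<in> class_fun" "T e = (\<lambda>x. c * e x)"
  shows "c * e \<one> = of_nat (card C) * e (inv g)"
proof -
  have "c * e \<one> = T e \<one>" by (simp add: assms)
  also have "\<dots> = (\<Sum>c\<in>C. e (inv g))"
    using class_fun_C_inv[OF assms(1)] C_closed by (auto simp: T_def intro!: sum.cong)
  finally show ?thesis by simp
qed

text \<open>In the basis of group elements \<open>T\<close> is a matrix of zeros and ones.\<close>

lemma eigenvalue_algebraic_int:
  assumes "T e = (\<lambda>x. c * e x)" "e \<one> \<noteq> 0"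
  shows "algebraic_int c"
proof (rule algebraic_intI_module[of "carrier G" \<one> e])
  fix x assume x: "x \<in> carrier G"
  have "c * e x = (\<Sum>c\<in>C. e (inv c \<otimes> x))" using fun_cong[OF assms(1), of x] x by (simp add: T_def)
  also have "\<dots> = (\<Sum>y\<in>{y \<in> carrier G. x \<otimes> inv y \<in> C}. e y)"
    using x C_closed
    by (intro sum.reindex_bij_witness[where i = "\<lambda>y. x \<otimes> inv y" and j = "\<lambda>c. inv c \<otimes> x"])
      (auto simp: inv_mult_group m_assoc)
  also have "\<dots> = (\<Sum>y\<in>carrier G. if x \<otimes> inv y \<in> C then e y else 0)"
    using fin by (simp add: sum.inter_filter)
  also have "\<dots> = (\<Sum>y\<in>carrier G. of_int (if x \<otimes> inv y \<in> C then 1 else 0) * e y)"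
    by (intro sum.cong) auto
  finally show "c * e x = (\<Sum>y\<in>carrier G. of_int (if x \<otimes> inv y \<in> C then 1 else 0) * e y)" .
qed (use fin assms in auto)

text \<open>\<open>n * e (inv g)\<close> and \<open>n * e \<one>\<close> are the traces of \<open>g\<close> and of the identity on the two-sided
  ideal generated by the central idempotent \<open>e\<close>. The dimension of the ideal is the square of the
  degree of a character, but this is not needed: the trace of \<open>v \<mapsto> g v g\<close> on the ideal shows
  that \<open>(n * e (inv g))\<^sup>2\<close> is divisible by \<open>n * e \<one>\<close>.\<close>

lemma idem_trichotomy:
  assumes simple: "\<And>N. N \<lhd> G \<Longrightarrow> N = {\<one>} \<or> N = carrier G"
    and noncomm: "\<not> comm_group G" and g1: "g \<noteq> \<one>"
    and p: "Factorial_Ring.prime p" and card: "card C = p ^ k"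
    and e: "idem e" and eig: "T e = (\<lambda>x. c * e x)"
  shows "e (inv g) = 0 \<or> (\<forall>x\<in>carrier G. e x = 1 / n) \<or> algebraic_int (n * e (inv g) / csqrt (of_nat p))"
proof -
  have cf: "e \<in> class_fun" and e1: "e \<one> \<noteq> 0" using e by (rule idemD)+
  have n0: "n \<noteq> 0" using n_pos by simp
  define t where "t = n * e (inv g)"
  obtain \<mu>s where \<mu>: "\<forall>\<mu>\<in>set \<mu>s. \<mu> ^ card (carrier G) = 1"
      "t = sum_list \<mu>s" "n * e \<one> = of_nat (length \<mu>s)"
    using idem_trace[OF e g one_closed] g by (auto simp: t_def m_assoc)
  define D where "D = length \<mu>s"
  have D: "n * e \<one> = of_nat D" using \<mu>(3) by (simp add: D_def)
  have D0: "D > 0" using D n0 e1 by (cases "D = 0") auto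
  have alg_\<mu>: "algebraic_int \<mu>" if "\<mu> ^ card (carrier G) = 1" for \<mu> :: complex
    using algebraic_int_unity_root[OF that n_pos] .
  have t: "algebraic_int t" unfolding \<mu>(2) using \<mu>(1) alg_\<mu> by (intro algebraic_int_sum_list) auto
  have cD: "c * of_nat D = of_nat (p ^ k) * t"
    using eigenvalue_central_character[OF cf eig] unfolding card D[symmetric] t_def by (simp add: mult_ac)
  have c: "algebraic_int c" by (rule eigenvalue_algebraic_int[OF eig e1])
  show ?thesis
  proof (cases "p dvd D")
    case False
    \<comment> \<open>With \<alpha> = t / D, both p^k \<alpha> = c and D \<alpha> = t are algebraic
      integers, so a Bezout relation makes \<alpha> one as well. It is also an average of
      \<open>D\<close> roots of unity.\<close>
    then have "coprime (int (p ^ k)) (int D)"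
      using p by (simp add: prime_imp_coprime coprime_int_iff)
    then obtain u v where uv: "u * int (p ^ k) + v * int D = 1"
      using bezout_int[of "int (p ^ k)" "int D"] by (auto simp: coprime_iff_gcd_eq_1)
    define \<alpha> where "\<alpha> = t / of_nat D"
    have "of_int (u * int (p ^ k) + v * int D) * \<alpha> = of_int u * c + of_int v * t"
      using cD D0 by (simp add: \<alpha>_def field_simps)
    then have "\<alpha> = of_int u * c + of_int v * t" unfolding uv by simp
    then have "algebraic_int \<alpha>" using c t by (auto intro!: algebraic_int_plus_times algebraic_int_of_int)
    then have "\<alpha> = 0 \<or> norm \<alpha> = 1"
      using unity_average_algebraic_int[OF n_pos, of \<mu>s \<alpha>] \<mu> D0 by (simp add: \<alpha>_def D_def)
    then show ?thesis
    proof
      assume "\<alpha> = 0"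
      then show ?thesis using D0 n0 by (simp add: \<alpha>_def t_def)
    next
      have "\<alpha> = e (inv g) / e \<one>" using n0 e1 unfolding \<alpha>_def t_def D[symmetric] by simp
      moreover assume "norm \<alpha> = 1"
      ultimately have "norm (e (inv g)) = norm (e \<one>)" using e1 by (simp add: norm_divide)
      then show ?thesis using idem_norm_one[OF simple noncomm e g g1] by blast
    qed
  next
    case True
    then obtain D' where D': "D = p * D'" by blast
    define s where "s = (\<Sum>x\<in>carrier G. e (inv g \<otimes> x \<otimes> inv g \<otimes> inv x))"
    obtain \<nu>s where \<nu>: "\<forall>\<mu>\<in>set \<nu>s. \<mu> ^ card (carrier G) = 1" "s = sum_list \<nu>s"
      using idem_trace[OF e g g] by (auto simp: s_def)
    have s: "algebraic_int s" unfolding \<nu>(2) using \<nu>(1) alg_\<mu> by (intro algebraic_int_sum_list) auto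
    \<comment> \<open>Summing over conjugates turns this trace into a value of \<open>T e\<close>,
      from which the eigenvalue \<open>c\<close> comes out.\<close>
    have "of_nat (card C) * s = n * (c * e (inv g))"
    proof -
      have "of_nat (card C) * s = of_nat (card C) * (\<Sum>x\<in>carrier G. e (inv g \<otimes> inv (x \<otimes> g \<otimes> inv x)))"
        using g unfolding s_def
        by (intro arg_cong2[where f = "(*)"] sum.cong) (auto simp: inv_mult_group m_assoc)
      also have "\<dots> = n * (\<Sum>c\<in>C. e (inv g \<otimes> inv c))" by (rule sum_conjugates)
      also have "(\<Sum>c\<in>C. e (inv g \<otimes> inv c)) = T e (inv g)"
        using g C_closed class_fun_comm[OF cf] by (auto simp: T_def intro!: sum.cong)
      finally show ?thesis by (simp add: eig)
    qed
    \<comment> \<open>Replacing \<open>c * e \<one>\<close> by |C| e (inv g) and cancelling |C|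
      gives s D = t^2. The factor \<open>p\<close> of \<open>D\<close> then allows \<open>t\<close>
      to be divided by a square root of \<open>p\<close>.\<close>
    then have "of_nat (card C) * (s * of_nat D) = of_nat (card C) * t\<^sup>2"
      using eigenvalue_central_character[OF cf eig] unfolding D[symmetric] t_def power2_eq_square
      by (metis (no_types, lifting) mult.assoc mult.left_commute)
    moreover have "of_nat (card C) \<noteq> (0 :: complex)" using finite_C g_in_C by auto
    ultimately have st: "s * of_nat D = t\<^sup>2" by simp
    have p0: "p > 0" using p by (simp add: prime_gt_0_nat)
    have "(t / csqrt (of_nat p))\<^sup>2 = of_nat D' * s"
      using st p0 by (simp only: power_divide power2_csqrt) (simp add: D' field_simps)
    then have "algebraic_int ((t / csqrt (of_nat p))\<^sup>2)"
      using s by (auto intro: algebraic_int_plus_times algebraic_int_of_nat)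
    then have "algebraic_int (t / csqrt (of_nat p))" by (rule algebraic_int_power_root) simp
    then show ?thesis by (simp add: t_def)
  qed
qed

text \<open>The decomposition of \<open>delta\<close>, read at \<open>inv g\<close> and multiplied
  by \<open>n\<close>, says 0 = 1 + (other terms), where 1 comes from the constant idempotent. By
  the trichotomy every other term is an algebraic integer times the square root of \<open>p\<close>,
  so 1/p would be a rational algebraic integer.\<close>

theorem prime_power_class_not_simple:
  assumes simple: "\<And>N. N \<lhd> G \<Longrightarrow> N = {\<one>} \<or> N = carrier G"
    and noncomm: "\<not> comm_group G" and g1: "g \<noteq> \<one>"
    and p: "Factorial_Ring.prime p" and card: "card C = p ^ k"
  shows False
proof -
  have n0: "n \<noteq> 0" using n_pos by simp
  obtain S w where S: "finite S" and idem: "\<And>c. c \<in> S \<Longrightarrow> idem (w c)"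
    and eig: "\<And>c. c \<in> S \<Longrightarrow> T (w c) = (\<lambda>x. c * w c x)" and delta: "delta = (\<lambda>x. \<Sum>c\<in>S. w c x)"
    using idem_decomposition by blast
  have C0: "of_nat (card C) \<noteq> (0 :: complex)" using finite_C g_in_C by auto
  \<comment> \<open>A constant idempotent can only belong to the eigenvalue |C|. This rules out the
    second case of the trichotomy for every other component.\<close>
  have const_eig: "c = of_nat (card C)" if c: "c \<in> S" and const: "\<forall>x\<in>carrier G. w c x = 1 / n" for c
    using eigenvalue_central_character[OF idemD(1)[OF idem[OF c]] eig[OF c]] const g n0 by simp
  define c0 where "c0 = (of_nat (card C) :: complex)"
  \<comment> \<open>Since \<open>delta\<close> sums to 1 over the group, some component has nonzero
    sum. \<open>T\<close> multiplies such sums by |C|, so this component has eigenvalue |C|, hence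
    equal values at \<open>inv g\<close> and \<open>\<one>\<close>, and \<open>idem_norm_one\<close>
    applies.\<close>
  have triv: "c0 \<in> S \<and> (\<forall>x\<in>carrier G. w c0 x = 1 / n)"
  proof -
    have "(\<Sum>c\<in>S. \<Sum>x\<in>carrier G. w c x) = (\<Sum>x\<in>carrier G. delta x)"
      unfolding delta by (rule sum.swap)
    also have "\<dots> = 1" using fin by (simp add: delta_def)
    finally have "(\<Sum>c\<in>S. \<Sum>x\<in>carrier G. w c x) \<noteq> 0" by simp
    then obtain c where c: "c \<in> S" "(\<Sum>x\<in>carrier G. w c x) \<noteq> 0"
      by (rule sum.not_neutral_contains_not_neutral)
    have "c * (\<Sum>x\<in>carrier G. w c x) = (\<Sum>x\<in>carrier G. T (w c) x)"
      by (simp add: eig[OF c(1)] sum_distrib_left)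
    also have "\<dots> = (\<Sum>x\<in>carrier G. \<Sum>d\<in>C. w c (inv d \<otimes> x))" by (simp add: T_def)
    also have "\<dots> = (\<Sum>d\<in>C. \<Sum>x\<in>carrier G. w c (inv d \<otimes> x))" by (rule sum.swap)
    also have "\<dots> = c0 * (\<Sum>x\<in>carrier G. w c x)"
    proof -
      have "(\<Sum>x\<in>carrier G. w c (inv d \<otimes> x)) = (\<Sum>x\<in>carrier G. w c x)" if "d \<in> C" for d
        using sum_translate_left[of "inv d" "w c"] C_closed[OF that] by simp
      then show ?thesis by (simp add: c0_def)
    qed
    finally have cc0: "c = c0" using c(2) by simp
    have "w c (inv g) = w c \<one>"
      using eigenvalue_central_character[OF idemD(1)[OF idem[OF c(1)]] eig[OF c(1)]] cc0 C0
      by (simp add: c0_def)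
    then have "\<forall>x\<in>carrier G. w c x = 1 / n"
      by (intro ballI idem_norm_one[OF simple noncomm idem[OF c(1)] g g1]) auto
    then show ?thesis using c cc0 by simp
  qed
  define q where "q = csqrt (of_nat p)"
  have q2: "q\<^sup>2 = of_nat p" unfolding q_def by (rule power2_csqrt)
  have p1: "p > 1" using p by (rule prime_gt_1_nat)
  then have q0: "q \<noteq> 0" using q2 by auto
  have int: "algebraic_int (n * w c (inv g) / q)" if c: "c \<in> S - {c0}" for c
  proof -
    have "w c (inv g) = 0 \<or> (\<forall>x\<in>carrier G. w c x = 1 / n) \<or> algebraic_int (n * w c (inv g) / q)"
      unfolding q_def using c by (intro idem_trichotomy[OF simple noncomm g1 p card idem eig]) auto
    moreover have "\<not> (\<forall>x\<in>carrier G. w c x = 1 / n)"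
      using const_eig[of c] c by (auto simp: c0_def)
    ultimately show ?thesis using algebraic_int_of_nat[of 0] by auto
  qed
  have "inv g \<noteq> \<one>" using g1 g inv_eq_1_iff by auto
  then have "0 = (\<Sum>c\<in>S. w c (inv g))" using fun_cong[OF delta, of "inv g"] by (simp add: delta_def)
  also have "\<dots> = w c0 (inv g) + (\<Sum>c\<in>S-{c0}. w c (inv g))" using S triv by (intro sum.remove) auto
  also have "w c0 (inv g) = 1 / n" using triv g by simp
  finally have "1 + (\<Sum>c\<in>S-{c0}. n * w c (inv g)) = 0"
    using n0 by (simp add: field_simps sum_distrib_left)
  then have "(\<Sum>c\<in>S-{c0}. n * w c (inv g) / q) = - (1 / q)"
    unfolding sum_divide_distrib[symmetric] by (simp add: add_eq_0_iff)
  moreover have "algebraic_int (\<Sum>c\<in>S-{c0}. n * w c (inv g) / q)"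
    using int by (rule algebraic_int_sum)
  ultimately have "algebraic_int (- (1 / q))" by simp
  then have "algebraic_int (- (1 / q) * - (1 / q))" by (intro algebraic_int_plus_times)
  then have "algebraic_int (1 / of_nat p :: complex)" by (simp add: q2[symmetric] power2_eq_square)
  then have "1 / of_nat p \<in> (\<int> :: complex set)" by (rule rational_algebraic_int_is_int) simp
  then obtain z :: int where "1 / of_nat p = (of_int z :: complex)" by (auto elim: Ints_cases)
  then have "of_int (z * int p) = (1 :: complex)" using p1 by (simp add: field_simps)
  then have "z * int p = 1" by (simp only: of_int_eq_1_iff)
  then show False using p1 by (simp add: zmult_eq_1_iff)
qed

end

section \<open>Burnside's theorem\<close>

text \<open>The moved points form whole orbits, whose lengths are positive powers of
  \<open>p\<close>; an orbit that contains a fixed point is a singleton.\<close>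

lemma (in group_action) prime_dvd_card_moved:
  assumes p: "Factorial_Ring.prime p" and G: "card (carrier G) = p ^ k" and E: "finite E"
  shows "p dvd card {x \<in> E. \<exists>g\<in>carrier G. \<phi> g x \<noteq> x}"
proof -
  define M where "M = {x \<in> E. \<exists>g\<in>carrier G. \<phi> g x \<noteq> x}"
  define h where "h x = (if x \<in> M then 1 else 0 :: nat)" for x
  have "p dvd (\<Sum>x\<in>orb. h x)" if orb: "orb \<in> orbits G E \<phi>" for orb
  proof -
    obtain x0 where x0: "x0 \<in> E" "orb = orbit G \<phi> x0" using orb by (auto simp: orbits_def)
    have sub: "orb \<subseteq> E" using x0 element_image by (auto simp: orbit_def)
    show ?thesis
    proof (cases "orb \<subseteq> M")
      case True
      then have eq: "(\<Sum>x\<in>orb. h x) = card orb" by (simp add: h_def subset_iff)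
      have "card orb dvd p ^ k" using orbit_stabilizer_theorem[OF x0(1)] G x0(2) unfolding Coset.order_def by (metis dvd_triv_left)
      then obtain j where j: "card orb = p ^ j" using divides_primepow_nat[OF p] by blast
      have "j \<noteq> 0"
      proof
        assume "j = 0"
        then have "card orb = 1" using j by simp
        then obtain y where y: "orb = {y}" using card_1_singletonE by blast
        have "\<phi> g x0 \<in> orb" if "g \<in> carrier G" for g using that x0 by (auto simp: orbit_def)
        moreover have "x0 \<in> orb" using orbit_refl[OF x0(1)] x0(2) by simp
        ultimately have "x0 \<notin> M" using y by (auto simp: M_def)
        then show False using True \<open>x0 \<in> orb\<close> by blast
      qed
      then show ?thesis using eq j by (simp add: dvd_power)
    next
      case False
      then obtain x where x: "x \<in> orb" "x \<notin> M" by blast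
      then have fixed: "\<phi> g x = x" if "g \<in> carrier G" for g using that sub by (auto simp: M_def)
      have "orb = orbit G \<phi> x"
      proof -
        have "orbit G \<phi> x \<in> orbits G E \<phi>" using x sub by (auto simp: orbits_def)
        moreover have "x \<in> orbit G \<phi> x" using orbit_refl x sub by auto
        ultimately show ?thesis using disjoint_union[OF orb] x by blast
      qed
      then have "orb \<subseteq> {x}" using fixed by (auto simp: orbit_def)
      then have "(\<Sum>x\<in>orb. h x) = 0" using x by (intro sum.neutral) (auto simp: h_def)
      then show ?thesis by simp
    qed
  qed
  then have "p dvd (\<Sum>orb\<in>orbits G E \<phi>. \<Sum>x\<in>orb. h x)" by (rule dvd_sum)
  also have "(\<Sum>orb\<in>orbits G E \<phi>. \<Sum>x\<in>orb. h x) = (\<Sum>x\<in>E. h x)" by (rule disjoint_sum[OF E])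
  also have "\<dots> = card M" using E by (simp add: h_def M_def sum.If_cases Int_def)
  finally show ?thesis by (simp add: M_def)
qed

text \<open>Conjugation moves exactly the elements outside the centre, so \<open>p\<close> divides
  the order of the centre, which is positive.\<close>

lemma (in group) prime_power_order_center:
  assumes p: "Factorial_Ring.prime p" and G: "card (carrier G) = p ^ k" "k > 0"
  obtains z where "z \<in> carrier G" "z \<noteq> \<one>" "\<And>x. x \<in> carrier G \<Longrightarrow> x \<otimes> z = z \<otimes> x"
proof -
  have p0: "p > 0" using p by (rule prime_gt_0_nat)
  have "card (carrier G) > 0" using G p0 by simp
  then have fin: "finite (carrier G)" by (rule card_ge_0_finite)
  define Z where "Z = {x \<in> carrier G. \<forall>g\<in>carrier G. g \<otimes> x \<otimes> inv g = x}"
  interpret A: group_action G "carrier G" "\<lambda>g. \<lambda>h\<in>carrier G. g \<otimes> h \<otimes> inv g"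
    by (rule action_by_conjugation)
  have "{x \<in> carrier G. \<exists>g\<in>carrier G. (\<lambda>h\<in>carrier G. g \<otimes> h \<otimes> inv g) x \<noteq> x} = carrier G - Z"
    by (auto simp: Z_def)
  then have "p dvd card (carrier G - Z)" using A.prime_dvd_card_moved[OF p G(1) fin] by simp
  moreover have "card (carrier G) = card (carrier G - Z) + card Z"
    using fin by (subst card_Un_disjoint[symmetric]) (auto simp: Z_def intro!: arg_cong[of _ _ card] finite_subset[OF _ fin])
  moreover have "p dvd card (carrier G)" using G by (simp add: dvd_power)
  ultimately have "p dvd card Z" by (metis dvd_add_right_iff)
  moreover have "card Z > 0"
    using fin by (auto simp: card_gt_0_iff Z_def intro!: finite_subset[OF _ fin] exI[of _ \<one>])
  ultimately have "card Z > 1" using prime_gt_1_nat[OF p] by (meson dvd_imp_le less_le_trans)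
  then have "\<not> Z \<subseteq> {\<one>}" by (metis card.empty card_1_singleton_iff less_irrefl not_one_less_zero subset_singletonD One_nat_def)
  then obtain z where z: "z \<in> Z" "z \<noteq> \<one>" by blast
  have "x \<otimes> z = z \<otimes> x" if "x \<in> carrier G" for x
  proof -
    have "x \<otimes> z \<otimes> inv x = z" "z \<in> carrier G" using z that by (auto simp: Z_def)
    then show ?thesis using that by (metis inv_solve_right m_closed)
  qed
  then show ?thesis using z that by (auto simp: Z_def)
qed

text \<open>Orbit-stabilizer for conjugation, read off from \<open>sum_conjugates\<close> for the
  indicator function of \<open>g\<close>.\<close>

lemma (in class_sum_operator) card_class_centralizer:
  "card C * card {x \<in> carrier G. x \<otimes> g = g \<otimes> x} = card (carrier G)"
proof -
  have "x \<otimes> g \<otimes> inv x = g \<longleftrightarrow> x \<otimes> g = g \<otimes> x" if "x \<in> carrier G" for x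
    using that g inv_solve_right[of g "x \<otimes> g" x] by auto
  then have "(\<Sum>x\<in>carrier G. if x \<otimes> g \<otimes> inv x = g then 1 else 0 :: complex)
      = of_nat (card {x \<in> carrier G. x \<otimes> g = g \<otimes> x})"
    using fin by (simp add: sum.If_cases Int_def cong: conj_cong)
  moreover have "(\<Sum>c\<in>C. if c = g then 1 else 0 :: complex) = 1"
    using finite_C g_in_C by simp
  ultimately have "of_nat (card C * card {x \<in> carrier G. x \<otimes> g = g \<otimes> x}) = (of_nat (card (carrier G)) :: complex)"
    using sum_conjugates[of "\<lambda>c. if c = g then 1 else 0"] by simp
  then show ?thesis by (simp only: of_nat_eq_iff)
qed

lemma (in group) card_subgroup_dvd:
  "subgroup H G \<Longrightarrow> card H dvd card (carrier G)"
  using lagrange unfolding Coset.order_def by (metis dvd_triv_right)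

lemma (in group) card_subgroup_dvd_subgroup:
  assumes "subgroup H G" "subgroup K G" "H \<subseteq> K"
  shows "card H dvd card K"
  using group.card_subgroup_dvd[OF subgroup.subgroup_is_group[OF assms(2) is_group] subgroup_incl[OF assms]]
  by simp

lemma prime_factors_singleton_power:
  fixes m :: nat
  assumes "m > 0" "prime_factors m \<subseteq> {p}"
  shows "m = p ^ multiplicity p m"
proof (cases "p \<in> prime_factors m")
  case True
  then have "prime_factors m = {p}" using assms by auto
  then show ?thesis using prime_factorization_nat[of m] assms(1) by simp
next
  case False
  then have "prime_factors m = {}" using assms by auto
  then have "m = 1" using assms(1) by (simp add: prime_factorization_empty_iff)
  then show ?thesis by simp
qed

text \<open>A nontrivial central element of a Sylow \<open>q\<close>-subgroup has a centralizer
  containing that subgroup. The size of its class therefore divides the Sylow index, whose only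
  possible prime factor is \<open>p\<close>.\<close>

lemma (in group) burnside_two_primes_simple:
  assumes fin: "finite (carrier G)" and pr: "Factorial_Ring.prime p" "Factorial_Ring.prime q"
    and pq: "prime_factors (card (carrier G)) \<subseteq> {p, q}"
    and simple: "\<And>N. N \<lhd> G \<Longrightarrow> N = {\<one>} \<or> N = carrier G"
  shows "comm_group G"
proof (rule ccontr)
  assume noncomm: "\<not> comm_group G"
  have o0: "card (carrier G) > 0" using fin by (auto simp: card_gt_0_iff)
  \<comment> \<open>Only one of the two primes need divide the order, so the argument must be
    available with their roles exchanged.\<close>
  have wlog: False
    if pr: "Factorial_Ring.prime p" "Factorial_Ring.prime q"
      and pq: "prime_factors (card (carrier G)) \<subseteq> {p, q}" and q: "q dvd card (carrier G)" for p q
  proof -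
    define b where "b = multiplicity q (card (carrier G))"
    obtain m where m: "card (carrier G) = q ^ b * m" "\<not> q dvd m"
      using multiplicity_decompose'[of "card (carrier G)" q] o0 pr(2) unfolding b_def
      by (metis not_prime_unit not_gr_zero)
    have b: "b > 0" using q m by (metis gr0I mult_1 power_0)
    obtain Q where Q: "subgroup Q G" "card Q = q ^ b"
      using sylow_thm[OF pr(2) is_group _ fin] m(1) unfolding Coset.order_def by blast
    interpret Q: group "G\<lparr>carrier := Q\<rparr>" by (rule subgroup.subgroup_is_group[OF Q(1) is_group])
    obtain z where z: "z \<in> Q" "z \<noteq> \<one>" "\<And>x. x \<in> Q \<Longrightarrow> x \<otimes> z = z \<otimes> x"
      using Q.prime_power_order_center[OF pr(2), of b] Q(2) b by (auto simp: Coset.order_def)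
    have zG: "z \<in> carrier G" using z(1) Q(1) by (rule subgroup.mem_carrier[rotated])
    interpret A: class_sum_operator G z by unfold_locales (use fin zG in auto)
    define Z where "Z = {x \<in> carrier G. x \<otimes> z = z \<otimes> x}"
    have "subgroup Z G"
    proof (rule subgroupI)
      show "inv a \<in> Z" if "a \<in> Z" for a
      proof -
        have a: "a \<in> carrier G" "a \<otimes> z = z \<otimes> a" using that by (auto simp: Z_def)
        then have "inv a \<otimes> (a \<otimes> z) \<otimes> inv a = inv a \<otimes> (z \<otimes> a) \<otimes> inv a" by simp
        then have "inv a \<otimes> z = z \<otimes> inv a" using a(1) zG by (simp add: m_assoc A.inv_cancel)
        then show ?thesis using a by (simp add: Z_def)
      qed
      show "a \<otimes> b \<in> Z" if "a \<in> Z" "b \<in> Z" for a b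
        using that zG unfolding Z_def by (simp add: m_assoc) (metis m_assoc)
    qed (use zG in \<open>auto simp: Z_def\<close>)
    moreover have "Q \<subseteq> Z" using z(3) subgroup.subset[OF Q(1)] by (auto simp: Z_def)
    ultimately have "q ^ b dvd card Z"
      using Q card_subgroup_dvd_subgroup by metis
    then obtain r where r: "card Z = q ^ b * r" by blast
    have "card A.C * r = m"
      using A.card_class_centralizer m(1) r pr(2) unfolding Z_def[symmetric]
      by (simp add: prime_gt_0_nat)
    then have Cm: "card A.C dvd m" by (metis dvd_triv_left)
    have m0: "m > 0" using o0 m(1) by (simp)
    have "prime_factors (card A.C) \<subseteq> {p}"
    proof
      fix s assume "s \<in> prime_factors (card A.C)"
      then have s: "Factorial_Ring.prime s" "s dvd m" using Cm by (auto intro: dvd_trans)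
      then have "s \<in> prime_factors (card (carrier G))" using o0 m(1) by (auto simp: prime_factors_dvd)
      then show "s \<in> {p}" using pq s m(2) by auto
    qed
    moreover have "card A.C > 0" using Cm m0 by (auto intro: Nat.gr0I)
    ultimately have "card A.C = p ^ multiplicity p (card A.C)"
      by (intro prime_factors_singleton_power)
    then show False
      using A.prime_power_class_not_simple[OF simple noncomm z(2) pr(1)] by blast
  qed
  have "card (carrier G) \<noteq> 1"
  proof
    assume "card (carrier G) = 1"
    then have "carrier G = {\<one>}" using order_one_triv_iff unfolding Coset.order_def by blast
    then have "comm_group G" by (intro group_comm_groupI) auto
    then show False using noncomm by simp
  qed
  then obtain s where s: "Factorial_Ring.prime s" "s dvd card (carrier G)" using prime_factor_nat by blast
  then have "s \<in> {p, q}" using pq o0 by (auto simp: prime_factors_dvd)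
  then show False using wlog[OF pr pq] wlog[OF pr(2,1)] pq s by (auto simp: insert_commute)
qed

section \<open>Solubility through normal subgroups and quotients\<close>

lemma (in group) card_normal_union:
  assumes N: "N \<lhd> G" and fin: "finite (carrier G)" and B: "B \<subseteq> carrier (G Mod N)"
  shows "card {x \<in> carrier G. N #> x \<in> B} = card N * card B"
proof -
  interpret N: normal N G by fact
  have rc: "B \<subseteq> rcosets N" using B by (simp add: FactGroup_def)
  have eq: "{x \<in> carrier G. N #> x \<in> B} = \<Union>B"
  proof (intro equalityI subsetI)
    fix x assume x: "x \<in> {x \<in> carrier G. N #> x \<in> B}"
    then have "x \<in> N #> x" using rcos_self N.is_subgroup by auto
    then show "x \<in> \<Union>B" using x by auto
  next
    fix x assume "x \<in> \<Union>B"
    then obtain b where b: "b \<in> B" "x \<in> b" by blast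
    then obtain y where y: "y \<in> carrier G" "b = N #> y" using rc by (auto simp: RCOSETS_def)
    have x: "x \<in> carrier G" using b y N.subset r_coset_subset_G by blast
    have "N #> x = b" using repr_independence[OF _ y(1) N.is_subgroup, of x] b y by simp
    then show "x \<in> {x \<in> carrier G. N #> x \<in> B}" using x b by simp
  qed
  have "card N * card B = card (\<Union>B)"
  proof (rule card_partition)
    have "finite (rcosets N)" using fin by (simp add: RCOSETS_def)
    then show "finite B" using rc by (rule finite_subset[rotated])
    show "finite (\<Union>B)" using fin unfolding eq[symmetric] by simp
    show "card c = card N" if "c \<in> B" for c
      using card_rcosets_equal[of c N] that rc N.subset by auto
    show "c1 \<inter> c2 = {}" if "c1 \<in> B" "c2 \<in> B" "c1 \<noteq> c2" for c1 c2
      using rcos_disjoint[OF N.is_subgroup] that rc by (auto simp: pairwise_def disjnt_def)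
  qed
  then show ?thesis using eq by simp
qed

lemma (in normal) coset_group_hom: "group_hom G (G Mod H) (\<lambda>x. H #> x)"
  using factorgroup_is_group r_coset_hom_Mod is_group by (simp add: group_hom_def group_hom_axioms_def)

lemma (in normal) coset_kernel: "x \<in> carrier G \<Longrightarrow> H #> x = H \<Longrightarrow> x \<in> H"
  using is_subgroup rcos_self by blast

text \<open>The elements of a quotient are sets, so an induction at a fixed element type does not
  reach it. A copy on the natural numbers brings every finite quotient back to one type.\<close>

lemma (in group) exists_nat_copy:
  assumes fin: "finite (carrier G)"
  shows "\<exists>(H :: nat monoid) h. group H \<and> h \<in> iso G H"
proof -
  obtain h :: "'a \<Rightarrow> nat" where h: "bij_betw h (carrier G) {0..<card (carrier G)}"
    using ex_bij_betw_finite_nat[OF fin] by blast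
  define b where "b = inv_into (carrier G) h"
  have inj: "inj_on h (carrier G)" using h by (simp add: bij_betw_def)
  have bh: "b (h x) = x" if "x \<in> carrier G" for x using inj that by (simp add: b_def)
  define H where "H = \<lparr>carrier = h ` carrier G, monoid.mult = (\<lambda>i j. h (b i \<otimes> b j)), one = h \<one>\<rparr>"
  have "monoid H" by unfold_locales (auto simp: H_def bh m_assoc)
  moreover have iso: "h \<in> iso G H" using inj by (auto simp: iso_def hom_def bij_betw_def H_def bh)
  ultimately have "group H" using iso_imp_group[of H] by (auto simp: is_iso_def)
  then show ?thesis using iso by blast
qed

lemma comm_group_imp_solvable:
  fixes G (structure)
  assumes "comm_group G"
  shows "solvable G"
proof -
  interpret comm_group G by fact
  have "(derived G ^^ 1) (carrier G) = {\<one>}" using derived_eq_singleton by simp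
  then show ?thesis using solvable_iff_trivial_derived_seq by blast
qed

theorem (in group) burnside_two_primes:
  assumes fin: "finite (carrier G)" and pr: "Factorial_Ring.prime p" "Factorial_Ring.prime q"
    and pq: "prime_factors (card (carrier G)) \<subseteq> {p, q}"
  shows "solvable G"
proof -
  \<comment> \<open>The induction on the order runs over groups of natural numbers: a normal
    subgroup keeps this type, and the quotient is replaced by a copy.\<close>
  have nat: "solvable H"
    if "group H" "finite (carrier H)" "prime_factors (card (carrier H)) \<subseteq> {p, q}" for H :: "nat monoid"
    using that
  proof (induction "card (carrier H)" arbitrary: H rule: less_induct)
    case less
    interpret H: group H by fact
    note finH = less.prems(2)
    show ?case
    proof (cases "comm_group H")
      case False
      then obtain N where N: "N \<lhd> H" "N \<noteq> {\<one>\<^bsub>H\<^esub>}" "N \<noteq> carrier H"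
        using H.burnside_two_primes_simple[OF finH pr less.prems(3)] by blast
      interpret N: normal N H by fact
      have card_dvd: "card N dvd card (carrier H)" by (rule H.card_subgroup_dvd[OF N.is_subgroup])
      have c0: "card (carrier H) > 0" using finH by (auto simp: card_gt_0_iff)
      have finN: "finite N" using N.subset finH by (rule finite_subset)
      have less1: "card N < card (carrier H)"
        using N.subset N(3) finH by (intro psubset_card_mono) auto
      have "card N \<noteq> 1"
        using N(2) N.one_closed by (metis card_1_singletonE singletonD)
      then have N1: "card N > 1" using finN N.one_closed by (metis card_gt_0_iff empty_iff less_one nat_neq_iff)
      have sub: "solvable (H\<lparr>carrier := N\<rparr>)"
        using less.hyps[of "H\<lparr>carrier := N\<rparr>"] less1 finN less.prems(3) dvd_prime_factors[OF _ card_dvd] c0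
          subgroup.subgroup_is_group[OF N.is_subgroup H.is_group] by auto
      interpret Q: group "H Mod N" by (rule N.factorgroup_is_group)
      have finQ: "finite (carrier (H Mod N))" using finH by (simp add: FactGroup_def RCOSETS_def)
      have idx: "card (carrier (H Mod N)) * card N = card (carrier H)"
        using H.lagrange[OF N.is_subgroup] by (simp add: FactGroup_def Coset.order_def)
      obtain K :: "nat monoid" and h where K: "group K" "h \<in> iso (H Mod N) K"
        using Q.exists_nat_copy[OF finQ] by blast
      have cK: "card (carrier K) = card (carrier (H Mod N))" and finK: "finite (carrier K)"
        using K(2) finQ by (auto simp: iso_def bij_betw_same_card bij_betw_finite)
      have "card (carrier K) < card (carrier H)"
        using idx N1 c0 cK by (metis mult.right_neutral mult_less_cancel1 nat_0_less_mult_iff)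
      moreover have "card (carrier K) dvd card (carrier H)" using idx cK by (metis dvd_triv_left)
      ultimately have quot: "solvable K"
        using less.hyps[of K] K(1) finK less.prems(3) dvd_prime_factors c0 by blast
      define g where "g = (\<lambda>x. h (N #>\<^bsub>H\<^esub> x))"
      have h: "h \<in> hom (H Mod N) K" "bij_betw h (carrier (H Mod N)) (carrier K)"
        using K(2) by (auto simp: iso_def)
      have g: "group_hom H K g"
        using Group.hom_compose[OF N.r_coset_hom_Mod h(1)] H.is_group K(1)
        by (simp add: g_def group_hom_def group_hom_axioms_def comp_def)
      have carr: "(\<lambda>x. N #>\<^bsub>H\<^esub> x) ` carrier H = carrier (H Mod N)"
        by (auto simp: FactGroup_def RCOSETS_def)
      have surj: "g ` carrier H = carrier K"
      proof -
        have "g ` carrier H = h ` (\<lambda>x. N #>\<^bsub>H\<^esub> x) ` carrier H" by (simp add: g_def image_image)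
        then show ?thesis unfolding carr using h(2) by (simp add: bij_betw_def)
      qed
      have ker: "kernel H K g \<subseteq> (\<lambda>x. x) ` carrier (H\<lparr>carrier := N\<rparr>)"
      proof
        fix x assume "x \<in> kernel H K g"
        then have x: "x \<in> carrier H" "h (N #>\<^bsub>H\<^esub> x) = \<one>\<^bsub>K\<^esub>" by (auto simp: kernel_def g_def)
        have "h N = \<one>\<^bsub>K\<^esub>" using hom_one[OF h(1) Q.is_group K(1)] by simp
        moreover have "N #>\<^bsub>H\<^esub> x \<in> carrier (H Mod N)" using carr x by blast
        moreover have "N \<in> carrier (H Mod N)" using Q.one_closed by simp
        ultimately have "N #>\<^bsub>H\<^esub> x = N" using h(2) x(2) unfolding bij_betw_def inj_on_def by metis
        then have "x \<in> N" using N.coset_kernel x by blast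
        then show "x \<in> (\<lambda>x. x) ` carrier (H\<lparr>carrier := N\<rparr>)" by simp
      qed
      have "group_hom (H\<lparr>carrier := N\<rparr>) H (\<lambda>x. x)"
        using subgroup.subgroup_is_group[OF N.is_subgroup H.is_group] H.is_group N.subset
        by (auto simp: group_hom_def group_hom_axioms_def hom_def)
      then show ?thesis using solvable_condition[OF _ g surj ker sub quot] by blast
    qed (rule comm_group_imp_solvable)
  qed
  obtain H :: "nat monoid" and h where H: "group H" "h \<in> iso G H"
    using exists_nat_copy[OF fin] by blast
  have "card (carrier H) = card (carrier G)" "finite (carrier H)"
    using H(2) fin by (auto simp: iso_def bij_betw_same_card bij_betw_finite)
  then have "solvable H" using nat[of H] H pq by simp
  moreover have "group_hom G H h" "inj_on h (carrier G)"
    using H is_group by (auto simp: group_hom_def group_hom_axioms_def iso_def bij_betw_def)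
  ultimately show ?thesis using group_hom.inj_hom_imp_solvable by blast
qed

lemma (in group) solvable_seq_subset:
  assumes "solvable_seq G H" "subgroup K G" "K \<subseteq> H"
  shows "solvable_seq G K"
proof -
  obtain n where n: "(derived G ^^ n) H = {\<one>}" using solvable_imp_trivial_derived_seq[OF assms(1)] by blast
  have "(derived G ^^ n) K \<subseteq> {\<one>}" using mono_exp_of_derived[OF assms(3), of n] n by simp
  moreover have "\<one> \<in> (derived G ^^ n) K"
    using exp_of_derived_is_subgroup[OF assms(2)] by (rule subgroup.one_closed)
  ultimately show ?thesis using trivial_derived_seq_imp_solvable[OF assms(2), of n] by blast
qed

text \<open>The product is an extension of \<open>K\<close> by a subgroup of \<open>G Mod K\<close>,
  namely the image of \<open>H\<close>, and both are soluble.\<close>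

lemma (in group) solvable_seq_set_mult:
  assumes K: "K \<lhd> G" "solvable_seq G K" and H: "solvable_seq G H"
  shows "solvable_seq G (K <#> H)"
proof -
  interpret K: normal K G by fact
  have HG: "subgroup H G" using solvable_imp_subgroup[OF H] .
  have sub: "subgroup (K <#> H) G" by (rule mult_norm_subgroup[OF K(1) HG])
  interpret q: group_hom G "G Mod K" "\<lambda>x. K #> x" by (rule K.coset_group_hom)
  have img: "(\<lambda>x. K #> x) ` (K <#> H) = (\<lambda>x. K #> x) ` H"
  proof -
    have 1: "K #> (k \<otimes> h) = K #> h" if k: "k \<in> K" and h: "h \<in> H" for k h
      using coset_mult_assoc[OF K.subset K.mem_carrier[OF k] subgroup.mem_carrier[OF HG h]] K.rcos_const[OF is_group k]
      by simp
    have 2: "h \<in> K <#> H" if h: "h \<in> H" for h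
      unfolding set_mult_def using h K.one_closed subgroup.mem_carrier[OF HG h]
      by (intro UN_I[of \<one>] UN_I[of h]) auto
    show ?thesis
    proof (intro equalityI image_subsetI)
      fix x assume "x \<in> K <#> H"
      then obtain k h where "k \<in> K" "h \<in> H" "x = k \<otimes> h" unfolding set_mult_def by blast
      then show "K #> x \<in> (\<lambda>x. K #> x) ` H" using 1 by simp
    next
      fix h assume "h \<in> H"
      then show "K #> h \<in> (\<lambda>x. K #> x) ` (K <#> H)" using 2 by (intro imageI)
    qed
  qed
  show ?thesis
  proof (rule solvable_seq_condition[of G G "\<lambda>x. x" "G Mod K" "\<lambda>x. K #> x" K])
    show "group_hom G G (\<lambda>x. x)" using is_group by (auto simp: group_hom_def group_hom_axioms_def hom_def)
    show "group_hom G (G Mod K) (\<lambda>x. K #> x)" by (rule q.group_hom_axioms)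
    show "(\<lambda>x. x) ` K \<subseteq> K <#> H"
    proof
      fix k assume "k \<in> (\<lambda>x. x) ` K"
      then have "k \<in> K" by simp
      then show "k \<in> K <#> H" unfolding set_mult_def using subgroup.one_closed[OF HG] K.mem_carrier
        by (intro UN_I[of k] UN_I[of \<one>]) auto
    qed
    show "kernel G (G Mod K) ((#>) K) \<subseteq> (\<lambda>x. x) ` K"
      using K.coset_kernel by (auto simp: kernel_def)
    show "solvable_seq (G Mod K) ((#>) K ` (K <#> H))"
      unfolding img using q.solvable_imp_solvable_img[OF H] .
  qed (use sub K in auto)
qed

section \<open>Wielandt's theorem\<close>

text \<open>The fibre of multiplication H \<times> K over h0 k0 consists of the pairs (h0 d, d^-1
  k0) with d in H \<inter> K.\<close>

lemma (in group) card_set_mult_Int: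
  assumes H: "subgroup H G" and K: "subgroup K G" and fin: "finite (carrier G)"
  shows "card (H <#> K) * card (H \<inter> K) = card H * card K"
proof -
  interpret H: subgroup H G by fact
  interpret K: subgroup K G by fact
  have finHK: "finite (H \<times> K)" using H.subset K.subset by (intro finite_cartesian_product finite_subset[OF _ fin])
  define f where "f = (\<lambda>(h, k). h \<otimes> k)"
  have img: "f ` (H \<times> K) = H <#> K" by (auto simp: f_def set_mult_def)
  have fibre: "card {z \<in> H \<times> K. f z = x} = card (H \<inter> K)" if x: "x \<in> H <#> K" for x
  proof -
    obtain h0 k0 where hk: "h0 \<in> H" "k0 \<in> K" "x = h0 \<otimes> k0" using x by (auto simp: set_mult_def)
    have c: "h0 \<in> carrier G" "k0 \<in> carrier G" using hk by auto
    have "bij_betw (\<lambda>d. (h0 \<otimes> d, inv d \<otimes> k0)) (H \<inter> K) {z \<in> H \<times> K. f z = x}"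
    proof (rule bij_betwI[where g = "\<lambda>(h, k). inv h0 \<otimes> h"])
      show "(\<lambda>d. (h0 \<otimes> d, inv d \<otimes> k0)) \<in> H \<inter> K \<rightarrow> {z \<in> H \<times> K. f z = x}"
      proof
        fix d assume d: "d \<in> H \<inter> K"
        then have dc: "d \<in> carrier G" by auto
        have "h0 \<otimes> d \<otimes> (inv d \<otimes> k0) = h0 \<otimes> (d \<otimes> inv d) \<otimes> k0"
          using c dc by (simp only: m_assoc inv_closed m_closed)
        then show "(h0 \<otimes> d, inv d \<otimes> k0) \<in> {z \<in> H \<times> K. f z = x}"
          using d hk c dc by (simp add: f_def)
      qed
      show "(\<lambda>(h, k). inv h0 \<otimes> h) \<in> {z \<in> H \<times> K. f z = x} \<rightarrow> H \<inter> K"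
      proof
        fix z assume "z \<in> {z \<in> H \<times> K. f z = x}"
        then obtain h k where z: "z = (h, k)" "h \<in> H" "k \<in> K" "h \<otimes> k = h0 \<otimes> k0"
          by (auto simp: f_def hk)
        have hc: "h \<in> carrier G" "k \<in> carrier G" using z by auto
        have "inv h0 \<otimes> (h \<otimes> k) \<otimes> inv k = inv h0 \<otimes> (h0 \<otimes> k0) \<otimes> inv k" using z(4) by simp
        then have "inv h0 \<otimes> h \<otimes> (k \<otimes> inv k) = (inv h0 \<otimes> h0) \<otimes> (k0 \<otimes> inv k)"
          using hc c by (simp only: m_assoc inv_closed m_closed)
        then have "inv h0 \<otimes> h = k0 \<otimes> inv k" using hc c by simp
        then show "(case z of (h, k) \<Rightarrow> inv h0 \<otimes> h) \<in> H \<inter> K"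
          using z hk by (metis H.m_closed H.m_inv_closed IntI K.m_closed K.m_inv_closed case_prod_conv)
      qed
      show "(case (h0 \<otimes> d, inv d \<otimes> k0) of (h, k) \<Rightarrow> inv h0 \<otimes> h) = d" if "d \<in> H \<inter> K" for d
        using that c by (auto simp: m_assoc[symmetric])
      show "(h0 \<otimes> (case z of (h, k) \<Rightarrow> inv h0 \<otimes> h), inv (case z of (h, k) \<Rightarrow> inv h0 \<otimes> h) \<otimes> k0) = z"
        if zz: "z \<in> {z \<in> H \<times> K. f z = x}" for z
      proof -
        obtain h k where z: "z = (h, k)" "h \<in> H" "k \<in> K" "h \<otimes> k = h0 \<otimes> k0"
          using zz by (auto simp: f_def hk)
        have hc: "h \<in> carrier G" "k \<in> carrier G" using z by auto
        have "h0 \<otimes> (inv h0 \<otimes> h) = h" using hc c by (simp add: m_assoc[symmetric])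
        moreover have "inv (inv h0 \<otimes> h) \<otimes> k0 = k"
        proof -
          have "inv (inv h0 \<otimes> h) \<otimes> k0 = inv h \<otimes> (h0 \<otimes> k0)"
            using hc c by (simp add: inv_mult_group m_assoc)
          also have "\<dots> = k" using hc z(4)[symmetric] by (simp add: m_assoc[symmetric])
          finally show ?thesis .
        qed
        ultimately show ?thesis using z(1) by simp
      qed
    qed
    then show ?thesis by (simp add: bij_betw_same_card)
  qed
  have "card H * card K = (\<Sum>z\<in>H \<times> K. 1)" by (simp add: card_cartesian_product)
  also have "\<dots> = (\<Sum>x\<in>H <#> K. \<Sum>z\<in>{z \<in> H \<times> K. f z = x}. 1)"
    using sum.image_gen[OF finHK, of "\<lambda>_. 1 :: nat" f] unfolding img .
  also have "\<dots> = (\<Sum>x\<in>H <#> K. card (H \<inter> K))" using fibre by (intro sum.cong) auto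
  finally show ?thesis by simp
qed

lemma (in group) cauchy:
  assumes fin: "finite (carrier G)" and p: "Factorial_Ring.prime p" "p dvd card (carrier G)"
  obtains y where "y \<in> carrier G" "y \<noteq> \<one>" "y [^] p = \<one>"
proof -
  obtain m where "card (carrier G) = p ^ 1 * m" using p(2) by auto
  then obtain H where H: "subgroup H G" "card H = p"
    using sylow_thm[OF p(1) is_group _ fin, of 1 m] by (auto simp: Coset.order_def)
  have "\<not> H \<subseteq> {\<one>}"
  proof
    assume "H \<subseteq> {\<one>}"
    then have "card H \<le> 1" by (metis card.empty card_mono finite.emptyI finite.insertI card_insert_disjoint empty_iff One_nat_def)
    then show False using H(2) prime_gt_1_nat[OF p(1)] by simp
  qed
  then obtain y where y: "y \<in> H" "y \<noteq> \<one>" by blast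
  interpret H: group "G\<lparr>carrier := H\<rparr>" by (rule subgroup.subgroup_is_group[OF H(1) is_group])
  have "y [^]\<^bsub>G\<lparr>carrier := H\<rparr>\<^esub> card H = \<one>"
    using H.pow_order_eq_1[of y] y by (simp add: Coset.order_def)
  then have "y [^] p = \<one>" using H(2) nat_pow_consistent by metis
  then show ?thesis using y that subgroup.mem_carrier[OF H(1)] by blast
qed

lemma (in group) conj_pow:
  assumes "x \<in> carrier G" "y \<in> carrier G"
  shows "(x \<otimes> y \<otimes> inv x) [^] (m :: nat) = x \<otimes> (y [^] m) \<otimes> inv x"
proof (induction m)
  case (Suc m)
  have "inv x \<otimes> (x \<otimes> (y \<otimes> inv x)) = y \<otimes> inv x" using assms by (simp add: m_assoc[symmetric])
  then show ?case using assms Suc by (simp add: m_assoc)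
qed (use assms in simp)

text \<open>N/K is a nontrivial elementary abelian \<open>p\<close>-group, normal in L/K. It is
  found as the \<open>p\<close>-torsion of the last nontrivial term of the derived series of
  L/K.\<close>

lemma (in group) elementary_layer:
  assumes fin: "finite (carrier G)" and K: "K \<lhd> G" and L: "solvable_seq G L" and KL: "K \<subset> L"
  shows "\<exists>p N j. Factorial_Ring.prime p \<and> subgroup N G \<and> K \<subset> N \<and> N \<subseteq> L \<and>
           (\<forall>x\<in>L. \<forall>y\<in>N. x \<otimes> y \<otimes> inv x \<in> N) \<and> card N = card K * p ^ j"
proof -
  interpret K: normal K G by fact
  have LG: "subgroup L G" using solvable_imp_subgroup[OF L] .
  interpret L: subgroup L G by fact
  interpret Q: group "G Mod K" by (rule K.factorgroup_is_group)
  define \<pi> where "\<pi> = (\<lambda>x. K #> x)"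
  interpret q: group_hom G "G Mod K" \<pi> unfolding \<pi>_def by (rule K.coset_group_hom)
  have ker: "\<pi> x = \<one>\<^bsub>G Mod K\<^esub> \<longleftrightarrow> x \<in> K" if "x \<in> carrier G" for x
    using that K.coset_kernel[of x] K.rcos_const[OF is_group, of x] by (auto simp: \<pi>_def)
  define D where "D i = (derived G ^^ i) L" for i
  obtain n where "D n = {\<one>}" using solvable_imp_trivial_derived_seq[OF L] by (auto simp: D_def)
  then have ex: "D n \<subseteq> K" by simp
  \<comment> \<open>The predecessor \<open>j\<close> of \<open>i\<close> indexes the last derived
    term of \<open>L\<close> not contained in \<open>K\<close>. Its commutators lie in
    \<open>K\<close>, so its image \<open>A\<close> in the quotient is abelian and
    nontrivial.\<close>
  define i where "i = (LEAST i. D i \<subseteq> K)"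
  have i: "D i \<subseteq> K" unfolding i_def by (rule LeastI[of "\<lambda>i. D i \<subseteq> K", OF ex])
  have "i \<noteq> 0" using i KL by (auto simp: D_def intro!: Nat.gr0I) 
  then obtain j where j: "i = Suc j" by (cases i) auto
  have Dj: "\<not> D j \<subseteq> K" using not_less_Least[of j "\<lambda>i. D i \<subseteq> K"] j unfolding i_def by simp
  have D_sub: "subgroup (D j) G" unfolding D_def by (rule exp_of_derived_is_subgroup[OF LG])
  have D_L: "D m \<subseteq> L" for m
  proof (induction m)
    case (Suc m)
    then show ?case using derived_incl[OF Suc LG] by (simp add: D_def)
  qed (simp add: D_def)
  have D_conj: "x \<otimes> d \<otimes> inv x \<in> D j" if x: "x \<in> L" and d: "d \<in> D j" for x d
  proof -
    have xc: "x \<in> carrier G" using x by simp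
    define h where "h = (\<lambda>y. x \<otimes> y \<otimes> inv x)"
    have "h \<in> hom G G"
    proof (rule homI)
      fix y z assume yz: "y \<in> carrier G" "z \<in> carrier G"
      have "inv x \<otimes> (x \<otimes> (z \<otimes> inv x)) = z \<otimes> inv x" using xc yz by (simp add: m_assoc[symmetric])
      then show "h (y \<otimes> z) = h y \<otimes> h z" using xc yz by (simp add: h_def m_assoc)
    qed (use xc in \<open>simp add: h_def\<close>)
    then interpret h: group_hom G G h by unfold_locales
    have "h ` L \<subseteq> L" using x by (auto simp: h_def)
    then have "(derived G ^^ j) (h ` L) \<subseteq> D j" unfolding D_def by (rule mono_exp_of_derived)
    then have "h ` D j \<subseteq> D j" using h.exp_of_derived_img[OF L.subset, of j] by (simp add: D_def)
    then show ?thesis using d by (auto simp: h_def)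
  qed
  define A where "A = \<pi> ` D j"
  have A_sub: "subgroup A (G Mod K)" unfolding A_def by (rule q.subgroup_img_is_subgroup[OF D_sub])
  interpret A: subgroup A "G Mod K" by (rule A_sub)
  have A_comm: "a \<otimes>\<^bsub>G Mod K\<^esub> b = b \<otimes>\<^bsub>G Mod K\<^esub> a" if ab: "a \<in> A" "b \<in> A" for a b
  proof -
    obtain x y where xy: "x \<in> D j" "y \<in> D j" "a = \<pi> x" "b = \<pi> y" using ab by (auto simp: A_def)
    have c: "x \<in> carrier G" "y \<in> carrier G" using xy subgroup.mem_carrier[OF D_sub] by auto
    have "x \<otimes> y \<otimes> inv x \<otimes> inv y \<in> derived_set G (D j)" using xy by blast
    then have "x \<otimes> y \<otimes> inv x \<otimes> inv y \<in> D (Suc j)"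
      unfolding D_def by (simp add: derived_def generate.incl)
    then have "x \<otimes> y \<otimes> inv x \<otimes> inv y \<in> K" using i j by auto
    moreover have "x \<otimes> y \<otimes> inv x \<otimes> inv y = (x \<otimes> y) \<otimes> inv (y \<otimes> x)"
      using c by (simp add: inv_mult_group m_assoc)
    ultimately have "\<pi> ((x \<otimes> y) \<otimes> inv (y \<otimes> x)) = \<one>\<^bsub>G Mod K\<^esub>"
      using iffD2[OF ker, of "(x \<otimes> y) \<otimes> inv (y \<otimes> x)"] c by (metis inv_closed m_closed)
    moreover have "\<pi> (x \<otimes> y) = \<pi> ((x \<otimes> y) \<otimes> inv (y \<otimes> x)) \<otimes>\<^bsub>G Mod K\<^esub> \<pi> (y \<otimes> x)"
    proof -
      have "x \<otimes> y = (x \<otimes> y) \<otimes> inv (y \<otimes> x) \<otimes> (y \<otimes> x)"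
        using c m_assoc[of "x \<otimes> y" "inv (y \<otimes> x)" "y \<otimes> x"] by simp
      then have "\<pi> (x \<otimes> y) = \<pi> ((x \<otimes> y) \<otimes> inv (y \<otimes> x) \<otimes> (y \<otimes> x))" by (rule arg_cong)
      also have "\<dots> = \<pi> ((x \<otimes> y) \<otimes> inv (y \<otimes> x)) \<otimes>\<^bsub>G Mod K\<^esub> \<pi> (y \<otimes> x)"
        using c by (intro q.hom_mult) simp_all
      finally show ?thesis .
    qed
    ultimately have "\<pi> (x \<otimes> y) = \<one>\<^bsub>G Mod K\<^esub> \<otimes>\<^bsub>G Mod K\<^esub> \<pi> (y \<otimes> x)" by (simp only:)
    also have "\<dots> = \<pi> (y \<otimes> x)" using c by (intro Q.l_one q.hom_closed) simp
    finally have "\<pi> (x \<otimes> y) = \<pi> (y \<otimes> x)" .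
    then show ?thesis using c xy q.hom_mult by simp
  qed
  have finQ: "finite (carrier (G Mod K))" using fin by (simp add: FactGroup_def RCOSETS_def)
  have finA: "finite A" using A.subset finQ by (rule finite_subset)
  have "\<exists>a\<in>A. a \<noteq> \<one>\<^bsub>G Mod K\<^esub>"
    using Dj ker subgroup.mem_carrier[OF D_sub] unfolding A_def by blast
  then have "card A \<noteq> 1" using A.one_closed by (metis card_1_singletonE singletonD)
  then obtain p where p: "Factorial_Ring.prime p" "p dvd card A" using prime_factor_nat by blast
  \<comment> \<open>An abelian group has its \<open>p\<close>-torsion as a subgroup, and the torsion
    condition is invariant under conjugation by \<open>L\<close>. By Cauchy's theorem no prime other
    than \<open>p\<close> divides the order of \<open>B\<close>.\<close>
  define B where "B = {y \<in> A. y [^]\<^bsub>G Mod K\<^esub> p = \<one>\<^bsub>G Mod K\<^esub>}"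
  have B_sub: "subgroup B (G Mod K)"
  proof (rule Q.subgroupI)
    show "B \<subseteq> carrier (G Mod K)" using A.subset by (auto simp: B_def)
    have "\<one>\<^bsub>G Mod K\<^esub> \<in> B" using A.one_closed Q.nat_pow_one unfolding B_def by blast
    then show "B \<noteq> {}" by blast
    show "inv\<^bsub>G Mod K\<^esub> a \<in> B" if "a \<in> B" for a
      using that A.m_inv_closed Q.nat_pow_inv[of a p] A.mem_carrier Q.inv_one unfolding B_def by simp
    show "a \<otimes>\<^bsub>G Mod K\<^esub> b \<in> B" if "a \<in> B" "b \<in> B" for a b
      using that A.m_closed Q.pow_mult_distrib[OF A_comm, of a b p] A.mem_carrier Q.l_one[OF Q.one_closed]
      unfolding B_def by simp
  qed
  interpret B: subgroup B "G Mod K" by (rule B_sub)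
  interpret BG: group "(G Mod K)\<lparr>carrier := B\<rparr>" by (rule subgroup.subgroup_is_group[OF B_sub Q.is_group])
  interpret AG: group "(G Mod K)\<lparr>carrier := A\<rparr>" by (rule subgroup.subgroup_is_group[OF A_sub Q.is_group])
  obtain y where y: "y \<in> A" "y \<noteq> \<one>\<^bsub>G Mod K\<^esub>" "y [^]\<^bsub>G Mod K\<^esub> p = \<one>\<^bsub>G Mod K\<^esub>"
    using AG.cauchy[of p] finA p Q.nat_pow_consistent[of _ p A] by auto
  have finB: "finite B" using B.subset finQ by (rule finite_subset)
  have cardB: "card B = p ^ multiplicity p (card B)"
  proof (rule prime_factors_singleton_power)
    show "card B > 0" using finB B.one_closed by (auto simp: card_gt_0_iff)
    show "prime_factors (card B) \<subseteq> {p}"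
    proof
      fix r assume "r \<in> prime_factors (card B)"
      then have r: "Factorial_Ring.prime r" "r dvd card B" by auto
      obtain z where z: "z \<in> B" "z \<noteq> \<one>\<^bsub>G Mod K\<^esub>" "z [^]\<^bsub>G Mod K\<^esub> r = \<one>\<^bsub>G Mod K\<^esub>"
        using BG.cauchy[of r] finB r Q.nat_pow_consistent[of _ r B] by auto
      have zc: "z \<in> carrier (G Mod K)" "z [^]\<^bsub>G Mod K\<^esub> p = \<one>\<^bsub>G Mod K\<^esub>"
        using z(1) B.mem_carrier by (auto simp: B_def)
      have "Q.ord z dvd r" "Q.ord z dvd p" using Q.pow_eq_id zc z by auto
      moreover have "Q.ord z \<noteq> 1" using Q.ord_eq_1 zc z(2) by blast
      ultimately have "r = p" using r(1) p(1) by (metis prime_nat_iff)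
      then show "r \<in> {p}" by simp
    qed
  qed
  define N where "N = {x \<in> carrier G. \<pi> x \<in> B}"
  have "subgroup N G"
  proof (rule subgroupI)
    have "\<one> \<in> N" using B.one_closed by (simp add: N_def q.hom_one)
    then show "N \<noteq> {}" by blast
    show "inv a \<in> N" if "a \<in> N" for a
      using that B.m_inv_closed[of "\<pi> a"] by (simp add: N_def)
    show "a \<otimes> b \<in> N" if "a \<in> N" "b \<in> N" for a b
      using that B.m_closed[of "\<pi> a" "\<pi> b"] q.hom_mult unfolding N_def by simp
  qed (simp add: N_def)
  moreover have "K \<subset> N"
  proof
    show "K \<subseteq> N"
    proof
      fix x assume x: "x \<in> K"
      then have "\<pi> x = \<one>\<^bsub>G Mod K\<^esub>" using ker by simp
      then show "x \<in> N" using x B.one_closed by (simp add: N_def)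
    qed
    obtain d where d: "d \<in> D j" "y = \<pi> d" using y(1) by (auto simp: A_def)
    have dc: "d \<in> carrier G" using d(1) subgroup.mem_carrier[OF D_sub] by blast
    have "d \<in> N" using y d dc by (simp add: N_def B_def)
    moreover have "d \<notin> K" using y(2) d ker dc by simp
    ultimately show "K \<noteq> N" by blast
  qed
  moreover have "N \<subseteq> L"
  proof
    fix x assume x: "x \<in> N"
    then obtain d where d: "d \<in> D j" "\<pi> x = \<pi> d" "x \<in> carrier G" by (auto simp: N_def B_def A_def)
    have dc: "d \<in> carrier G" using d(1) subgroup.mem_carrier[OF D_sub] by blast
    have "x \<in> K #> d" using d rcos_self[OF d(3) K.is_subgroup] by (simp add: \<pi>_def)
    then obtain k where k: "k \<in> K" "x = k \<otimes> d" by (auto simp: r_coset_def)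
    then show "x \<in> L" using KL D_L[of j] d(1) by (metis L.m_closed psubsetD subsetD)
  qed
  moreover have "x \<otimes> y \<otimes> inv x \<in> N" if x: "x \<in> L" and y: "y \<in> N" for x y
  proof -
    have c: "x \<in> carrier G" "y \<in> carrier G" using x y by (auto simp: N_def)
    obtain d where d: "d \<in> D j" "\<pi> y = \<pi> d" using y by (auto simp: N_def B_def A_def)
    have dc: "d \<in> carrier G" using d(1) subgroup.mem_carrier[OF D_sub] by blast
    have yp: "\<pi> y [^]\<^bsub>G Mod K\<^esub> p = \<one>\<^bsub>G Mod K\<^esub>" using y by (simp add: N_def B_def)
    have "\<pi> (x \<otimes> y \<otimes> inv x) = \<pi> (x \<otimes> d \<otimes> inv x)" using c dc d(2) by simp
    then have inA: "\<pi> (x \<otimes> y \<otimes> inv x) \<in> A" using D_conj[OF x d(1)] by (simp add: A_def)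
    have "\<pi> (y [^] p) = \<one>\<^bsub>G Mod K\<^esub>" using yp q.hom_nat_pow[of y p] c by (simp only:)
    then have "y [^] p \<in> K" using iffD1[OF ker, of "y [^] p"] c by simp
    then have "x \<otimes> (y [^] p) \<otimes> inv x \<in> K" using K.inv_op_closed2 c by blast
    then have "\<pi> (x \<otimes> y \<otimes> inv x) [^]\<^bsub>G Mod K\<^esub> p = \<one>\<^bsub>G Mod K\<^esub>"
    proof -
      have z: "x \<otimes> y \<otimes> inv x \<in> carrier G" using c by simp
      have "\<pi> ((x \<otimes> y \<otimes> inv x) [^] p) = \<one>\<^bsub>G Mod K\<^esub>"
        using \<open>x \<otimes> (y [^] p) \<otimes> inv x \<in> K\<close> iffD2[OF ker, of "(x \<otimes> y \<otimes> inv x) [^] p"] z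
        unfolding conj_pow[OF c] by (metis K.mem_carrier)
      then show ?thesis using q.hom_nat_pow[OF z, of p] by (simp only:)
    qed
    with inA have "\<pi> (x \<otimes> y \<otimes> inv x) \<in> B" unfolding B_def by blast
    moreover have "x \<otimes> y \<otimes> inv x \<in> carrier G" using c by simp
    ultimately show ?thesis unfolding N_def by blast
  qed
  moreover have "card N = card K * p ^ multiplicity p (card B)"
    using card_normal_union[OF K fin B.subset] cardB by (simp add: N_def \<pi>_def)
  ultimately show ?thesis using p(1) by blast
qed

text \<open>The index \<open>c\<close> of H \<inter> K in \<open>H\<close> satisfies |G:H| c = |G:K|
  d, so coprimality forces |G:K| to divide \<open>c\<close>. The product set has c |K| elements,
  hence at least |G|.\<close>

lemma (in group) coprime_index_set_mult:
  assumes H: "subgroup H G" and K: "subgroup K G" and fin: "finite (carrier G)"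
    and cop: "coprime (card (rcosets H)) (card (rcosets K))"
  shows "H <#> K = carrier G"
proof -
  have HK: "H \<subseteq> carrier G" "K \<subseteq> carrier G" using H K by (auto dest: subgroup.subset)
  have int: "subgroup (H \<inter> K) G" by (rule subgroups_Inter_pair[OF H K])
  have "finite (H \<inter> K)" using HK fin by (meson finite_Int finite_subset)
  then have pos: "card (H \<inter> K) > 0" using subgroup.one_closed[OF int] by (auto simp: card_gt_0_iff)
  obtain c where c: "card H = card (H \<inter> K) * c"
    using card_subgroup_dvd_subgroup[OF int H] by blast
  obtain d where d: "card K = card (H \<inter> K) * d"
    using card_subgroup_dvd_subgroup[OF int K] by blast
  have G: "card (rcosets H) * card H = card (carrier G)" "card (rcosets K) * card K = card (carrier G)"
    using lagrange[OF H] lagrange[OF K] by (auto simp: Coset.order_def)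
  then have "card (H \<inter> K) * (card (rcosets H) * c) = card (H \<inter> K) * (card (rcosets K) * d)"
    unfolding c d by (simp add: mult_ac)
  then have "card (rcosets H) * c = card (rcosets K) * d" using pos by simp
  then have "card (rcosets K) dvd card (rcosets H) * c" by simp
  then have "card (rcosets K) dvd c" using cop by (simp add: coprime_dvd_mult_right_iff coprime_commute)
  then obtain t where t: "c = card (rcosets K) * t" by blast
  have "card (H <#> K) * card (H \<inter> K) = card (H \<inter> K) * (c * card K)"
    using card_set_mult_Int[OF H K fin] unfolding c by (simp add: mult_ac)
  then have "card (H <#> K) = c * card K" using pos by simp
  also have "\<dots> = card (carrier G) * t" using G(2) by (simp add: t mult_ac)
  finally have eq: "card (H <#> K) = card (carrier G) * t" .
  have "card H > 0" using HK(1) fin subgroup.one_closed[OF H] by (auto simp: card_gt_0_iff dest: finite_subset)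
  then have "t > 0" using t c by (auto intro: Nat.gr0I)
  then have "card (carrier G) \<le> card (H <#> K)" unfolding eq by simp
  then show ?thesis using setmult_subset_G[OF HK] fin by (intro card_seteq) auto
qed

lemma (in group) index_dvd_index:
  assumes H: "subgroup H G" and L: "subgroup L G" and HL: "H \<subseteq> L" and fin: "finite (carrier G)"
  shows "card (rcosets L) dvd card (rcosets H)"
proof -
  obtain c where c: "card L = card H * c" using card_subgroup_dvd_subgroup[OF H L HL] by blast
  have "finite H" using subgroup.subset[OF H] fin by (rule finite_subset)
  then have pos: "card H > 0" using subgroup.one_closed[OF H] by (auto simp: card_gt_0_iff)
  have "card H * card (rcosets H) = card H * (card (rcosets L) * c)"
    using lagrange[OF H] lagrange[OF L] unfolding c by (simp add: mult_ac)
  then show ?thesis using pos by simp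
qed

text \<open>Let \<open>r\<close> be the index of N \<inter> L2 in \<open>N\<close>. It divides a
  power of \<open>p\<close>, because N \<inter> L2 contains \<open>K\<close>. It also divides
  |G:L2|: it is the index of L1 \<inter> L2 in the subgroup N (L1 \<inter> L2) of L1, and L1
  \<inter> L2 has index |G:L2| in L1 by coprimality. Hence r = 1.\<close>

lemma (in group) layer_subset:
  assumes L: "subgroup L1 G" "subgroup L2 G" and fin: "finite (carrier G)"
    and cop: "coprime (card (rcosets L1)) (card (rcosets L2))"
    and p: "Factorial_Ring.prime p" "\<not> p dvd card (rcosets L2)"
    and N: "subgroup N G" "N \<subseteq> L1" "\<forall>x\<in>L1. \<forall>y\<in>N. x \<otimes> y \<otimes> inv x \<in> N" "card N = card K * p ^ j"
    and K: "subgroup K G" "K \<subseteq> N" "K \<subseteq> L2"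
  shows "N \<subseteq> L2"
proof -
  define M where "M = L1 \<inter> L2"
  have M: "subgroup M G" unfolding M_def by (rule subgroups_Inter_pair[OF L])
  interpret L1: group "G\<lparr>carrier := L1\<rparr>" by (rule subgroup.subgroup_is_group[OF L(1) is_group])
  have "N \<lhd> G\<lparr>carrier := L1\<rparr>"
  proof (rule L1.normal_invI[OF subgroup_incl[OF N(1) L(1) N(2)]])
    fix x h assume "x \<in> carrier (G\<lparr>carrier := L1\<rparr>)" "h \<in> N"
    then show "x \<otimes>\<^bsub>G\<lparr>carrier := L1\<rparr>\<^esub> h \<otimes>\<^bsub>G\<lparr>carrier := L1\<rparr>\<^esub> inv\<^bsub>G\<lparr>carrier := L1\<rparr>\<^esub> x \<in> N"
      using N(3) m_inv_consistent[OF L(1)] by simp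
  qed
  moreover have "subgroup M (G\<lparr>carrier := L1\<rparr>)"
    by (rule subgroup_incl[OF M L(1)]) (simp add: M_def)
  ultimately have "subgroup (N <#> M) (G\<lparr>carrier := L1\<rparr>)"
    using L1.mult_norm_subgroup[of N M] by simp
  then have dvd1: "card (N <#> M) dvd card L1" using L1.card_subgroup_dvd by fastforce
  have posI: "card H > 0" if "subgroup H G" for H
    using subgroup.subset[OF that] fin subgroup.one_closed[OF that] by (auto simp: card_gt_0_iff dest: finite_subset)
  have cL1: "card L1 = card (rcosets L2) * card M"
  proof -
    have "card (carrier G) * card M = card L1 * card L2"
      using card_set_mult_Int[OF L fin] coprime_index_set_mult[OF L fin cop] by (simp add: M_def)
    moreover have "card (rcosets L2) * card L2 = card (carrier G)"
      using lagrange[OF L(2)] by (simp add: Coset.order_def)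
    ultimately have "card L2 * (card (rcosets L2) * card M) = card L2 * card L1"
      by (metis mult.assoc mult.commute)
    then show ?thesis using posI[OF L(2)] by simp
  qed
  have NL: "subgroup (N \<inter> L2) G" by (rule subgroups_Inter_pair[OF N(1) L(2)])
  obtain r where r: "card N = card (N \<inter> L2) * r"
    using card_subgroup_dvd_subgroup[OF NL N(1)] by blast
  have "N \<inter> M = N \<inter> L2" using N(2) by (auto simp: M_def)
  then have "card (N \<inter> L2) * card (N <#> M) = card (N \<inter> L2) * (r * card M)"
    using card_set_mult_Int[OF N(1) M fin] r by (simp add: mult_ac)
  then have "card (N <#> M) = r * card M" using posI[OF NL] by simp
  then have r1: "r dvd card (rcosets L2)" using dvd1 posI[OF M] unfolding cL1 by simp
  obtain s where s: "card (N \<inter> L2) = card K * s"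
    using card_subgroup_dvd_subgroup[OF K(1) NL] K by blast
  have "card K * (s * r) = card K * p ^ j" unfolding N(4)[symmetric] r s by (rule mult.assoc[symmetric])
  then have "s * r = p ^ j" using posI[OF K(1)] by simp
  then have "r dvd p ^ j" by (metis dvd_triv_right)
  then obtain i where i: "r = p ^ i" using divides_primepow_nat[OF p(1)] by blast
  have "i = 0"
  proof (rule ccontr)
    assume "i \<noteq> 0"
    then have "p dvd r" using i by (simp add: dvd_power)
    then show False using r1 p(2) dvd_trans by blast
  qed
  then have "card N = card (N \<inter> L2)" using r i by simp
  moreover have "finite N" using subgroup.subset[OF N(1)] fin by (rule finite_subset)
  ultimately have "N \<inter> L2 = N" by (intro card_subset_eq) auto
  then show ?thesis by blast
qed

text \<open>Every element of the group is a product a b with a in L2 and b in L1. Conjugation by b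
  keeps \<open>N\<close> inside itself, hence in L2, and conjugation by a does not leave L2. So
  \<open>N\<close> lies in \<open>M\<close>, the intersection of the conjugates of L2.\<close>

lemma (in group) normal_core:
  assumes L: "subgroup L2 G" "L2 <#> L1 = carrier G"
    and N: "N \<subseteq> L2" "\<forall>x\<in>L1. \<forall>y\<in>N. x \<otimes> y \<otimes> inv x \<in> N" and L1: "L1 \<subseteq> carrier G"
  shows "\<exists>M. M \<lhd> G \<and> N \<subseteq> M \<and> M \<subseteq> L2"
proof -
  interpret L2: subgroup L2 G by (rule L(1))
  define M where "M = {x \<in> carrier G. \<forall>g\<in>carrier G. g \<otimes> x \<otimes> inv g \<in> L2}"
  have "subgroup M G"
  proof (rule subgroupI)
    have "\<one> \<in> M" by (simp add: M_def)
    then show "M \<noteq> {}" by blast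
    show "inv a \<in> M" if "a \<in> M" for a
    proof -
      have a: "a \<in> carrier G" using that by (simp add: M_def)
      have "g \<otimes> inv a \<otimes> inv g \<in> L2" if g: "g \<in> carrier G" for g
      proof -
        have "inv (g \<otimes> a \<otimes> inv g) \<in> L2" using \<open>a \<in> M\<close> g by (simp add: M_def)
        then show ?thesis using a g by (simp add: inv_mult_group m_assoc)
      qed
      then show ?thesis using a by (simp add: M_def)
    qed
    show "a \<otimes> b \<in> M" if ab: "a \<in> M" "b \<in> M" for a b
    proof -
      have c: "a \<in> carrier G" "b \<in> carrier G" using ab by (auto simp: M_def)
      have "g \<otimes> (a \<otimes> b) \<otimes> inv g \<in> L2" if g: "g \<in> carrier G" for g
      proof -
        have "(g \<otimes> a \<otimes> inv g) \<otimes> (g \<otimes> b \<otimes> inv g) \<in> L2" using ab g by (simp add: M_def)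
        moreover have "inv g \<otimes> (g \<otimes> (b \<otimes> inv g)) = b \<otimes> inv g" using c g by (simp add: m_assoc[symmetric])
        ultimately show ?thesis using c g by (simp add: m_assoc)
      qed
      then show ?thesis using c by (simp add: M_def)
    qed
  qed (simp add: M_def)
  then have "M \<lhd> G"
  proof (rule normal_invI)
    fix x h assume x: "x \<in> carrier G" and h: "h \<in> M"
    have hc: "h \<in> carrier G" using h by (simp add: M_def)
    have "g \<otimes> (x \<otimes> h \<otimes> inv x) \<otimes> inv g \<in> L2" if g: "g \<in> carrier G" for g
    proof -
      have "(g \<otimes> x) \<otimes> h \<otimes> inv (g \<otimes> x) \<in> L2" using h x g by (simp add: M_def)
      then show ?thesis using x hc g by (simp add: inv_mult_group m_assoc)
    qed
    then show "x \<otimes> h \<otimes> inv x \<in> M" using x hc by (simp add: M_def)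
  qed
  moreover have "N \<subseteq> M"
  proof
    fix y assume y: "y \<in> N"
    have yc: "y \<in> carrier G" using y N(1) L2.subset by blast
    have "g \<otimes> y \<otimes> inv g \<in> L2" if g: "g \<in> carrier G" for g
    proof -
      obtain a b where ab: "a \<in> L2" "b \<in> L1" "g = a \<otimes> b" using g L(2) unfolding set_mult_def by blast
      have c: "a \<in> carrier G" "b \<in> carrier G" using ab L1 by auto
      have "b \<otimes> y \<otimes> inv b \<in> L2" using N ab(2) y by blast
      then have "a \<otimes> (b \<otimes> y \<otimes> inv b) \<otimes> inv a \<in> L2" using ab(1) by simp
      then show ?thesis using c yc by (simp add: ab(3) inv_mult_group m_assoc)
    qed
    then show "y \<in> M" using yc by (simp add: M_def)
  qed
  moreover have "M \<subseteq> L2"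
  proof
    fix x assume x: "x \<in> M"
    then have "\<one> \<otimes> x \<otimes> inv \<one> \<in> L2" by (simp only: M_def mem_Collect_eq one_closed)
    then show "x \<in> L2" using x by (simp add: M_def)
  qed
  ultimately show ?thesis by blast
qed

text \<open>A soluble normal subgroup \<open>K\<close> of largest order takes the place of an
  induction through quotients. The subgroups are enlarged by \<open>K\<close>, which keeps their
  indices coprime. If K = L1, then L1 L2 = L2 is the whole group. Otherwise a \<open>p\<close>-layer
  \<open>N\<close> over \<open>K\<close> in L1 is pushed into whichever of L2 and L3 has index prime
  to \<open>p\<close>.\<close>

theorem (in group) wielandt_three_solvable:
  assumes fin: "finite (carrier G)"
    and H: "solvable_seq G H1" "solvable_seq G H2" "solvable_seq G H3"
    and cop: "coprime (card (rcosets H1)) (card (rcosets H2))"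
      "coprime (card (rcosets H1)) (card (rcosets H3))"
      "coprime (card (rcosets H2)) (card (rcosets H3))"
  shows "solvable G"
proof -
  define \<K> where "\<K> = {K. K \<lhd> G \<and> solvable_seq G K}"
  have "\<K> \<subseteq> Pow (carrier G)" by (auto simp: \<K>_def dest!: normal_imp_subgroup subgroup.subset)
  then have fin\<K>: "finite \<K>" using fin by (simp add: finite_subset)
  have "{\<one>} \<in> \<K>" using one_is_normal solvable_seq.unity by (simp add: \<K>_def)
  then have "Max (card ` \<K>) \<in> card ` \<K>" using fin\<K> by (intro Max_in) auto
  then obtain K where K: "K \<in> \<K>" "card K = Max (card ` \<K>)" by auto
  then have Kmax: "card M \<le> card K" if "M \<in> \<K>" for M using fin\<K> that by simp
  have Kn: "K \<lhd> G" and Ks: "solvable_seq G K" using K(1) by (auto simp: \<K>_def)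
  interpret K: normal K G by (rule Kn)
  have grow: "\<not> (M \<lhd> G \<and> solvable_seq G M \<and> K \<subset> M)" for M
  proof
    assume M: "M \<lhd> G \<and> solvable_seq G M \<and> K \<subset> M"
    then have "finite M" using fin by (meson finite_subset normal_imp_subgroup subgroup.subset)
    then have "card K < card M" using M by (intro psubset_card_mono) auto
    then show False using Kmax[of M] M by (simp add: \<K>_def)
  qed
  define L where "L H = K <#> H" for H
  have Ls: "solvable_seq G (L H)" if "solvable_seq G H" for H
    unfolding L_def by (rule solvable_seq_set_mult[OF Kn Ks that])
  have KL: "K \<subseteq> L H" "H \<subseteq> L H" if "solvable_seq G H" for H
  proof -
    have HG: "subgroup H G" by (rule solvable_imp_subgroup[OF that])
    show "K \<subseteq> L H"
    proof
      fix k assume "k \<in> K"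
      then show "k \<in> L H" unfolding L_def set_mult_def using subgroup.one_closed[OF HG] K.mem_carrier
        by (intro UN_I[of k] UN_I[of \<one>]) auto
    qed
    show "H \<subseteq> L H"
    proof
      fix h assume "h \<in> H"
      then show "h \<in> L H" unfolding L_def set_mult_def using K.one_closed subgroup.mem_carrier[OF HG]
        by (intro UN_I[of \<one>] UN_I[of h]) auto
    qed
  qed
  have Lcop: "coprime (card (rcosets (L A))) (card (rcosets (L B)))"
    if "solvable_seq G A" "solvable_seq G B" "coprime (card (rcosets A)) (card (rcosets B))" for A B
    using index_dvd_index[OF solvable_imp_subgroup[OF that(1)] solvable_imp_subgroup[OF Ls[OF that(1)]] KL(2)[OF that(1)] fin]
      index_dvd_index[OF solvable_imp_subgroup[OF that(2)] solvable_imp_subgroup[OF Ls[OF that(2)]] KL(2)[OF that(2)] fin]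
      that(3) by (rule coprime_divisors)
  define L1 L2 L3 where "L1 = L H1" and "L2 = L H2" and "L3 = L H3"
  note Lsol = Ls[OF H(1), folded L1_def] Ls[OF H(2), folded L2_def] Ls[OF H(3), folded L3_def]
  note Lsub = Lsol[THEN solvable_imp_subgroup]
  note KLs = KL(1)[OF H(1), folded L1_def] KL(1)[OF H(2), folded L2_def] KL(1)[OF H(3), folded L3_def]
  have c12: "coprime (card (rcosets L1)) (card (rcosets L2))" unfolding L1_def L2_def by (rule Lcop[OF H(1,2) cop(1)])
  have c13: "coprime (card (rcosets L1)) (card (rcosets L3))" unfolding L1_def L3_def by (rule Lcop[OF H(1,3) cop(2)])
  have c23: "coprime (card (rcosets L2)) (card (rcosets L3))" unfolding L2_def L3_def by (rule Lcop[OF H(2,3) cop(3)])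
  show ?thesis
  proof (cases "K = L1")
    case True
    have "L1 <#> L2 = carrier G" by (rule coprime_index_set_mult[OF Lsub(1,2) fin c12])
    moreover have "L1 <#> L2 \<subseteq> L2"
      using True KLs(2) subgroup.m_closed[OF Lsub(2)] unfolding set_mult_def by blast
    ultimately have "L2 = carrier G" using subgroup.subset[OF Lsub(2)] by blast
    then show ?thesis using Lsol(2) by (simp add: solvable_def)
  next
    case False
    then have KL1: "K \<subset> L1" using KLs by blast
    obtain p N j where pN: "Factorial_Ring.prime p" "subgroup N G" "K \<subset> N" "N \<subseteq> L1"
        "\<forall>x\<in>L1. \<forall>y\<in>N. x \<otimes> y \<otimes> inv x \<in> N" "card N = card K * p ^ j"
      using elementary_layer[OF fin Kn Lsol(1) KL1] by blast
    \<comment> \<open>Here \<open>N\<close> lies in L', and so does a normal subgroup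
      \<open>M\<close> of the whole group containing \<open>N\<close>. As a subgroup of L' it is
      soluble, and it is larger than \<open>K\<close>.\<close>
    have contra: False if L': "subgroup L' G" "solvable_seq G L'" "K \<subseteq> L'"
        "coprime (card (rcosets L1)) (card (rcosets L'))" and p: "\<not> p dvd card (rcosets L')" for L'
    proof -
      have "N \<subseteq> L'"
        using layer_subset[OF Lsub(1) L'(1) fin L'(4) pN(1) p pN(2,4,5,6) K.is_subgroup _ L'(3)] pN(3) by blast
      moreover have "L' <#> L1 = carrier G"
        using L'(4) by (intro coprime_index_set_mult[OF L'(1) Lsub(1) fin]) (simp add: coprime_commute)
      ultimately obtain M where M: "M \<lhd> G" "N \<subseteq> M" "M \<subseteq> L'"
        using normal_core[OF L'(1) _ _ pN(5) subgroup.subset[OF Lsub(1)]] by blast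
      then have "solvable_seq G M" using solvable_seq_subset[OF L'(2) normal_imp_subgroup[OF M(1)] M(3)] by blast
      then show False using grow[of M] M pN(3) by blast
    qed
    have "\<not> (p dvd card (rcosets L2) \<and> p dvd card (rcosets L3))"
      using c23 pN(1) by (meson coprime_common_divisor not_prime_unit)
    then show ?thesis
      using contra[OF Lsub(2) Lsol(2) KLs(2) c12] contra[OF Lsub(3) Lsol(3) KLs(3) c13] by blast
  qed
qed

section \<open>Nilpotent groups\<close>

lemma (in group) lower_central_normal: "lower_central G n \<lhd> G"
proof (induction n)
  case 0
  have "carrier G \<lhd> G" by (rule normal_invI[OF subgroup_self]) auto
  then show ?case by simp
next
  case (Suc n)
  interpret N: normal "lower_central G n" G by (rule Suc)
  show ?case unfolding lower_central.simps
  proof (rule normal_generateI)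
    show "{h \<otimes> g \<otimes> inv h \<otimes> inv g | h g. h \<in> lower_central G n \<and> g \<in> carrier G} \<subseteq> carrier G" by auto
    fix c x assume "c \<in> {h \<otimes> g \<otimes> inv h \<otimes> inv g | h g. h \<in> lower_central G n \<and> g \<in> carrier G}" and x: "x \<in> carrier G"
    then obtain h g where h: "h \<in> lower_central G n" "g \<in> carrier G" "c = h \<otimes> g \<otimes> inv h \<otimes> inv g" by blast
    have hc: "h \<in> carrier G" using h by simp
    have cancel: "inv x \<otimes> (x \<otimes> z) = z" if "z \<in> carrier G" for z using x that by (simp add: m_assoc[symmetric])
    have "x \<otimes> c \<otimes> inv x = (x \<otimes> h \<otimes> inv x) \<otimes> (x \<otimes> g \<otimes> inv x) \<otimes> inv (x \<otimes> h \<otimes> inv x) \<otimes> inv (x \<otimes> g \<otimes> inv x)"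
      using x h(2,3) hc by (simp add: inv_mult_group m_assoc cancel)
    moreover have "x \<otimes> h \<otimes> inv x \<in> lower_central G n" using N.inv_op_closed2 x h(1) by blast
    ultimately show "x \<otimes> c \<otimes> inv x \<in> {h \<otimes> g \<otimes> inv h \<otimes> inv g | h g. h \<in> lower_central G n \<and> g \<in> carrier G}"
      using x h(2) by blast
  qed
qed

lemma (in group) lower_central_commutator:
  assumes "h \<in> lower_central G n" "g \<in> carrier G"
  shows "h \<otimes> g \<otimes> inv h \<otimes> inv g \<in> lower_central G (Suc n)"
  unfolding lower_central.simps using assms by (intro generate.incl) blast

section \<open>Hall subgroups of nilpotent groups as solution sets of power equations\<close>

lemma (in group) coset_pow_coprime:
  assumes P: "P \<lhd> G" and fin: "finite (carrier G)"
    and cop: "coprime (card P) (card (rcosets P))"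
    and x: "x \<in> carrier G" "x [^] card P = \<one>"
  shows "x \<in> P"
proof -
  interpret P: normal P G by fact
  interpret q: group_hom G "G Mod P" "\<lambda>x. P #> x" by (rule P.coset_group_hom)
  have z: "P #> x \<in> carrier (G Mod P)" using x(1) by (rule q.hom_closed)
  have "(P #> x) [^]\<^bsub>G Mod P\<^esub> card P = P #> (x [^] card P)" using q.hom_nat_pow[OF x(1)] by simp
  also have "\<dots> = \<one>\<^bsub>G Mod P\<^esub>" unfolding x(2) by (rule q.hom_one)
  finally have "q.H.ord (P #> x) dvd card P" using q.H.pow_eq_id[OF z] by blast
  moreover have "q.H.ord (P #> x) dvd card (rcosets P)"
    using q.H.ord_dvd_group_order[OF z] by (simp add: Coset.order_def FactGroup_def)
  ultimately have "q.H.ord (P #> x) = 1" using cop by (metis coprime_common_divisor_nat)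
  then have "P #> x = \<one>\<^bsub>G Mod P\<^esub>" using q.H.ord_eq_1[OF z] by blast
  then show ?thesis using P.coset_kernel[OF x(1)] by simp
qed

text \<open>\<open>P\<close> is subnormal: \<open>\<gamma>\<^sub>i\<^sub>+\<^sub>1 P\<close> is normal in \<open>\<gamma>\<^sub>i P\<close> for the lower central series \<open>\<gamma>\<close>. A
  normal Hall subgroup is characteristic, so normality is passed up the chain.\<close>

lemma (in group) nilpotent_hall_contains:
  assumes nil: "nilpotent G" and fin: "finite (carrier G)" and P: "subgroup P G"
    and cop: "coprime (card P) (card (rcosets P))"
    and x: "x \<in> carrier G" "x [^] card P = \<one>"
  shows "x \<in> P"
proof -
  interpret P: subgroup P G by fact
  define U where "U i = lower_central G i <#> P" for i
  have U_sub: "subgroup (U i) G" for i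
    unfolding U_def by (rule mult_norm_subgroup[OF lower_central_normal P])
  have lc: "subgroup (lower_central G i) G" for i using lower_central_normal by (rule normal_imp_subgroup)
  have PU: "P \<subseteq> U i" for i
  proof
    fix y assume y: "y \<in> P"
    show "y \<in> U i" unfolding U_def set_mult_def using y subgroup.one_closed[OF lc[of i]]
      by (intro UN_I[of \<one>] UN_I[of y]) auto
  qed
  have finP: "finite P" using P.subset fin by (rule finite_subset)
  have powP: "y [^] card P = \<one>" if y: "y \<in> P" for y
  proof -
    interpret PG: group "G\<lparr>carrier := P\<rparr>" by (rule subgroup.subgroup_is_group[OF P is_group])
    show ?thesis using PG.pow_order_eq_1[of y] y nat_pow_consistent[of y "card P" P] by (simp add: Coset.order_def)
  qed
  obtain n where n: "lower_central G n = {\<one>}" using nil unfolding nilpotent_def by blast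
  \<comment> \<open>Downward induction, from \<open>U n = P\<close> to \<open>U 0\<close>, which is
    the whole group.\<close>
  have step: "\<forall>x\<in>U i. x [^] card P = \<one> \<longrightarrow> x \<in> P" if "i \<le> n" for i
    using that
  proof (induction i rule: inc_induct)
    case base
    then show ?case unfolding U_def n by (auto simp: set_mult_def)
  next
    case (step i)
    interpret UG: group "G\<lparr>carrier := U i\<rparr>" by (rule subgroup.subgroup_is_group[OF U_sub is_group])
    have PsU: "subgroup P (G\<lparr>carrier := U i\<rparr>)" by (rule subgroup_incl[OF P U_sub PU])
    have conj: "u \<otimes> y \<otimes> inv u \<in> P" if u: "u \<in> U i" and y: "y \<in> P" for u y
    proof -
      obtain c z where cz: "c \<in> lower_central G i" "z \<in> P" "u = c \<otimes> z" using u by (auto simp: U_def set_mult_def)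
      have cc: "c \<in> carrier G" "z \<in> carrier G" "y \<in> carrier G"
        using subgroup.mem_carrier[OF lc cz(1)] cz(2) y by auto
      define w where "w = z \<otimes> y \<otimes> inv z"
      have w: "w \<in> P" "w \<in> carrier G" using cz(2) y cc by (auto simp: w_def)
      have cw: "inv w \<otimes> (w \<otimes> t) = t" "w \<otimes> (inv w \<otimes> t) = t" if "t \<in> carrier G" for t
        using w that by (simp_all add: m_assoc[symmetric])
      \<comment> \<open>Conjugation by \<open>c\<close> changes \<open>w\<close> by a commutator in
        the next term of the lower central series, so the conjugate lies in
        \<open>U (Suc i)\<close>. Its power with exponent |P| is trivial, so the induction
        hypothesis puts it into \<open>P\<close>.\<close>
      have eq: "u \<otimes> y \<otimes> inv u = (c \<otimes> w \<otimes> inv c \<otimes> inv w) \<otimes> w"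
      proof -
        have "u \<otimes> y \<otimes> inv u = c \<otimes> w \<otimes> inv c" using cc by (simp add: cz(3) w_def inv_mult_group m_assoc)
        also have "\<dots> = (c \<otimes> w \<otimes> inv c \<otimes> inv w) \<otimes> w" using cc w by (simp add: m_assoc)
        finally show ?thesis .
      qed
      have "u \<otimes> y \<otimes> inv u \<in> U (Suc i)"
        unfolding eq U_def set_mult_def using lower_central_commutator[OF cz(1) w(2)] w(1) by blast
      moreover have "(u \<otimes> y \<otimes> inv u) [^] card P = \<one>"
        using conj_pow[of u y "card P"] powP[OF y] subgroup.mem_carrier[OF U_sub u] cc by simp
      ultimately show ?thesis using step.IH by blast
    qed
    have "P \<lhd> G\<lparr>carrier := U i\<rparr>"
    proof (rule UG.normal_invI[OF PsU])
      fix x h assume "x \<in> carrier (G\<lparr>carrier := U i\<rparr>)" "h \<in> P"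
      then show "x \<otimes>\<^bsub>G\<lparr>carrier := U i\<rparr>\<^esub> h \<otimes>\<^bsub>G\<lparr>carrier := U i\<rparr>\<^esub> inv\<^bsub>G\<lparr>carrier := U i\<rparr>\<^esub> x \<in> P"
        using conj m_inv_consistent[OF U_sub] by simp
    qed
    moreover have "finite (carrier (G\<lparr>carrier := U i\<rparr>))"
      using subgroup.subset[OF U_sub[of i]] fin by (simp add: finite_subset)
    moreover have "coprime (card P) (card (rcosets\<^bsub>G\<lparr>carrier := U i\<rparr>\<^esub> P))"
    proof -
      obtain c where c: "card (carrier G) = card (U i) * c"
        using card_subgroup_dvd[OF U_sub[of i]] by blast
      have "card (rcosets\<^bsub>G\<lparr>carrier := U i\<rparr>\<^esub> P) * card P = card (U i)"
        using UG.lagrange[OF PsU] by (simp add: Coset.order_def)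
      then have "card P * card (rcosets P) = card P * (card (rcosets\<^bsub>G\<lparr>carrier := U i\<rparr>\<^esub> P) * c)"
        using lagrange[OF P] c by (simp add: Coset.order_def mult_ac)
      moreover have "card P > 0" using finP P.one_closed by (metis card_gt_0_iff empty_iff)
      ultimately have "card (rcosets\<^bsub>G\<lparr>carrier := U i\<rparr>\<^esub> P) dvd card (rcosets P)" by simp
      then show ?thesis using cop by (rule coprime_divisors[OF dvd_refl])
    qed
    ultimately have main: "x [^]\<^bsub>G\<lparr>carrier := U i\<rparr>\<^esub> card P = \<one>\<^bsub>G\<lparr>carrier := U i\<rparr>\<^esub> \<Longrightarrow> x \<in> P" if "x \<in> U i" for x
      using UG.coset_pow_coprime[of P x] that by simp
    show ?case
    proof (intro ballI impI)
      fix x assume "x \<in> U i" "x [^] card P = \<one>"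
      then show "x \<in> P" using main[of x] nat_pow_consistent[of x "card P" "U i"] by simp
    qed
  qed
  have "x \<in> U 0"
    unfolding U_def set_mult_def using x(1) P.one_closed
    by (intro UN_I[of x] UN_I[of \<one>]) auto
  then show ?thesis using step[of 0] x(2) by blast
qed

text \<open>Described by x^b = 1, the subgroup is visibly stable under every endomorphism. Induction
  removes one prime \<open>p\<close> from \<open>b\<close>: the solution set for the remaining
  factor is normal, its product with a Sylow \<open>p\<close>-subgroup has order \<open>b\<close>,
  and by \<open>nilpotent_hall_contains\<close> any subgroup of order \<open>b\<close> is the
  solution set.\<close>

lemma (in group) nilpotent_hall_subgroup:
  assumes nil: "nilpotent G" and fin: "finite (carrier G)"
  shows "b * a = card (carrier G) \<Longrightarrow> coprime b a \<Longrightarrow>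
    subgroup {x \<in> carrier G. x [^] b = \<one>} G \<and> card {x \<in> carrier G. x [^] b = \<one>} = b"
proof (induction b arbitrary: a rule: less_induct)
  case (less b)
  have n0: "card (carrier G) > 0" using fin by (auto simp: card_gt_0_iff)
  have b0: "b > 0" using less.prems(1) n0 by (auto intro: Nat.gr0I)
  have reduce: ?case if H: "subgroup H G" "card H = b" for H
  proof -
    have "finite H" using subgroup.subset[OF H(1)] fin by (rule finite_subset)
    have "b * card (rcosets H) = b * a" using lagrange[OF H(1)] H(2) less.prems(1) by (simp add: Coset.order_def mult.commute)
    then have "card (rcosets H) = a" using b0 by simp
    then have sub1: "x \<in> H" if "x \<in> carrier G" "x [^] b = \<one>" for x
      using nilpotent_hall_contains[OF nil fin H(1) _ that(1)] H(2) less.prems(2) that(2) by simp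
    interpret HG: group "G\<lparr>carrier := H\<rparr>" by (rule subgroup.subgroup_is_group[OF H(1) is_group])
    have "x [^] b = \<one>" if "x \<in> H" for x
      using HG.pow_order_eq_1[of x] that nat_pow_consistent[of x b H] H(2) by (simp add: Coset.order_def)
    then have "{x \<in> carrier G. x [^] b = \<one>} = H" using sub1 subgroup.subset[OF H(1)] by blast
    then show ?thesis using H by simp
  qed
  show ?case
  proof (cases "b = 1")
    case True
    show ?thesis by (rule reduce[of "{\<one>}"]) (use True triv_subgroup in auto)
  next
    case False
    then obtain p where p: "Factorial_Ring.prime p" "p dvd b" using prime_factor_nat by blast
    define k where "k = multiplicity p b"
    obtain c where c: "b = p ^ k * c" "\<not> p dvd c"
      using multiplicity_decompose'[of b p] b0 p(1) unfolding k_def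
      by (metis not_prime_unit not_gr_zero)
    have k: "k > 0" using p(2) c by (metis gr0I mult_1 power_0)
    have p1: "p > 1" using p(1) by (rule prime_gt_1_nat)
    have c0: "c > 0" using b0 c(1) by (auto intro: Nat.gr0I)
    have "p ^ k > 1" using p1 k by (rule one_less_power)
    then have "c < b" using c(1) c0 by simp
    have pc: "coprime (p ^ k) c" using p(1) c(2) by (simp add: prime_imp_coprime)
    have "coprime c (p ^ k * a)"
      using pc less.prems(2) c(1) by (simp add: coprime_commute)
    moreover have "c * (p ^ k * a) = card (carrier G)" using less.prems(1) c(1) by (simp add: mult_ac)
    ultimately have IH: "subgroup {x \<in> carrier G. x [^] c = \<one>} G" "card {x \<in> carrier G. x [^] c = \<one>} = c"
      using less.IH[OF \<open>c < b\<close>, of "p ^ k * a"] by auto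
    define C where "C = {x \<in> carrier G. x [^] c = \<one>}"
    have C: "subgroup C G" "card C = c" using IH by (auto simp: C_def)
    have Cn: "C \<lhd> G"
    proof (rule normal_invI[OF C(1)])
      fix x h assume "x \<in> carrier G" "h \<in> C"
      then show "x \<otimes> h \<otimes> inv x \<in> C" using conj_pow[of x h c] by (simp add: C_def)
    qed
    have "card (carrier G) = p ^ k * (c * a)" using less.prems(1) c(1) by (simp add: mult_ac)
    then obtain P where P: "subgroup P G" "card P = p ^ k"
      using sylow_thm[OF p(1) is_group _ fin] unfolding Coset.order_def by blast
    have int: "subgroup (C \<inter> P) G" by (rule subgroups_Inter_pair[OF C(1) P(1)])
    have "card (C \<inter> P) dvd c" "card (C \<inter> P) dvd p ^ k"
      using card_subgroup_dvd_subgroup[OF int C(1)] card_subgroup_dvd_subgroup[OF int P(1)] C(2) P(2) by auto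
    then have "card (C \<inter> P) = 1" using pc by (metis coprime_common_divisor_nat)
    then have "card (C <#> P) = b" using card_set_mult_Int[OF C(1) P(1) fin] C(2) P(2) c(1) by (simp add: mult.commute)
    then show ?thesis using reduce[OF mult_norm_subgroup[OF Cn P(1)]] by blast
  qed
qed

section \<open>Groups in crossed bijection with a nilpotent group\<close>

lemma (in group) solvable_seq_consistent:
  assumes B: "subgroup B G" and H: "subgroup H G" "H \<subseteq> B"
  shows "solvable_seq (G\<lparr>carrier := B\<rparr>) H \<longleftrightarrow> solvable_seq G H"
proof -
  interpret BG: group "G\<lparr>carrier := B\<rparr>" by (rule subgroup.subgroup_is_group[OF B is_group])
  have "(derived (G\<lparr>carrier := B\<rparr>) ^^ n) H = (derived G ^^ n) H \<and> (derived G ^^ n) H \<subseteq> B" for n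
  proof (induction n)
    case (Suc n)
    then show ?case using derived_consistent[OF _ B] derived_incl[OF _ B] by simp
  qed (use H in simp)
  then have eq: "(derived (G\<lparr>carrier := B\<rparr>) ^^ n) H = (derived G ^^ n) H" for n by blast
  show ?thesis
    using BG.solvable_imp_trivial_derived_seq[of H] BG.trivial_derived_seq_imp_solvable[OF subgroup_incl[OF H(1) B H(2)]]
      solvable_imp_trivial_derived_seq[of H] trivial_derived_seq_imp_solvable[OF H(1)] eq by auto
qed

lemma (in group) finite_subgroupI:
  assumes fin: "finite (carrier G)" and H: "H \<subseteq> carrier G" "H \<noteq> {}"
    and closed: "\<And>x y. x \<in> H \<Longrightarrow> y \<in> H \<Longrightarrow> x \<otimes> y \<in> H"
  shows "subgroup H G"
proof (rule subgroupI[OF H])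
  fix x assume x: "x \<in> H"
  have xc: "x \<in> carrier G" using x H by blast
  have pow: "x [^] Suc m \<in> H" for m
    by (induction m) (use x closed xc in auto)
  define n where "n = card (carrier G)"
  have "n > 0" using fin xc by (auto simp: n_def card_gt_0_iff)
  have "x [^] n = \<one>" using pow_order_eq_1[OF xc] by (simp add: Coset.order_def n_def)
  \<comment> \<open>The exponent 2 n - 1 is positive even for n = 1, so the inverse is a product of
    copies of \<open>x\<close>; with n - 1 it could be an empty product.\<close>
  then have "x [^] (2 * n - 1) \<otimes> x = \<one>"
    using \<open>n > 0\<close> xc nat_pow_mult[of x n n] by (simp flip: nat_pow_Suc add: mult_2)
  then have "inv x = x [^] (2 * n - 1)" using xc by (intro inv_equality) auto
  also have "\<dots> = x [^] Suc (2 * n - 2)" using \<open>n > 0\<close> by (intro arg_cong[of _ _ "\<lambda>m. x [^] (m :: nat)"]) simp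
  finally show "inv x \<in> H" using pow by simp
qed (fact closed)

text \<open>Up to the order of factors \<pi> is a bijective crossed homomorphism. A subgroup of
  \<open>N\<close> stable under all endomorphisms therefore pulls back to a subgroup of
  \<open>G\<close>, and the solution sets of power equations are of this kind.\<close>

theorem (in group) solvable_of_crossed_bijection:
  assumes fin: "finite (carrier G)" and N: "group N" "nilpotent N"
    and bij: "bij_betw \<pi> (carrier G) (carrier N)"
    and cross: "\<And>x. x \<in> carrier G \<Longrightarrow>
      \<exists>\<phi>\<in>hom N N. \<forall>y\<in>carrier G. \<pi> (x \<otimes> y) = \<phi> (\<pi> y) \<otimes>\<^bsub>N\<^esub> \<pi> x"
  shows "solvable G"
proof -
  interpret N: group N by fact
  have finN: "finite (carrier N)" using bij fin by (simp add: bij_betw_finite)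
  have cardN: "card (carrier N) = card (carrier G)" using bij by (simp add: bij_betw_same_card)
  have \<pi>c: "\<pi> x \<in> carrier N" if "x \<in> carrier G" for x using bij that by (auto simp: bij_betw_def)
  define B where "B b = {x \<in> carrier G. \<pi> x [^]\<^bsub>N\<^esub> b = \<one>\<^bsub>N\<^esub>}" for b :: nat
  have B: "subgroup (B b) G \<and> card (B b) = b" if ba: "b * a = card (carrier G)" "coprime b a" for a b
  proof
    define H where "H = {x \<in> carrier N. x [^]\<^bsub>N\<^esub> b = \<one>\<^bsub>N\<^esub>}"
    have H: "subgroup H N" "card H = b"
      using N.nilpotent_hall_subgroup[OF N(2) finN, of b a] ba cardN by (auto simp: H_def)
    have B_iff: "x \<in> B b \<longleftrightarrow> x \<in> carrier G \<and> \<pi> x \<in> H" for x using \<pi>c by (auto simp: B_def H_def)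
    have img: "\<pi> ` B b = H"
    proof -
      have "\<pi> ` carrier G = carrier N" using bij by (simp add: bij_betw_def)
      then have "y \<in> \<pi> ` B b" if "y \<in> H" for y using that subgroup.subset[OF H(1)] B_iff by fastforce
      then show ?thesis using B_iff by blast
    qed
    have "inj_on \<pi> (B b)" using bij by (auto simp: bij_betw_def B_def intro: inj_on_subset)
    then show "card (B b) = b" using card_image[of \<pi> "B b"] img H(2) by simp
    show "subgroup (B b) G"
    proof (rule finite_subgroupI[OF fin])
      show "B b \<subseteq> carrier G" by (auto simp: B_def)
      show "B b \<noteq> {}" using img subgroup.one_closed[OF H(1)] by blast
      fix x y assume xy: "x \<in> B b" "y \<in> B b"
      then have c: "x \<in> carrier G" "y \<in> carrier G" by (auto simp: B_def)
      obtain \<phi> where \<phi>: "\<phi> \<in> hom N N" "\<pi> (x \<otimes> y) = \<phi> (\<pi> y) \<otimes>\<^bsub>N\<^esub> \<pi> x" using cross[OF c(1)] c by blast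
      interpret \<phi>: group_hom N N \<phi> by unfold_locales (rule \<phi>(1))
      have "\<phi> (\<pi> y) [^]\<^bsub>N\<^esub> b = \<one>\<^bsub>N\<^esub>"
        using \<phi>.hom_nat_pow[OF \<pi>c[OF c(2)], of b] xy(2) by (simp add: B_def)
      then have "\<phi> (\<pi> y) \<in> H" using \<phi>.hom_closed[OF \<pi>c[OF c(2)]] by (simp add: H_def)
      moreover have "\<pi> x \<in> H" using xy(1) B_iff by blast
      ultimately have "\<pi> (x \<otimes> y) \<in> H" unfolding \<phi>(2) by (rule subgroup.m_closed[OF H(1)])
      then show "x \<otimes> y \<in> B b" using B_iff c by simp
    qed
  qed
  have main: "solvable_seq G (B b)" if "b * a = card (carrier G)" "coprime b a" for a b
    using that
  proof (induction b arbitrary: a rule: less_induct)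
    case (less b)
    have Bb: "subgroup (B b) G" "card (B b) = b" using B[OF less.prems] by auto
    have n0: "card (carrier G) > 0" using fin by (auto simp: card_gt_0_iff)
    have b0: "b > 0" using less.prems(1) n0 by (auto intro: Nat.gr0I)
    interpret BG: group "G\<lparr>carrier := B b\<rparr>" by (rule subgroup.subgroup_is_group[OF Bb(1) is_group])
    have finB: "finite (carrier (G\<lparr>carrier := B b\<rparr>))"
      using subgroup.subset[OF Bb(1)] fin by (simp add: finite_subset)
    have "solvable (G\<lparr>carrier := B b\<rparr>)"
    \<comment> \<open>The two primes may coincide, so all \<open>b\<close> with at most two prime
      factors fall under Burnside's theorem.\<close>
    proof (cases "\<exists>p q. Factorial_Ring.prime p \<and> Factorial_Ring.prime q \<and> prime_factors b \<subseteq> {p, q}")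
      case True
      then show ?thesis using BG.burnside_two_primes[OF finB] Bb(2) by auto
    next
      case False
      then have three: "\<exists>r\<in>prime_factors b. r \<notin> {p, q}" if "Factorial_Ring.prime p" "Factorial_Ring.prime q" for p q
        using that by blast
      \<comment> \<open>The pair 2, 2 is a placeholder: any pair of primes serves to extract a first
        prime factor.\<close>
      obtain p1 where p1: "p1 \<in> prime_factors b" using three[of 2 2] by auto
      then have "Factorial_Ring.prime p1" by auto
      then obtain p2 where p2: "p2 \<in> prime_factors b" "p2 \<noteq> p1" using three[of p1 p1] by auto
      then have "Factorial_Ring.prime p2" by auto
      then obtain p3 where p3: "p3 \<in> prime_factors b" "p3 \<noteq> p1" "p3 \<noteq> p2"
        using three[of p1 p2] \<open>Factorial_Ring.prime p1\<close> by auto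
      \<comment> \<open>Without its full power of \<open>p\<close>, \<open>b\<close> is still a
        coprime factor of the group order. The subgroup \<open>B (c p)\<close> has index a power of
        \<open>p\<close> in \<open>B b\<close>, so three distinct primes give three pairwise coprime
        indices.\<close>
      define c where "c p = b div p ^ multiplicity p b" for p
      have sub: "solvable_seq (G\<lparr>carrier := B b\<rparr>) (B (c p)) \<and>
          card (rcosets\<^bsub>G\<lparr>carrier := B b\<rparr>\<^esub> B (c p)) = p ^ multiplicity p b"
        if p: "p \<in> prime_factors b" for p
      proof -
        define k where "k = multiplicity p b"
        have pp: "Factorial_Ring.prime p" "p dvd b" using p by auto
        have bc: "b = p ^ k * c p" unfolding c_def k_def using multiplicity_dvd[of p b] by simp
        have "\<not> p dvd c p" unfolding c_def using multiplicity_decompose[of b p] b0 pp(1) not_prime_unit by auto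
        then have pc: "coprime (p ^ k) (c p)" using pp(1) by (simp add: prime_imp_coprime)
        have "k > 0" using p unfolding k_def by (simp add: prime_factors_multiplicity)
        then have "p ^ k > 1" using prime_gt_1_nat[OF pp(1)] by (intro one_less_power)
        moreover have c0: "c p > 0" using b0 bc by (metis mult_0_right not_gr_zero)
        ultimately have lt: "c p < b" using bc by (metis mult.commute mult.right_neutral mult_less_cancel2 nat_mult_1)
        have eq: "c p * (p ^ k * a) = card (carrier G)" using less.prems(1) bc by (metis mult.assoc mult.commute)
        have cop: "coprime (c p) (p ^ k * a)"
        proof -
          have "coprime (p ^ k * c p) a" using less.prems(2) bc by simp
          then show ?thesis using pc by (simp add: coprime_commute)
        qed
        have Bc: "subgroup (B (c p)) G" "card (B (c p)) = c p" using B[OF eq cop] by auto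
        have incl: "B (c p) \<subseteq> B b"
        proof
          fix x assume x: "x \<in> B (c p)"
          have "\<pi> x [^]\<^bsub>N\<^esub> (c p * p ^ k) = (\<pi> x [^]\<^bsub>N\<^esub> c p) [^]\<^bsub>N\<^esub> (p ^ k)"
            using x \<pi>c by (intro N.nat_pow_pow[symmetric]) (simp add: B_def)
          also have "\<dots> = \<one>\<^bsub>N\<^esub>" using x by (simp add: B_def)
          finally have "\<pi> x [^]\<^bsub>N\<^esub> b = \<one>\<^bsub>N\<^esub>" using bc by (simp add: mult.commute)
          then show "x \<in> B b" using x by (simp add: B_def)
        qed
        have "solvable_seq (G\<lparr>carrier := B b\<rparr>) (B (c p))"
          using less.IH[OF lt eq cop] solvable_seq_consistent[OF Bb(1) Bc(1) incl] by blast
        moreover have "card (rcosets\<^bsub>G\<lparr>carrier := B b\<rparr>\<^esub> B (c p)) * c p = p ^ k * c p"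
          using BG.lagrange[OF subgroup_incl[OF Bc(1) Bb(1) incl]] Bc(2) Bb(2) bc by (simp add: Coset.order_def)
        ultimately show ?thesis using c0 unfolding k_def by simp
      qed
      have cop: "coprime (card (rcosets\<^bsub>G\<lparr>carrier := B b\<rparr>\<^esub> B (c p))) (card (rcosets\<^bsub>G\<lparr>carrier := B b\<rparr>\<^esub> B (c q)))"
        if "p \<in> prime_factors b" "q \<in> prime_factors b" "p \<noteq> q" for p q
      proof -
        have "coprime p q" using that by (intro primes_coprime) auto
        then show ?thesis using sub[OF that(1)] sub[OF that(2)] by simp
      qed
      show ?thesis
        by (rule BG.wielandt_three_solvable[OF finB, of "B (c p1)" "B (c p2)" "B (c p3)"])
          (use sub cop p1 p2 p3 in auto)
    qed
    then have "solvable_seq (G\<lparr>carrier := B b\<rparr>) (B b)" by (simp add: solvable_def)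
    then show ?case using solvable_seq_consistent[OF Bb(1) Bb(1)] by simp
  qed
  have "B (card (carrier G)) = carrier G"
    using N.pow_order_eq_1 \<pi>c cardN by (auto simp: B_def Coset.order_def)
  then show ?thesis using main[of "card (carrier G)" 1] by (simp add: solvable_def)
qed

section \<open>Regular subgroups and Galois groups\<close>

lemma (in group_hom) lower_central_img:
  assumes surj: "h ` carrier G = carrier H"
  shows "lower_central H n = h ` lower_central G n"
proof (induction n)
  case (Suc n)
  let ?A = "{x \<otimes> g \<otimes> inv x \<otimes> inv g | x g. x \<in> lower_central G n \<and> g \<in> carrier G}"
  have lc: "x \<in> carrier G" if "x \<in> lower_central G n" for x
    using G.lower_central_normal[THEN normal_imp_subgroup] that by (rule subgroup.mem_carrier)
  have comm: "h (x \<otimes> g \<otimes> inv x \<otimes> inv g) = h x \<otimes>\<^bsub>H\<^esub> h g \<otimes>\<^bsub>H\<^esub> inv\<^bsub>H\<^esub> h x \<otimes>\<^bsub>H\<^esub> inv\<^bsub>H\<^esub> h g"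
    if "x \<in> lower_central G n" "g \<in> carrier G" for x g
    using that lc by simp
  have "{y \<otimes>\<^bsub>H\<^esub> g \<otimes>\<^bsub>H\<^esub> inv\<^bsub>H\<^esub> y \<otimes>\<^bsub>H\<^esub> inv\<^bsub>H\<^esub> g | y g. y \<in> lower_central H n \<and> g \<in> carrier H} = h ` ?A"
    (is "?B = _")
  proof (intro equalityI subsetI)
    fix z assume "z \<in> ?B"
    then obtain y g where yg: "z = y \<otimes>\<^bsub>H\<^esub> g \<otimes>\<^bsub>H\<^esub> inv\<^bsub>H\<^esub> y \<otimes>\<^bsub>H\<^esub> inv\<^bsub>H\<^esub> g" "y \<in> h ` lower_central G n" "g \<in> h ` carrier G"
      unfolding Suc surj by blast
    then obtain x g' where "x \<in> lower_central G n" "y = h x" "g' \<in> carrier G" "g = h g'" by blast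
    then show "z \<in> h ` ?A" using yg(1) comm by (intro image_eqI[of _ _ "x \<otimes> g' \<otimes> inv x \<otimes> inv g'"]) auto
  next
    fix z assume "z \<in> h ` ?A"
    then obtain x g where "z = h (x \<otimes> g \<otimes> inv x \<otimes> inv g)" "x \<in> lower_central G n" "g \<in> carrier G" by blast
    then have "z = h x \<otimes>\<^bsub>H\<^esub> h g \<otimes>\<^bsub>H\<^esub> inv\<^bsub>H\<^esub> h x \<otimes>\<^bsub>H\<^esub> inv\<^bsub>H\<^esub> h g \<and>
        h x \<in> lower_central H n \<and> h g \<in> carrier H"
      using comm[of x g] hom_closed[of g] unfolding Suc by simp
    then show "z \<in> ?B" unfolding mem_Collect_eq by (intro exI)
  qed
  then have "lower_central H (Suc n) = generate H (h ` ?A)" by (simp only: lower_central.simps)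
  also have "\<dots> = h ` generate G ?A" using lc by (intro generate_img) auto
  finally show ?case by simp
qed (simp add: surj)

lemma nilpotent_iso:
  assumes "group G" "group H" "h \<in> iso G H" "nilpotent G"
  shows "nilpotent H"
proof -
  interpret group_hom G H h
    using assms(1-3) by (simp add: group_hom_def group_hom_axioms_def iso_def)
  obtain n where n: "lower_central G n = {\<one>\<^bsub>G\<^esub>}" using assms(4) by (auto simp: nilpotent_def)
  have "lower_central H n = {\<one>\<^bsub>H\<^esub>}"
    using lower_central_img[of n] assms(3) n by (simp add: iso_def bij_betw_def)
  then show ?thesis by (auto simp: nilpotent_def)
qed

section \<open>Finiteness of the Galois group\<close>

lemma (in finite_galois_extension) finite_field_auts: "finite (field_auts L K)"
proof -
  have KL: "K \<subseteq> carrier L" by (rule subfieldE(3)[OF subfield_base])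
  obtain n where "dimension n K (carrier L)" using finite_degree by (auto simp: finite_dimension_def)
  then obtain Us where Us: "set Us \<subseteq> carrier L" "Span K Us = carrier L"
    using exists_base[OF subfield_base] by blast
  have "\<exists>p. p \<in> carrier (K[X]) \<and> p \<noteq> [] \<and> eval p u = \<zero>" if u: "u \<in> carrier L" for u
    using algebraicE[OF subfieldE(1)[OF subfield_base] u
        finite_dimension_imp_algebraic[OF subfield_base carrier_is_subring finite_degree u]] by metis
  then obtain p where p: "\<And>u. u \<in> carrier L \<Longrightarrow> p u \<in> carrier (K[X]) \<and> p u \<noteq> [] \<and> eval (p u) u = \<zero>"
    by metis
  \<comment> \<open>An automorphism over \<open>K\<close> sends each \<open>u\<close> of the
    spanning list to a root of a polynomial over \<open>K\<close> that vanishes at \<open>u\<close>.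
    The values on the list determine it and lie in the finite set \<open>Z\<close>.\<close>
  define Z where "Z = (\<Union>u\<in>set Us. {x. is_root (p u) x})"
  have finZ: "finite Z"
    unfolding Z_def
  proof (intro finite_UN_I finite_set)
    fix u assume "u \<in> set Us"
    then have "p u \<in> carrier (poly_ring L)"
      using p Us(1) carrier_polynomial_shell[OF subfieldE(1)[OF subfield_base]] by blast
    then show "finite {x. is_root (p u) x}" by (rule finite_number_of_roots)
  qed
  have hom: "ring_hom_ring L L \<sigma>" if "\<sigma> \<in> field_auts L K" for \<sigma>
    using that ring_axioms by (auto simp: field_auts_def ring_iso_def intro!: ring_hom_ringI2)
  have fix': "map \<sigma> xs = xs" if "\<sigma> \<in> field_auts L K" "set xs \<subseteq> K" for \<sigma> xs
    using that by (intro map_idI) (auto simp: field_auts_def)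
  have img: "map \<sigma> Us \<in> {xs. set xs \<subseteq> Z \<and> length xs = length Us}" if \<sigma>: "\<sigma> \<in> field_auts L K" for \<sigma>
  proof -
    interpret \<sigma>: ring_hom_ring L L \<sigma> by (rule hom[OF \<sigma>])
    have "\<sigma> u \<in> Z" if u: "u \<in> set Us" for u
    proof -
      have uc: "u \<in> carrier L" using u Us(1) by blast
      have pK: "set (p u) \<subseteq> K" using p[OF uc] by (auto simp: univ_poly_def polynomial_def)
      then have "\<sigma> (eval (p u) u) = eval (map \<sigma> (p u)) (\<sigma> u)"
        using \<sigma>.eval_hom'[OF uc, of "p u"] KL by auto
      then have "eval (p u) (\<sigma> u) = \<zero>" using p[OF uc] fix'[OF \<sigma> pK] by simp
      then have "is_root (p u) (\<sigma> u)" using p[OF uc] uc by (simp add: is_root_def)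
      then show ?thesis using u by (auto simp: Z_def)
    qed
    then show ?thesis by auto
  qed
  have "inj_on (\<lambda>\<sigma>. map \<sigma> Us) (field_auts L K)"
  proof (rule inj_onI)
    fix \<sigma> \<tau> assume \<sigma>: "\<sigma> \<in> field_auts L K" and \<tau>: "\<tau> \<in> field_auts L K" and eq: "map \<sigma> Us = map \<tau> Us"
    have comb: "\<rho> (combine Ks Us) = combine Ks (map \<rho> Us)"
      if \<rho>: "\<rho> \<in> field_auts L K" and Ks: "set Ks \<subseteq> K" for \<rho> Ks
    proof -
      interpret \<rho>: ring_hom_ring L L \<rho> by (rule hom[OF \<rho>])
      show ?thesis using \<rho>.combine_hom[of Ks Us] Ks KL Us(1) fix'[OF \<rho> Ks] by auto
    qed
    have "\<sigma> x = \<tau> x" if x: "x \<in> carrier L" for x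
    proof -
      have "x \<in> {combine Ks Us |Ks. set Ks \<subseteq> K}"
        using x unfolding Span_eq_combine_set[OF subfield_base Us(1), symmetric] Us(2) .
      then obtain Ks where Ks: "set Ks \<subseteq> K" "x = combine Ks Us" by blast
      show ?thesis using comb[OF \<sigma> Ks(1)] comb[OF \<tau> Ks(1)] eq Ks(2) by simp
    qed
    moreover have "\<sigma> \<in> extensional (carrier L)" "\<tau> \<in> extensional (carrier L)"
      using \<sigma> \<tau> by (auto simp: field_auts_def Bij_def)
    ultimately show "\<sigma> = \<tau>" by (intro extensionalityI[of \<sigma> "carrier L"]) auto
  qed
  moreover have "(\<lambda>\<sigma>. map \<sigma> Us) ` field_auts L K \<subseteq> {xs. set xs \<subseteq> Z \<and> length xs = length Us}"
    using img by blast
  moreover have "finite {xs. set xs \<subseteq> Z \<and> length xs = length Us}"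
    by (rule finite_lists_length_eq[OF finZ])
  ultimately show ?thesis by (rule inj_on_finite)
qed

text \<open>Sending \<open>x\<close> to the unique element of \<open>N\<close> that maps \<open>\<one>\<close> to \<open>x\<close> identifies \<open>G\<close> with \<open>N\<close>,
  and left translation by \<open>x\<close> acts on \<open>N\<close> by conjugation.\<close>

lemma (in group) solvable_of_regular_nilpotent:
  assumes fin: "finite (carrier G)" and reg: "regular_perm_group (carrier G) N"
    and norm: "left_translation G ` carrier G \<subseteq> normalizer (BijGroup (carrier G)) N"
    and nil: "nilpotent (BijGroup (carrier G) \<lparr>carrier := N\<rparr>)"
  shows "solvable G"
proof -
  define P where "P = BijGroup (carrier G)"
  interpret P: group P unfolding P_def by (rule group_BijGroup)
  have N: "subgroup N P" using reg by (simp add: regular_perm_group_def P_def)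
  interpret N: subgroup N P by (rule N)
  interpret NG: group "P\<lparr>carrier := N\<rparr>" by (rule subgroup.subgroup_is_group[OF N P.is_group])
  have carrP: "f \<in> Bij (carrier G)" if "f \<in> carrier P" for f using that by (simp add: P_def BijGroup_def)
  have app: "(f \<otimes>\<^bsub>P\<^esub> h) x = f (h x)" if "f \<in> carrier P" "h \<in> carrier P" "x \<in> carrier G" for f h x
    using that by (simp add: P_def BijGroup_def compose_def)
  have maps: "f x \<in> carrier G" if "f \<in> carrier P" "x \<in> carrier G" for f x
    using Bij_imp_funcset[OF carrP[OF that(1)]] that(2) by blast
  have inv_app: "(inv\<^bsub>P\<^esub> f) (f x) = x" if "f \<in> carrier P" "x \<in> carrier G" for f x
  proof -
    have "(inv\<^bsub>P\<^esub> f) (f x) = (inv\<^bsub>P\<^esub> f \<otimes>\<^bsub>P\<^esub> f) x" using app[of "inv\<^bsub>P\<^esub> f" f x] that by simp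
    also have "\<dots> = x" using that by (simp add: P.l_inv) (simp add: P_def BijGroup_def)
    finally show ?thesis .
  qed
  define ev where "ev = (\<lambda>\<eta>. \<eta> \<one> :: 'a)"
  have "transitive_action (P\<lparr>carrier := N\<rparr>) (carrier G) (\<lambda>\<eta>. \<eta>)"
    using reg by (simp add: regular_perm_group_def P_def)
  then have surj: "\<exists>\<eta>\<in>N. ev \<eta> = x" if "x \<in> carrier G" for x
    using transitive_action.unique_orbit[of "P\<lparr>carrier := N\<rparr>" "carrier G" "\<lambda>\<eta>. \<eta>" \<one> x] that
    by (auto simp: ev_def)
  have "inj_on ev N"
  proof (rule inj_onI)
    fix \<eta> \<theta> assume e: "\<eta> \<in> N" "\<theta> \<in> N" "ev \<eta> = ev \<theta>"
    have c: "\<eta> \<in> carrier P" "\<theta> \<in> carrier P" using e by auto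
    have "(inv\<^bsub>P\<^esub> \<theta> \<otimes>\<^bsub>P\<^esub> \<eta>) \<one> = \<one>"
      using app[of "inv\<^bsub>P\<^esub> \<theta>" \<eta> \<one>] inv_app[of \<theta> \<one>] c e(3) by (simp add: ev_def)
    moreover have "inv\<^bsub>P\<^esub> \<theta> \<otimes>\<^bsub>P\<^esub> \<eta> \<in> N" using e by simp
    ultimately have "inv\<^bsub>P\<^esub> \<theta> \<otimes>\<^bsub>P\<^esub> \<eta> \<in> stabilizer (P\<lparr>carrier := N\<rparr>) (\<lambda>\<eta>. \<eta>) \<one>"
      by (simp add: stabilizer_def)
    then have "inv\<^bsub>P\<^esub> \<theta> \<otimes>\<^bsub>P\<^esub> \<eta> = \<one>\<^bsub>P\<^esub>"
      using reg unfolding regular_perm_group_def P_def by blast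
    moreover have "\<eta> = \<theta> \<otimes>\<^bsub>P\<^esub> (inv\<^bsub>P\<^esub> \<theta> \<otimes>\<^bsub>P\<^esub> \<eta>)" using c by (simp add: P.m_assoc[symmetric])
    ultimately show "\<eta> = \<theta>" using c by simp
  qed
  moreover have "ev ` N = carrier G"
    using surj maps N.mem_carrier unfolding ev_def by blast
  ultimately have bij: "bij_betw ev N (carrier G)" by (simp add: bij_betw_def)
  define \<pi> where "\<pi> = inv_into N ev"
  have bij': "bij_betw \<pi> (carrier G) N" unfolding \<pi>_def by (rule bij_betw_inv_into[OF bij])
  have ev\<pi>: "\<pi> x \<one> = x" if "x \<in> carrier G" for x
    using bij_betw_inv_into_right[OF bij that] by (simp add: \<pi>_def ev_def)
  have \<pi>N: "\<pi> x \<in> N" if "x \<in> carrier G" for x using bij' that by (auto simp: bij_betw_def)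
  show ?thesis
  proof (rule solvable_of_crossed_bijection[OF fin NG.is_group])
    show "nilpotent (P\<lparr>carrier := N\<rparr>)" using nil by (simp add: P_def)
    show "bij_betw \<pi> (carrier G) (carrier (P\<lparr>carrier := N\<rparr>))" using bij' by simp
    fix x assume x: "x \<in> carrier G"
    define l where "l = left_translation G x"
    have "l \<in> normalizer P N" using norm x by (auto simp: l_def P_def)
    then have l: "l \<in> carrier P" "l <#\<^bsub>P\<^esub> N #>\<^bsub>P\<^esub> inv\<^bsub>P\<^esub> l = N"
      using N.subset by (auto simp: normalizer_def stabilizer_def)
    have l_app: "l y = x \<otimes> y" if "y \<in> carrier G" for y
      using that by (simp add: l_def left_translation_def)
    define \<phi> where "\<phi> = (\<lambda>\<eta>. l \<otimes>\<^bsub>P\<^esub> \<eta> \<otimes>\<^bsub>P\<^esub> inv\<^bsub>P\<^esub> l)"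
    have \<phi>N: "\<phi> \<eta> \<in> N" if "\<eta> \<in> N" for \<eta>
      using that l(2) unfolding \<phi>_def l_coset_def r_coset_def by blast
    have "\<phi> \<in> hom (P\<lparr>carrier := N\<rparr>) (P\<lparr>carrier := N\<rparr>)"
    proof (rule homI)
      fix \<eta> \<theta> assume "\<eta> \<in> carrier (P\<lparr>carrier := N\<rparr>)" "\<theta> \<in> carrier (P\<lparr>carrier := N\<rparr>)"
      then have c: "\<eta> \<in> carrier P" "\<theta> \<in> carrier P" by auto
      have "inv\<^bsub>P\<^esub> l \<otimes>\<^bsub>P\<^esub> (l \<otimes>\<^bsub>P\<^esub> (\<theta> \<otimes>\<^bsub>P\<^esub> inv\<^bsub>P\<^esub> l)) = \<theta> \<otimes>\<^bsub>P\<^esub> inv\<^bsub>P\<^esub> l"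
        using c l(1) by (simp add: P.m_assoc[symmetric])
      then show "\<phi> (\<eta> \<otimes>\<^bsub>P\<lparr>carrier := N\<rparr>\<^esub> \<theta>) = \<phi> \<eta> \<otimes>\<^bsub>P\<lparr>carrier := N\<rparr>\<^esub> \<phi> \<theta>"
        using c l(1) by (simp add: \<phi>_def P.m_assoc)
    qed (use \<phi>N in simp)
    \<comment> \<open>Both sides lie in \<open>N\<close>, where evaluation at \<open>\<one>\<close>
      is injective. As \<open>l\<close> takes \<open>\<one>\<close> to \<open>x\<close>, the
      conjugate of \<pi> y by \<open>l\<close> takes \<open>x\<close> to
      \<open>x \<otimes> y\<close>, so both sides take \<open>\<one>\<close> to
      \<open>x \<otimes> y\<close>.\<close>
    moreover have "\<pi> (x \<otimes> y) = \<phi> (\<pi> y) \<otimes>\<^bsub>P\<lparr>carrier := N\<rparr>\<^esub> \<pi> x" if y: "y \<in> carrier G" for y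
    proof -
      have c: "\<pi> x \<in> carrier P" "\<pi> y \<in> carrier P" using \<pi>N x y by auto
      have "(inv\<^bsub>P\<^esub> l) x = \<one>" using inv_app[OF l(1), of \<one>] l_app[of \<one>] x by simp
      then have "\<phi> (\<pi> y) x = x \<otimes> y"
        using app[of "l \<otimes>\<^bsub>P\<^esub> \<pi> y" "inv\<^bsub>P\<^esub> l" x] app[of l "\<pi> y" \<one>] c l(1) x y
        by (simp add: \<phi>_def ev\<pi> l_app)
      then have "ev (\<phi> (\<pi> y) \<otimes>\<^bsub>P\<^esub> \<pi> x) = x \<otimes> y"
        using app[of "\<phi> (\<pi> y)" "\<pi> x" \<one>] c \<phi>N[OF \<pi>N[OF y]] x by (simp add: ev_def ev\<pi>)
      moreover have "ev (\<pi> (x \<otimes> y)) = x \<otimes> y" using ev\<pi> x y by (simp add: ev_def)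
      moreover have "\<phi> (\<pi> y) \<otimes>\<^bsub>P\<^esub> \<pi> x \<in> N" using \<phi>N \<pi>N x y by simp
      ultimately show ?thesis using bij \<pi>N x y by (simp add: bij_betw_def inj_on_def)
    qed
    ultimately show "\<exists>\<phi>\<in>hom (P\<lparr>carrier := N\<rparr>) (P\<lparr>carrier := N\<rparr>). \<forall>y\<in>carrier G.
        \<pi> (x \<otimes> y) = \<phi> (\<pi> y) \<otimes>\<^bsub>P\<lparr>carrier := N\<rparr>\<^esub> \<pi> x" by blast
  qed
qed

lemma (in finite_galois_extension) solvable_galois_group:
  fixes G :: "('g, 'c) monoid_scheme"
  assumes G: "group G" "admits_hopf_galois_of_type L K G" "nilpotent G"
  shows "solvable (galois_group L K)"
proof -
  define \<Gamma> where "\<Gamma> = galois_group L K"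
  interpret \<Gamma>: group \<Gamma> unfolding \<Gamma>_def by (rule group_galois_group)
  have fin: "finite (carrier \<Gamma>)" using finite_field_auts by (simp add: \<Gamma>_def galois_group_def)
  obtain N where N: "regular_perm_group (carrier \<Gamma>) N"
      "left_translation \<Gamma> ` carrier \<Gamma> \<subseteq> normalizer (BijGroup (carrier \<Gamma>)) N"
      "BijGroup (carrier \<Gamma>) \<lparr>carrier := N\<rparr> \<cong> G"
    using G(2) unfolding admits_hopf_galois_of_type_def Let_def \<Gamma>_def by blast
  have NG: "group (BijGroup (carrier \<Gamma>) \<lparr>carrier := N\<rparr>)"
    using N(1) subgroup.subgroup_is_group[OF _ group_BijGroup] by (auto simp: regular_perm_group_def)
  obtain h where "h \<in> iso G (BijGroup (carrier \<Gamma>) \<lparr>carrier := N\<rparr>)"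
    using group.iso_sym[OF NG N(3)] by (auto simp: is_iso_def)
  then have "nilpotent (BijGroup (carrier \<Gamma>) \<lparr>carrier := N\<rparr>)"
    by (rule nilpotent_iso[OF G(1) NG _ G(3)])
  then show ?thesis
    using \<Gamma>.solvable_of_regular_nilpotent[OF fin N(1,2)] by (simp add: \<Gamma>_def)
qed

text \<open>A type is an isomorphism class, and the regular subgroup itself represents it among
  permutations of the Galois group. The element type chosen for \<open>H\<close> in the second part
  thus covers every nilpotent type.\<close>

theorem theorem1:
  fixes L :: "('a, 'b) ring_scheme" and K :: "'a set" and G :: "('g, 'c) monoid_scheme"
  assumes "finite_galois_extension L K"
  shows "(group G \<and> admits_hopf_galois_of_type L K G \<and> nilpotent G
            \<longrightarrow> solvable (galois_group L K)) \<and>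
         ((\<exists>H :: (('a \<Rightarrow> 'a) \<Rightarrow> 'a \<Rightarrow> 'a) monoid.
              group H \<and> admits_hopf_galois_of_type L K H \<and> nilpotent H)
            \<longrightarrow> solvable (galois_group L K))"
proof (intro conjI impI)
  assume "group G \<and> admits_hopf_galois_of_type L K G \<and> nilpotent G"
  then show "solvable (galois_group L K)"
    using finite_galois_extension.solvable_galois_group[OF assms, of G] by simp
next
  assume "\<exists>H :: (('a \<Rightarrow> 'a) \<Rightarrow> 'a \<Rightarrow> 'a) monoid.
    group H \<and> admits_hopf_galois_of_type L K H \<and> nilpotent H"
  then obtain H :: "(('a \<Rightarrow> 'a) \<Rightarrow> 'a \<Rightarrow> 'a) monoid"
    where "group H" "admits_hopf_galois_of_type L K H" "nilpotent H" by blast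
  then show "solvable (galois_group L K)"
    by (rule finite_galois_extension.solvable_galois_group[OF assms])
qed

end
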